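(* Let $s'>s\ge 1$ be real numbers. Then: (i) every polynomially convex compact set $E\subset\mathbb{C}$ that admits the Łojasiewicz–Siciak inequality $\mathrm{LS}(s)$ and the Hölder Continuity Property $\mathrm{HCP}$ admits the Jackson Property $\mathrm{JP}(s)$; (ii) every compact set $E\subset\mathbb{C}$ that admits $\mathrm{JP}(s)$ admits $\mathrm{LS}(s')$.
   Context: $\mathbb{N}=\{1,2,\dots\}$. $\mathcal{P}_n$ is the set of complex polynomials in one complex variable of degree at most $n$. For a compact set $E\subset\mathbb{C}$: $\|\cdot\|_E$ is the supremum norm on $E$; $\mathcal{C}(E)$ is the space of continuous complex functions on $E$; $\operatorname{dist}_E(f,\mathcal{P}_n):=\inf\{\|f-p\|_E : p\in\mathcal{P}_n\}$; $s(E):=\{f\in\mathcal{C}(E) : \forall \ell\in\mathbb{N},\ \lim_{n\to\infty} n^\ell\operatorname{dist}_E(f,\mathcal{P}_n)=0\}$; $|f|_\ell:=\|f\|_E+\sup_{n\in\mathbb{N}} n^\ell\operatorname{dist}_E(f,\mathcal{P}_n)$. For $\delta>0$, $E_\delta:=\{z\in\mathbb{C} : \operatorname{dist}(z,E)\le\delta\}$. For a compact set $K$, $\mathcal{H}^\infty(K):=\{f\in\mathcal{C}^\infty(\mathbb{C}) : \partial f/\partial\bar z\equiv 0$ in some open neighborhood of $K\}$, and $\mathcal{H}^\infty(E)_{|E}:=\{f_{|E}: f\in\mathcal{H}^\infty(E)\}$. The polynomial hull is $\hat E:=\{z\in\mathbb{C} : |p(z)|\le\|p\|_E \text{ for all polynomials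 } p\}$, and $E$ is polynomially convex if $E=\hat E$. Extremal and Green's functions: for $n\in\mathbb{N}$, $\Phi_n(z):=\sup\{|p(z)| : p\in\mathcal{P}_n,\ \|p\|_E\le 1\}$; $\Phi_E(z):=\limsup_{n\to\infty}\Phi_n(z)^{1/n}$; $g_E$ is the Green's function of $\mathbb{C}\setminus\hat E$ with logarithmic pole at infinity, extended by $g_E:=0$ on $\hat E$; one has $\Phi_E=e^{g_E}$, i.e. $g_E=\log\Phi_E$ (the value $+\infty$ being allowed). $\mathrm{JP}(s)$ (for $s\ge1$): $\mathcal{H}^\infty(E)_{|E}\subset s(E)$ and there exist constants $c,v\ge1$ such that for all $\ell\in\mathbb{N}$, all $\delta\in(0,1]$ and all $f\in\mathcal{H}^\infty(E_\delta)$, $$|f_{|E}|_\ell\le\left(\frac{c\,\ell^v}{\delta^s}\right)^{\ell+c}\|f\|_{E_\delta}.$$ $\mathrm{LS}(s)$ (for $s\ge1$): there exists $M>0$ such that $g_E(z)\ge M\operatorname{dist}(z,E)^s$ for all $z\in E_1$. $\mathrm{HCP}(k)$ (for $k\ge1$): there exists $M\ge1$ such that $g_E(z)\le M\operatorname{dist}(z,E)^{1/k}$ for all $z\in E_1$. $E$ admits $\mathrm{HCP}$ if it admits $\mathrm{HCP}(k)$ for some $k\ge1$. *)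

theory Defs
  imports
    "HOL-Analysis.Analysis"
    "HOL-Library.Landau_Symbols"
    "HOL-Computational_Algebra.Polynomial"
begin

subsection \<open>Polynomial approximation\<close>

text \<open>A function on \<open>E\<close> is represented by any total function that extends it; all notions in this
  subsection depend only on the values on \<open>E\<close>. Norms take values in \<^typ>\<open>ennreal\<close>, so that
  suprema and infima always exist and the supremum norm over the empty set is 0.\<close>

definition sup_norm_on :: "complex set \<Rightarrow> (complex \<Rightarrow> complex) \<Rightarrow> ennreal" where
  "sup_norm_on E f = (SUP z\<in>E. ennreal (norm (f z)))"

definition poly_dist :: "complex set \<Rightarrow> (complex \<Rightarrow> complex) \<Rightarrow> nat \<Rightarrow> ennreal" where
  "poly_dist E f n = (INF p\<in>{p. degree p \<le> n}. sup_norm_on E (\<lambda>z. f z - poly p z))"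

definition rapid_approx :: "complex set \<Rightarrow> (complex \<Rightarrow> complex) set"  \<comment> \<open>the space \<open>s(E)\<close>\<close> where
  "rapid_approx E = {f. continuous_on E f \<and>
     (\<forall>l\<ge>1. (\<lambda>n. of_nat n ^ l * poly_dist E f n) \<longlonglongrightarrow> 0)}"

definition jackson_norm :: "complex set \<Rightarrow> nat \<Rightarrow> (complex \<Rightarrow> complex) \<Rightarrow> ennreal"  \<comment> \<open>\<open>|f|\<^sub>l\<close>\<close> where
  "jackson_norm E l f = sup_norm_on E f + (SUP n\<in>{1..}. of_nat n ^ l * poly_dist E f n)"

definition poly_hull :: "complex set \<Rightarrow> complex set" where
  "poly_hull E = {z. \<forall>p :: complex poly. ennreal (norm (poly p z)) \<le> sup_norm_on E (poly p)}"

definition polynomially_convex :: "complex set \<Rightarrow> bool" where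
  "polynomially_convex E \<longleftrightarrow> E = poly_hull E"

text \<open>The condition \<^term>\<open>E \<noteq> {}\<close> matters because \<^term>\<open>infdist z {} = 0\<close> in the library, whereas
  the distance to the empty set should be infinite here.\<close>

definition enlargement :: "complex set \<Rightarrow> real \<Rightarrow> complex set" where
  "enlargement E \<delta> = {z. E \<noteq> {} \<and> infdist z E \<le> \<delta>}"

subsection \<open>Smooth, harmonic and \<open>\<partial>\<close>-bar-flat functions\<close>

definition dir_deriv :: "complex \<Rightarrow> (complex \<Rightarrow> 'b::real_normed_vector) \<Rightarrow> complex \<Rightarrow> 'b" where
  "dir_deriv v f z = frechet_derivative f (at z) v"

text \<open>With \<open>z = x + \<i>y\<close>, the operators \<open>dir_deriv 1\<close> and \<open>dir_deriv \<i>\<close> are \<open>\<partial>/\<partial>x\<close> and \<open>\<partial>/\<partial>y\<close>.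
  The following describes \<open>C\<^sup>k\<close> functions (in the real sense) on an open set \<open>S\<close>.\<close>

primrec Ck_on :: "nat \<Rightarrow> complex set \<Rightarrow> (complex \<Rightarrow> 'b::real_normed_vector) \<Rightarrow> bool" where
  "Ck_on 0 S f \<longleftrightarrow> continuous_on S f"
| "Ck_on (Suc k) S f \<longleftrightarrow> (\<forall>z\<in>S. f differentiable (at z)) \<and>
     Ck_on k S (dir_deriv 1 f) \<and> Ck_on k S (dir_deriv \<i> f)"

definition dbar :: "(complex \<Rightarrow> complex) \<Rightarrow> complex \<Rightarrow> complex" where
  "dbar f z = (dir_deriv 1 f z + \<i> * dir_deriv \<i> f z) / 2"

definition H_infinity :: "complex set \<Rightarrow> (complex \<Rightarrow> complex) set" where
  "H_infinity K = {f. (\<forall>k. Ck_on k UNIV f) \<and> (\<exists>U. open U \<and> K \<subseteq> U \<and> (\<forall>z\<in>U. dbar f z = 0))}"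

definition harmonic_on :: "complex set \<Rightarrow> (complex \<Rightarrow> real) \<Rightarrow> bool" where
  "harmonic_on S u \<longleftrightarrow> Ck_on 2 S u \<and>
     (\<forall>z\<in>S. dir_deriv 1 (dir_deriv 1 u) z + dir_deriv \<i> (dir_deriv \<i> u) z = 0)"

subsection \<open>Green's function and the three properties\<close>

text \<open>The Green's function of the complement of the polynomial hull, with logarithmic pole at
  infinity, is the least nonnegative harmonic function \<open>u\<close> there with \<open>u(z) = log |z| + O(1)\<close>
  at infinity. No such \<open>u\<close> exists exactly when \<open>E\<close> is polar; then the infimum below is \<open>\<infinity>\<close>,
  which is the convention for polar sets. The function is extended by 0 to the hull.\<close>

definition green_candidates :: "complex set \<Rightarrow> (complex \<Rightarrow> real) set" where
  "green_candidates E = {u. harmonic_on (- poly_hull E) u \<and> (\<forall>z\<in>- poly_hull E. 0 \<le> u z) \<and>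
     (\<lambda>z. u z - ln (norm z)) \<in> O[at_infinity](\<lambda>_. 1)}"

definition green_function :: "complex set \<Rightarrow> complex \<Rightarrow> ennreal" where
  "green_function E z =
     (if z \<in> poly_hull E then 0 else (INF u\<in>green_candidates E. ennreal (u z)))"

definition Jackson_property :: "real \<Rightarrow> complex set \<Rightarrow> bool" where
  "Jackson_property s E \<longleftrightarrow> H_infinity E \<subseteq> rapid_approx E \<and>
     (\<exists>c\<ge>1. \<exists>v\<ge>1. \<forall>l::nat. l \<ge> 1 \<longrightarrow> (\<forall>\<delta>. 0 < \<delta> \<and> \<delta> \<le> 1 \<longrightarrow>
       (\<forall>f\<in>H_infinity (enlargement E \<delta>).
          jackson_norm E l f \<le>
            ennreal ((c * real l powr v / \<delta> powr s) powr (real l + c)) *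
            sup_norm_on (enlargement E \<delta>) f)))"

definition Lojasiewicz_Siciak :: "real \<Rightarrow> complex set \<Rightarrow> bool" where
  "Lojasiewicz_Siciak s E \<longleftrightarrow>
     (\<exists>M>0. \<forall>z\<in>enlargement E 1. green_function E z \<ge> ennreal (M * infdist z E powr s))"

definition HCP_exponent :: "real \<Rightarrow> complex set \<Rightarrow> bool" where
  "HCP_exponent k E \<longleftrightarrow>
     (\<exists>M\<ge>1. \<forall>z\<in>enlargement E 1. green_function E z \<le> ennreal (M * infdist z E powr (1 / k)))"

definition Hoelder_continuity_property :: "complex set \<Rightarrow> bool" where
  "Hoelder_continuity_property E \<longleftrightarrow> (\<exists>k\<ge>1. HCP_exponent k E)"

end

theory Submission
  imports Defs "HOL-Complex_Analysis.Complex_Analysis"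
begin

text \<open>Write \<open>g\<close> for the Green's function and \<open>d(z)\<close> for the distance from \<open>z\<close> to \<open>E\<close>.

The link between \<open>g\<close> and polynomials is the Bernstein--Walsh inequality \<open>bernstein_walsh\<close>: a
polynomial of degree at most \<open>m\<close> that is bounded by 1 on \<open>E\<close> is bounded by \<open>exp (m u)\<close> for every
candidate \<open>u\<close> for \<open>g\<close>, hence by \<open>exp (m g)\<close>. It follows from the maximum principle
\<open>harmonic_maximum_principle\<close> for products \<open>|F| exp (c u)\<close> with \<open>F\<close> holomorphic.

From Jackson to Lojasiewicz--Siciak (\<open>jackson_imp_LS\<close>): for \<open>d(a) = \<delta>\<close>, the function \<open>1/(z - a)\<close>,
smoothly modified near \<open>a\<close>, belongs to the class on the enlargement by \<open>\<delta>/2\<close> and has norm at most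
\<open>2/\<delta>\<close> there. The Jackson property with a fixed large \<open>l\<close> gives a polynomial \<open>p\<close> of degree
\<open>n \<approx> \<delta>^(-s')\<close> for which \<open>q = 1 - (z - a) p\<close> is at most \<open>1/e\<close> on \<open>E\<close>, while \<open>q(a) = 1\<close>.
By Bernstein--Walsh, \<open>g(a) \<ge> 1/(n + 1)\<close>. The loss from \<open>s\<close> to \<open>s'\<close> comes from the additive
constant in the exponent \<open>l + c\<close>, whose influence vanishes as \<open>l\<close> grows.

From Lojasiewicz--Siciak and HCP to Jackson (\<open>LS_HCP_imp_jackson\<close>): \<open>f\<close> is approximated by its
Lagrange interpolant at a near-Fekete set \<open>A\<close> of \<open>N\<close> points, a set on which the basis polynomials
are bounded by 2 on \<open>E\<close>. The error \<open>f(z) - Lf(z)\<close> is the integral of \<open>f\<close> against a finite measure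
whose Cauchy transform \<open>K\<close> satisfies \<open>|K| \<le> (2N + 1)/d\<close> and vanishes to order \<open>N + 1\<close> at infinity.
The maximum principle for \<open>|K| exp (N g)\<close>, started at the small distance \<open>\<eta> \<approx> \<delta> N^(-k)\<close> from \<open>E\<close>
where HCP gives \<open>N g = O(1)\<close>, yields \<open>|K| \<le> poly(N, 1/\<delta>) exp (- N g)\<close>
(\<open>interpolation_kernel_bound\<close>). Cauchy's formula over a grid of squares of size comparable to
\<open>\<delta>\<close> (\<open>cauchy_transform_estimate\<close>) only needs \<open>K\<close> where \<open>\<delta>/2 \<le> d \<le> \<delta>\<close>. There
\<open>g \<ge> M (\<delta>/2)\<^sup>s\<close>, so the error is \<open>poly(N, 1/\<delta>) exp (- c N \<delta>\<^sup>s)\<close>, and maximizing \<open>N\<^sup>l\<close> times this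
gives the Jackson bound.

The last argument needs \<open>g\<close> itself to be harmonic, although it is defined as a pointwise
infimum. This is \<open>green_function_attained\<close>: normalized logarithms of near-Fekete polynomials lie
below every candidate by Bernstein--Walsh, are bounded below by a sequence tending to 0, and
accumulate at a candidate.\<close>

section \<open>A maximum principle for harmonic functions\<close>

lemma second_deriv_nonpos_at_max:
  fixes \<phi> :: "real \<Rightarrow> real"
  assumes d: "d > 0" and D1: "\<And>t. \<bar>t\<bar> < d \<Longrightarrow> (\<phi> has_real_derivative \<phi>' t) (at t)"
    and D2: "(\<phi>' has_real_derivative D) (at 0)"
    and mx: "\<And>t. \<bar>t\<bar> < d \<Longrightarrow> \<phi> t \<le> \<phi> 0"
  shows "D \<le> 0"
proof (rule ccontr)
  assume "\<not> D \<le> 0"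
  then have "D > 0" by simp
  have z: "\<phi>' 0 = 0"
    using DERIV_local_max[OF D1[of 0] d] mx d by auto
  obtain e where e: "e > 0" "\<And>h. 0 < h \<Longrightarrow> h < e \<Longrightarrow> \<phi>' 0 < \<phi>' (0 + h)"
    using DERIV_pos_inc_right[OF D2 \<open>D > 0\<close>] by auto
  define h where "h = min d e / 2"
  have h: "0 < h" "h < d" "h < e" using d e by (auto simp: h_def)
  have "\<phi> 0 < \<phi> h"
  proof (rule DERIV_pos_imp_increasing_open[OF h(1)])
    fix x assume "0 < x" "x < h"
    then show "\<exists>y. (\<phi> has_real_derivative y) (at x) \<and> y > 0"
      using D1[of x] e(2)[of x] h z by (intro exI[of _ "\<phi>' x"]) auto
  next
    show "continuous_on {0..h} \<phi>"
      using h by (intro continuous_at_imp_continuous_on ballI DERIV_isCont[OF D1]) auto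
  qed
  then show False using mx[of h] h by auto
qed

lemma dir_deriv_eq:
  assumes "(f has_derivative f') (at z)"
  shows "dir_deriv v f z = f' v"
  using frechet_derivative_at[OF assms] by (simp add: dir_deriv_def)

lemma has_real_derivative_along_line:
  fixes f :: "complex \<Rightarrow> real"
  assumes "f differentiable (at (z + of_real t * v))"
  shows "((\<lambda>t. f (z + of_real t * v)) has_real_derivative dir_deriv v f (z + of_real t * v)) (at t)"
proof -
  let ?D = "frechet_derivative f (at (z + of_real t * v))"
  have 1: "(f has_derivative ?D) (at (z + of_real t * v))"
    using assms frechet_derivative_works by blast
  have 2: "((\<lambda>t. z + of_real t * v) has_derivative (\<lambda>h. of_real h * v)) (at t)"
    by (auto intro!: derivative_eq_intros)
  have "((\<lambda>t. f (z + of_real t * v)) has_derivative (\<lambda>h. ?D (of_real h * v))) (at t)"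
    using has_derivative_compose[OF 2 1] .
  moreover have "?D (of_real h * v) = dir_deriv v f (z + of_real t * v) * h" for h
    using linear_cmul[OF has_derivative_linear[OF 1], of h v]
    by (simp add: dir_deriv_def scaleR_conv_of_real)
  ultimately show ?thesis by (simp add: has_field_derivative_def mult_commute_abs)
qed

lemma has_derivative_ln_norm:
  fixes f :: "'a::real_normed_vector \<Rightarrow> complex"
  assumes "(f has_derivative f') (at x)" "f x \<noteq> 0"
  shows "((\<lambda>x. ln (norm (f x))) has_derivative (\<lambda>h. Re (f' h / f x))) (at x)"
proof -
  have "((\<lambda>x. norm (f x)) has_derivative (\<lambda>h. f' h \<bullet> sgn (f x))) (at x)"
    using has_derivative_compose[OF assms(1) has_derivative_norm[OF assms(2)]]
    by (simp add: inner_commute)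
  from has_derivative_ln[OF _ this] assms(2)
  have "((\<lambda>x. ln (norm (f x))) has_derivative (\<lambda>h. f' h \<bullet> sgn (f x) * inverse (norm (f x)))) (at x)"
    by (simp add: divide_inverse)
  moreover have "w \<bullet> sgn y * inverse (norm y) = Re (w / y)" if "y \<noteq> 0" for w y :: complex
  proof -
    have "w / y = w * cnj y / of_real ((norm y)\<^sup>2)"
      using that by (simp add: field_simps complex_norm_square[symmetric] del: of_real_power)
    then have "Re (w / y) = Re (w * cnj y) / (norm y)\<^sup>2" by simp
    then show ?thesis
      by (simp add: inner_complex_def sgn_div_norm power2_eq_square divide_inverse algebra_simps)
  qed
  ultimately show ?thesis using assms(2) by simp
qed

lemma ln_norm_has_derivative_along_line:
  assumes "(F has_field_derivative F') (at (z + of_real t * v))" "F (z + of_real t * v) \<noteq> 0"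
  shows "((\<lambda>t. ln (norm (F (z + of_real t * v)))) has_real_derivative
            Re (v * (F' / F (z + of_real t * v)))) (at t)"
proof -
  have "((\<lambda>t. z + of_real t * v) has_derivative (\<lambda>h. of_real h * v)) (at t)"
    by (auto intro!: derivative_eq_intros)
  moreover have "(F has_derivative (\<lambda>h. F' * h)) (at (z + of_real t * v))"
    using assms(1) by (simp add: has_field_derivative_def)
  ultimately have "((\<lambda>t. F (z + of_real t * v)) has_derivative (\<lambda>h. F' * (of_real h * v))) (at t)"
    by (rule has_derivative_compose)
  from has_derivative_ln_norm[OF this assms(2)]
  have "((\<lambda>t. ln (norm (F (z + of_real t * v)))) has_derivative
      (\<lambda>h. Re (F' * (of_real h * v) / F (z + of_real t * v)))) (at t)" .
  moreover have "Re (F' * (of_real h * v) / y) = Re (v * (F' / y)) * h" for h y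
  proof -
    have "F' * (of_real h * v) / y = of_real h * (v * (F' / y))" by simp
    moreover have "Re (of_real h * w) = Re w * h" for w by simp
    ultimately show ?thesis by (simp only:)
  qed
  ultimately show ?thesis by (simp add: has_field_derivative_def mult_commute_abs)
qed

lemma harmonic_onD:
  assumes "harmonic_on S u" "z \<in> S"
  shows "u differentiable (at z)" "dir_deriv 1 u differentiable (at z)"
    "dir_deriv \<i> u differentiable (at z)"
    "dir_deriv 1 (dir_deriv 1 u) z + dir_deriv \<i> (dir_deriv \<i> u) z = 0"
  using assms by (auto simp: harmonic_on_def numeral_2_eq_2)

lemma harmonic_on_continuous: "harmonic_on S u \<Longrightarrow> continuous_on S u"
  by (intro continuous_at_imp_continuous_on ballI differentiable_imp_continuous_within harmonic_onD(1))

text \<open>Compactness of the superlevel sets expresses at once that the product is at most \<open>B\<close> at the boundary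
of \<open>S\<close> and at infinity. If the value \<open>B\<close> were exceeded, then \<open>ln |F| + c u + \<kappa> |z|\<^sup>2\<close> with a
small \<open>\<kappa> > 0\<close> would have an interior maximum at a point with \<open>F \<noteq> 0\<close>, where its Laplacian is
\<open>4 \<kappa> > 0\<close>. At a maximum the second derivatives along both coordinate directions are
nonpositive, which is a contradiction.\<close>

lemma harmonic_maximum_principle:
  fixes F :: "complex \<Rightarrow> complex" and u :: "complex \<Rightarrow> real"
  assumes S: "open S" and u: "harmonic_on S u" and F: "F holomorphic_on S" and B: "B \<ge> 0"
    and cpt: "\<And>e. e > 0 \<Longrightarrow> compact {z\<in>S. norm (F z) * exp (c * u z) \<ge> B + e}"
    and z0: "z0 \<in> S"
  shows "norm (F z0) * exp (c * u z0) \<le> B"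
proof (rule ccontr)
  define val where "val = (\<lambda>z. norm (F z) * exp (c * u z))"
  define T where "T = val z0"
  assume "\<not> ?thesis"
  then have T: "B < T" by (simp add: T_def val_def)
  define e where "e = (T - B) / 2"
  define K where "K = {z\<in>S. val z \<ge> B + e}"
  have e: "e > 0" "B + e < T" "B + e > 0" using T B by (auto simp: e_def field_simps)
  have K: "compact K" using cpt[OF e(1)] by (simp add: K_def val_def)
  have z0K: "z0 \<in> K" using z0 e by (simp add: K_def T_def[symmetric])
  have cont: "continuous_on S val"
    unfolding val_def using harmonic_on_continuous[OF u] holomorphic_on_imp_continuous_on[OF F]
    by (intro continuous_intros)
  obtain R where R: "R > 0" "\<And>z. z \<in> K \<Longrightarrow> norm z \<le> R"
    using compact_imp_bounded[OF K] bounded_pos by blast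
  \<comment> \<open>This choice keeps the maximum of the perturbed function inside the open set \<open>val > B + e\<close>.\<close>
  define \<kappa> where "\<kappa> = (ln T - ln (B + e)) / (2 * R^2)"
  have \<kappa>: "\<kappa> > 0" "\<kappa> * R^2 < ln T - ln (B+e)"
    using e R by (auto simp: \<kappa>_def)
  define \<Psi> where "\<Psi> = (\<lambda>z. ln (norm (F z)) + c * u z + \<kappa> * (norm z)^2)"
  have nzF: "F z \<noteq> 0" if "z \<in> K" for z
    using that e by (auto simp: K_def val_def)
  have KS: "K \<subseteq> S" by (auto simp: K_def)
  have "continuous_on K \<Psi>"
    unfolding \<Psi>_def
    using harmonic_on_continuous[OF u] holomorphic_on_imp_continuous_on[OF F] nzF
    by (intro continuous_intros continuous_on_subset[OF _ KS]) auto
  then obtain z1 where z1: "z1 \<in> K" "\<And>z. z \<in> K \<Longrightarrow> \<Psi> z \<le> \<Psi> z1"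
    using continuous_attains_sup[OF K, of \<Psi>] z0K by blast
  have lnval: "\<Psi> z = ln (val z) + \<kappa> * (norm z)^2" if "z \<in> K" for z
    using nzF[OF that] by (simp add: \<Psi>_def val_def ln_mult)
  have "ln T \<le> \<Psi> z0" using lnval[OF z0K] \<kappa> by (simp add: T_def)
  also have "\<dots> \<le> \<Psi> z1" using z1 z0K by blast
  also have "\<dots> \<le> ln (val z1) + \<kappa> * R^2"
    using lnval[OF z1(1)] R(2)[OF z1(1)] \<kappa>(1) by (auto intro!: mult_left_mono power_mono)
  finally have "ln (B + e) < ln (val z1)" using \<kappa> by simp
  moreover have "val z1 > 0" using z1(1) e by (auto simp: K_def)
  ultimately have v1: "B + e < val z1" using e by simp
  have "open (S \<inter> val -` {B+e<..})"
    using cont S by (simp add: continuous_on_open_vimage Int_commute)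
  moreover have "z1 \<in> S \<inter> val -` {B+e<..}" using v1 z1 KS by auto
  ultimately obtain d where d: "d > 0" "ball z1 d \<subseteq> S \<inter> val -` {B+e<..}"
    by (meson openE)
  then have dK: "ball z1 d \<subseteq> K" by (auto simp: K_def)
  define L where "L = (\<lambda>z. deriv F z / F z)"
  have der: "\<exists>D. D \<le> 0 \<and> D = Re (v * (v * deriv L z1)) + c * dir_deriv v (dir_deriv v u) z1 + 2 * \<kappa>"
    if v: "v = 1 \<or> v = \<i>" for v :: complex
  proof -
    have nv: "norm v = 1" using v by auto
    have inb: "z1 + of_real t * v \<in> ball z1 d" if "\<bar>t\<bar> < d" for t
      using that nv by (simp add: dist_norm norm_mult)
    have inS: "z1 + of_real t * v \<in> S" "z1 + of_real t * v \<in> K" if "\<bar>t\<bar> < d" for t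
      using inb[OF that] dK KS by auto
    have nz: "F (z1 + of_real t * v) \<noteq> 0" if "\<bar>t\<bar> < d" for t
      using nzF inS that by blast
    have nsq: "(norm (z1 + of_real t * v))^2 = (norm z1)^2 + 2 * t * Re (cnj z1 * v) + t^2" for t
    proof -
      have "(norm (z1 + of_real t * v))^2 = (norm z1)^2 + 2 * t * Re (cnj z1 * v) + t^2 * (norm v)^2"
        unfolding cmod_power2 by (simp add: power2_eq_square algebra_simps)
      then show ?thesis by (simp add: nv)
    qed
    define \<phi>' where "\<phi>' = (\<lambda>t. Re (v * L (z1 + of_real t * v)) + c * dir_deriv v u (z1 + of_real t * v)
        + \<kappa> * (2 * Re (cnj z1 * v) + 2 * t))"
    let ?D = "Re (v * (v * deriv L z1)) + c * dir_deriv v (dir_deriv v u) z1 + 2 * \<kappa>"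
    have "?D \<le> 0"
    proof (rule second_deriv_nonpos_at_max[OF d(1), where \<phi> = "\<lambda>t. \<Psi> (z1 + of_real t * v)" and \<phi>' = \<phi>'])
      fix t :: real assume t: "\<bar>t\<bar> < d"
      have Fd: "(F has_field_derivative deriv F (z1 + of_real t * v)) (at (z1 + of_real t * v))"
        using F S inS(1)[OF t] holomorphic_derivI by blast
      show "((\<lambda>t. \<Psi> (z1 + of_real t * v)) has_real_derivative \<phi>' t) (at t)"
        unfolding \<Psi>_def \<phi>'_def nsq L_def
        by (rule derivative_eq_intros ln_norm_has_derivative_along_line[OF Fd nz[OF t]] refl
              has_real_derivative_along_line harmonic_onD(1)[OF u inS(1)[OF t]] | simp)+
      show "\<Psi> (z1 + of_real t * v) \<le> \<Psi> (z1 + of_real 0 * v)"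
        using z1(2) inS(2)[OF t] by simp
    next
      have z1S: "z1 \<in> S" using z1 KS by auto
      have "(L has_field_derivative deriv L z1) (at z1)"
      proof (rule holomorphic_derivI[of _ "ball z1 d"])
        show "L holomorphic_on ball z1 d"
          unfolding L_def using d dK nzF F S
          by (intro holomorphic_intros holomorphic_on_subset[OF _ d(2), of "F"]) 
             (auto intro: holomorphic_on_subset holomorphic_deriv)
      qed (use d in auto)
      then have "((\<lambda>t. L (z1 + of_real t * v)) has_vector_derivative v * deriv L z1) (at 0)"
        by (intro field_vector_diff_chain_at[unfolded o_def, where g=L])
          (auto intro!: derivative_eq_intros simp: has_vector_derivative_def scaleR_conv_of_real)
      then have "((\<lambda>t. v * L (z1 + of_real t * v)) has_vector_derivative v * (v * deriv L z1)) (at 0)"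
        by (rule has_vector_derivative_mult_right)
      then have L': "((\<lambda>t. Re (v * L (z1 + of_real t * v))) has_real_derivative Re (v * (v * deriv L z1))) (at 0)"
        unfolding has_real_derivative_iff_has_vector_derivative
        by (rule bounded_linear.has_vector_derivative[OF bounded_linear_Re])
      have "dir_deriv v u differentiable (at (z1 + of_real 0 * v))"
        using v harmonic_onD(2,3)[OF u z1S] by auto
      from has_real_derivative_along_line[OF this]
      have u': "((\<lambda>t. dir_deriv v u (z1 + of_real t * v)) has_real_derivative dir_deriv v (dir_deriv v u) z1) (at 0)"
        by simp
      show "(\<phi>' has_real_derivative ?D) (at 0)"
        unfolding \<phi>'_def by (rule derivative_eq_intros L' u' refl | simp)+
    qed
    then show ?thesis by blast
  qed
  from der[of 1] der[of \<i>] harmonic_onD(4)[OF u subsetD[OF KS z1(1)]] have "4 * \<kappa> + c * 0 \<le> 0"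
    by (smt (verit, ccfv_SIG) distrib_left mult_zero_right mult_1 complex_i_mult_minus minus_complex.sel(1) uminus_complex.sel(1))
  then show False using \<kappa> by simp
qed

section \<open>The Bernstein--Walsh inequality\<close>

lemma sup_norm_on_upper: "z \<in> E \<Longrightarrow> ennreal (norm (f z)) \<le> sup_norm_on E f"
  unfolding sup_norm_on_def by (rule SUP_upper)

lemma sup_norm_on_le_iff: "sup_norm_on E f \<le> C \<longleftrightarrow> (\<forall>z\<in>E. ennreal (norm (f z)) \<le> C)"
  by (simp add: sup_norm_on_def SUP_le_iff)

lemma closed_poly_hull: "closed (poly_hull E)"
proof -
  have "poly_hull E = (\<Inter>p :: complex poly. {z. ennreal (norm (poly p z)) \<le> sup_norm_on E (poly p)})"
    by (auto simp: poly_hull_def)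
  moreover have "closed {z. ennreal (norm (poly p z)) \<le> sup_norm_on E (poly p)}" for p :: "complex poly"
    by (intro closed_Collect_le continuous_on_ennreal continuous_intros)
  ultimately show ?thesis by auto
qed

lemma norm_le_on_poly_hull:
  assumes "\<And>z. z \<in> E \<Longrightarrow> norm (poly p z) \<le> C" "C \<ge> 0" "z \<in> poly_hull E"
  shows "norm (poly p z) \<le> C"
proof -
  have "ennreal (norm (poly p z)) \<le> sup_norm_on E (poly p)"
    using assms by (auto simp: poly_hull_def)
  also have "\<dots> \<le> ennreal C"
    using assms by (auto simp: sup_norm_on_le_iff intro: ennreal_leI)
  finally show ?thesis using assms(2) by simp
qed

lemma poly_growth:
  fixes q :: "complex poly"
  shows "\<exists>C\<ge>0. \<forall>z. norm z \<ge> 1 \<longrightarrow> norm (poly q z) \<le> C * norm z ^ degree q"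
proof (intro exI conjI allI impI)
  show "0 \<le> (\<Sum>i\<le>degree q. norm (coeff q i))" by (intro sum_nonneg) auto
  fix z :: complex assume z: "1 \<le> norm z"
  have "norm (poly q z) \<le> (\<Sum>i\<le>degree q. norm (coeff q i) * norm z ^ i)"
    by (simp add: poly_altdef norm_mult norm_power norm_sum flip: norm_mult norm_power)
  also have "\<dots> \<le> (\<Sum>i\<le>degree q. norm (coeff q i) * norm z ^ degree q)"
    using z by (intro sum_mono mult_left_mono power_increasing) auto
  finally show "norm (poly q z) \<le> (\<Sum>i\<le>degree q. norm (coeff q i)) * norm z ^ degree q"
    by (simp add: sum_distrib_right)
qed

lemma green_candidate_log_bounds:
  assumes "u \<in> green_candidates E"
  obtains R C where "R \<ge> 1" "C \<ge> 0"
    "\<And>z. norm z \<ge> R \<Longrightarrow> \<bar>u z - ln (norm z)\<bar> \<le> C"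
proof -
  have "(\<lambda>z. u z - ln (norm z)) \<in> O[at_infinity](\<lambda>_. 1)"
    using assms by (simp add: green_candidates_def)
  then obtain C where C: "C > 0" "eventually (\<lambda>z. norm (u z - ln (norm z)) \<le> C * norm (1::real)) at_infinity"
    using landau_o.bigE by blast
  then obtain R where R: "\<And>z. norm z \<ge> R \<Longrightarrow> \<bar>u z - ln (norm z)\<bar> \<le> C"
    by (auto simp: eventually_at_infinity)
  show thesis by (rule that[of "max 1 R" C]) (use R C in auto)
qed

text \<open>The maximum principle is applied to \<open>|q| exp (- (m + t) u)\<close>. The extra exponent \<open>t > 0\<close> makes this
tend to 0 at infinity, where \<open>u\<close> and \<open>ln |z|\<close> differ by a bounded amount. Since \<open>|q| \<le> 1\<close> on the
hull and \<open>u \<ge> 0\<close> outside, superlevel sets above 1 stay away from the hull.\<close>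

lemma bernstein_walsh:
  assumes E: "bounded E" and q: "degree q \<le> m" "\<And>z. z \<in> E \<Longrightarrow> norm (poly q z) \<le> 1"
    and u: "u \<in> green_candidates E" and z0: "z0 \<notin> poly_hull E"
  shows "norm (poly q z0) \<le> exp (real m * u z0)"
proof -
  define S where "S = - poly_hull E"
  have hu: "harmonic_on S u" and u0: "\<And>z. z \<in> S \<Longrightarrow> u z \<ge> 0"
    using u by (auto simp: green_candidates_def S_def)
  have S: "open S" using closed_poly_hull[of E] by (simp add: S_def open_Compl)
  obtain R C where RC: "R \<ge> 1" "C \<ge> 0" "\<And>z. norm z \<ge> R \<Longrightarrow> \<bar>u z - ln (norm z)\<bar> \<le> C"
    using green_candidate_log_bounds[OF u] by metis
  obtain Q where Q: "Q \<ge> 0" "\<And>z. norm z \<ge> 1 \<Longrightarrow> norm (poly q z) \<le> Q * norm z ^ degree q"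
    using poly_growth by metis
  have contu: "continuous_on S u" using hu harmonic_on_continuous by blast
  have main: "norm (poly q z0) * exp (- (m + t) * u z0) \<le> 1" if t: "t > 0" for t :: real
  proof (rule harmonic_maximum_principle[OF S hu])
    show "poly q holomorphic_on S" by (intro holomorphic_intros)
    show "z0 \<in> S" using z0 by (simp add: S_def)
    fix e :: real assume e: "e > 0"
    define val where "val = (\<lambda>z. norm (poly q z) * exp (- (m + t) * u z))"
    define X where "X = {z\<in>S. val z \<ge> 1 + e}"
    define P where "P = {z. norm (poly q z) \<ge> 1 + e}"
    have "closed P" unfolding P_def by (intro closed_Collect_le continuous_intros)
    have PS: "P \<subseteq> S" using norm_le_on_poly_hull[of E q 1] q e by (fastforce simp: P_def S_def)
    have le: "val z \<le> norm (poly q z)" if "z \<in> S" for z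
      unfolding val_def using u0[OF that] t by (intro mult_left_le) (auto intro: mult_nonpos_nonneg)
    have X: "X = {z\<in>P. val z \<in> {1+e..}}"
      using PS le by (fastforce simp: X_def P_def)
    have "continuous_on P val"
      unfolding val_def using continuous_on_subset[OF contu PS] by (intro continuous_intros)
    then have "closed X"
      unfolding X using \<open>closed P\<close>
      by (metis (no_types) closed_atLeast continuous_closed_preimage Collect_conj_eq Collect_mem_eq vimage_def)
    moreover have "bounded X"
    proof -
      define B where "B = max R ((Q * exp ((m+t)*C)) powr (1/t))"
      have "norm z \<le> B" if z: "z \<in> X" for z
      proof (rule ccontr)
        assume "\<not> norm z \<le> B"
        then have B: "norm z \<ge> R" "norm z > (Q * exp ((m+t)*C)) powr (1/t)" by (auto simp: B_def)
        have n1: "norm z \<ge> 1" using B RC by linarith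
        have "u z \<ge> ln (norm z) - C" using RC(3)[OF B(1)] by linarith
        then have "(m+t) * u z \<ge> (m + t) * (ln (norm z) - C)" using t by (intro mult_left_mono) auto
        then have "exp (- (m + t) * u z) \<le> exp ((m+t) * C - (m+t) * ln (norm z))"
          by (simp add: algebra_simps)
        also have "\<dots> = exp ((m+t) * C) * norm z powr (- (m+t))"
          using n1 by (auto simp: powr_def exp_diff exp_minus exp_add field_simps)
        finally have 1: "exp (- (m + t) * u z) \<le> exp ((m+t) * C) * norm z powr (- (m+t))" .
        have "norm (poly q z) \<le> Q * norm z ^ degree q" using Q(2) n1 by simp
        also have "\<dots> \<le> Q * norm z ^ m" using q n1 Q by (intro mult_left_mono power_increasing) auto
        also have "\<dots> = Q * norm z powr m" using n1 by (subst powr_realpow) auto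
        finally have "val z \<le> (Q * norm z powr m) * (exp ((m+t) * C) * norm z powr (- (m+t)))"
          unfolding val_def using 1 Q by (intro mult_mono) auto
        also have "\<dots> = (Q * exp ((m+t)*C)) * norm z powr (-t)"
          by (simp add: powr_add[symmetric] mult.assoc mult.left_commute)
        also have "\<dots> \<le> 1"
        proof -
          have "Q * exp ((m+t)*C) \<le> ((Q * exp ((m+t)*C)) powr (1/t)) powr t"
            using t Q by (simp add: powr_powr)
          also have "\<dots> \<le> norm z powr t" using B t by (intro powr_mono2) auto
          finally have "Q * exp ((m+t)*C) \<le> norm z powr t" .
          moreover have "norm z powr t > 0" using n1 by auto
          ultimately show ?thesis by (simp add: powr_minus divide_inverse[symmetric])
        qed
        finally show False using z e by (simp add: X_def)
      qed
      then show ?thesis using boundedI by blast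
    qed
    ultimately show "compact {z \<in> S. 1 + e \<le> norm (poly q z) * exp (- (m + t) * u z)}"
      by (simp add: X_def val_def compact_eq_bounded_closed)
  qed simp
  have "((\<lambda>t. norm (poly q z0) * exp (- (real m + t) * u z0)) \<longlongrightarrow> norm (poly q z0) * exp (- (real m + 0) * u z0)) (at_right 0)"
    by (intro tendsto_intros)
  moreover have "eventually (\<lambda>t. norm (poly q z0) * exp (- (real m + t) * u z0) \<le> 1) (at_right 0)"
    using main by (auto simp: eventually_at_right_less intro: eventually_mono[OF eventually_at_right_less])
  ultimately have "norm (poly q z0) * exp (- (real m + 0) * u z0) \<le> 1"
    by (intro tendsto_upperbound) auto
  then show ?thesis by (simp add: exp_minus field_simps)
qed

section \<open>A smooth function equal to 1/(z - a) away from a\<close>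

lemma Ck_on_SucD: "Ck_on (Suc k) S f \<Longrightarrow> Ck_on k S f"
proof (induction k arbitrary: f)
  case 0
  then show ?case
    by (auto intro!: continuous_at_imp_continuous_on differentiable_imp_continuous_within)
next
  case (Suc k)
  have "\<forall>z\<in>S. f differentiable (at z)"
    and "Ck_on (Suc k) S (dir_deriv 1 f)" "Ck_on (Suc k) S (dir_deriv \<i> f)"
    using Suc.prems unfolding Ck_on.simps(2)[of "Suc k" S f] by blast+
  with Suc.IH show ?case unfolding Ck_on.simps(2)[of k S f] by blast
qed

lemma Ck_on_affine:
  assumes "bounded_linear L"
  shows "Ck_on k S (\<lambda>z. L z + c)"
proof -
  have d: "((\<lambda>z. L z + c) has_derivative L) (at z)" if "bounded_linear L"
    for z c and L :: "complex \<Rightarrow> 'a"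
    using bounded_linear.has_derivative[OF that has_derivative_ident]
    by (auto intro!: derivative_eq_intros)
  have dd: "dir_deriv v (\<lambda>z. L z + c) = (\<lambda>z. L v)" if "bounded_linear L"
    for v c and L :: "complex \<Rightarrow> 'a"
    using dir_deriv_eq[OF d[OF that]] by auto
  have const: "Ck_on k S (\<lambda>z. b)" for k and b :: 'a
  proof (induction k arbitrary: b)
    case (Suc k)
    then show ?case using dd[of "\<lambda>_. 0"] d[of "\<lambda>_. 0"] by (auto simp: differentiable_def)
  qed simp
  show ?thesis
  proof (cases k)
    case 0
    then show ?thesis
      using d[OF assms] by (auto intro!: continuous_at_imp_continuous_on has_derivative_continuous)
  next
    case (Suc n)
    moreover have "(\<lambda>z. L z + c) differentiable (at z)" for z
      unfolding differentiable_def using d[OF assms] by blast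
    ultimately show ?thesis using dd[OF assms] const by simp
  qed
qed

lemma Ck_on_const: "Ck_on k S (\<lambda>z. b)"
  using Ck_on_affine[of "\<lambda>_. 0" k S b] by simp

lemma Ck_on_add:
  "Ck_on k UNIV f \<Longrightarrow> Ck_on k UNIV g \<Longrightarrow> Ck_on k UNIV (\<lambda>z. f z + g z)"
proof (induction k arbitrary: f g)
  case (Suc k)
  from Suc.prems have d: "f differentiable (at z)" "g differentiable (at z)" for z by auto
  have eq: "dir_deriv v (\<lambda>z. f z + g z) = (\<lambda>z. dir_deriv v f z + dir_deriv v g z)" for v
  proof
    fix z
    have "((\<lambda>z. f z + g z) has_derivative
        (\<lambda>h. frechet_derivative f (at z) h + frechet_derivative g (at z) h)) (at z)"
      using d[of z] by (intro has_derivative_add) (auto simp: frechet_derivative_works)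
    from dir_deriv_eq[OF this, of v] show "dir_deriv v (\<lambda>z. f z + g z) z = dir_deriv v f z + dir_deriv v g z"
      by (simp add: dir_deriv_def)
  qed
  have "(\<lambda>z. f z + g z) differentiable (at z)" for z
    using d by (intro differentiable_add)
  moreover have "Ck_on k UNIV (\<lambda>z. dir_deriv v f z + dir_deriv v g z)" if "v = 1 \<or> v = \<i>" for v
    using Suc.prems that by (intro Suc.IH) auto
  ultimately show ?case unfolding Ck_on.simps eq by blast
qed (simp add: continuous_on_add)

lemma Ck_on_mult:
  fixes f g :: "complex \<Rightarrow> complex"
  shows "Ck_on k UNIV f \<Longrightarrow> Ck_on k UNIV g \<Longrightarrow> Ck_on k UNIV (\<lambda>z. f z * g z)"
proof (induction k arbitrary: f g)
  case (Suc k)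
  from Suc.prems have d: "f differentiable (at z)" "g differentiable (at z)" for z by auto
  have eq: "dir_deriv v (\<lambda>z. f z * g z) = (\<lambda>z. f z * dir_deriv v g z + dir_deriv v f z * g z)" for v
  proof
    fix z
    have "((\<lambda>z. f z * g z) has_derivative
        (\<lambda>h. f z * frechet_derivative g (at z) h + frechet_derivative f (at z) h * g z)) (at z)"
      using d[of z] by (intro has_derivative_mult) (auto simp: frechet_derivative_works)
    from dir_deriv_eq[OF this, of v] show "dir_deriv v (\<lambda>z. f z * g z) z = f z * dir_deriv v g z + dir_deriv v f z * g z"
      by (simp add: dir_deriv_def)
  qed
  have "Ck_on k UNIV (\<lambda>z. f z * dir_deriv v g z + dir_deriv v f z * g z)"
    if "v = 1 \<or> v = \<i>" for v
    using Suc.prems that Ck_on_SucD[OF Suc.prems(1)] Ck_on_SucD[OF Suc.prems(2)]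
    by (intro Ck_on_add Suc.IH) auto
  moreover have "(\<lambda>z. f z * g z) differentiable (at z)" for z
    using d by (intro differentiable_mult)
  ultimately show ?case unfolding Ck_on.simps eq by blast
qed (simp add: continuous_on_mult)

lemma Ck_on_inverse:
  fixes f :: "complex \<Rightarrow> complex"
  assumes nz: "\<And>z. f z \<noteq> 0"
  shows "Ck_on k UNIV f \<Longrightarrow> Ck_on k UNIV (\<lambda>z. inverse (f z))"
proof (induction k)
  case (Suc k)
  from Suc.prems have d: "f differentiable (at z)" for z by auto
  have eq: "dir_deriv v (\<lambda>z. inverse (f z)) =
      (\<lambda>z. (- 1) * (inverse (f z) * dir_deriv v f z * inverse (f z)))" for v
  proof
    fix z
    have "((\<lambda>z. inverse (f z)) has_derivative
        (\<lambda>h. - (inverse (f z) * frechet_derivative f (at z) h * inverse (f z)))) (at z)"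
      using Deriv.has_derivative_inverse[OF nz frechet_derivative_works[THEN iffD1, OF d]] .
    from dir_deriv_eq[OF this, of v] show "dir_deriv v (\<lambda>z. inverse (f z)) z = (- 1) * (inverse (f z) * dir_deriv v f z * inverse (f z))"
      by (simp add: dir_deriv_def)
  qed
  have "Ck_on k UNIV (\<lambda>z. (- 1) * (inverse (f z) * dir_deriv v f z * inverse (f z)))"
    if "v = 1 \<or> v = \<i>" for v
    using Suc.prems that Suc.IH[OF Ck_on_SucD[OF Suc.prems(1)]]
    by (intro Ck_on_mult Ck_on_const) auto
  moreover have "(\<lambda>z. inverse (f z)) differentiable (at z)" for z
    using d nz by (intro differentiable_inverse) auto
  ultimately show ?case unfolding Ck_on.simps eq by blast
qed (use nz in \<open>simp add: continuous_on_inverse\<close>)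

text \<open>The family contains the classical flat function (\<open>k = 0\<close>) and is closed under differentiation up to
linear combinations, so that smoothness follows from a single induction.\<close>

definition flat :: "nat \<Rightarrow> real \<Rightarrow> real" where
  "flat k t = (if t > 0 then exp (- 1 / t) / t ^ k else 0)"

lemma flat_nonneg: "flat k t \<ge> 0" by (simp add: flat_def)

lemma flat_le_square: "\<exists>C. \<forall>t. \<bar>flat k t\<bar> \<le> C * t\<^sup>2"
proof (intro exI allI)
  fix t :: real
  show "\<bar>flat k t\<bar> \<le> fact (k + 2) * t\<^sup>2"
  proof (cases "t > 0")
    case True
    define c p :: real where "c = fact (k + 2)" and "p = t ^ (k + 2)"
    have cp: "c > 0" "p > 0" using True by (simp_all add: c_def p_def)
    have "(\<Sum>n\<in>{k+2}. (1/t) ^ n /\<^sub>R fact n) \<le> exp (1/t)"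
      unfolding exp_def using summable_exp_generic[of "1/t"] True
      by (intro sum_le_suminf) (auto)
    then have "1 / (p * c) \<le> exp (1/t)"
      by (simp add: c_def p_def power_one_over divide_inverse power_inverse mult.commute del: fact_Suc power_Suc)
    then have "exp (-1/t) \<le> c * p"
      using cp by (simp add: exp_minus field_simps)
    then have "exp (-1/t) / t ^ k \<le> c * p / t ^ k"
      using True by (intro divide_right_mono) auto
    also have "c * p / t ^ k = c * t\<^sup>2"
      using True by (simp add: p_def power_add power2_eq_square)
    finally show ?thesis using True by (simp add: flat_def c_def)
  qed (simp add: flat_def)
qed

lemma flat_has_derivative:
  "(flat k has_real_derivative flat (k + 2) t - real k * flat (k + 1) t) (at t)"
proof -
  consider "t > 0" | "t < 0" | "t = 0" by linarith
  then show ?thesis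
  proof cases
    case 1
    have "((\<lambda>t. exp (- 1 / t) / t ^ k) has_real_derivative flat (k + 2) t - real k * flat (k + 1) t) (at t)"
    proof (rule DERIV_cong)
      show "((\<lambda>t. exp (- 1 / t) / t ^ k) has_real_derivative
        ((exp (- 1 / t) * (1 / t^2)) * t^k - exp (-1/t) * (real k * t ^ (k - 1))) / (t ^ k * t ^ k)) (at t)"
        using 1 by (auto intro!: derivative_eq_intros simp: power2_eq_square)
      show "((exp (- 1 / t) * (1 / t^2)) * t^k - exp (-1/t) * (real k * t ^ (k - 1))) / (t ^ k * t ^ k)
          = flat (k + 2) t - real k * flat (k + 1) t"
        using 1 by (cases k) (simp_all add: flat_def field_simps power_add power2_eq_square)
    qed
    then show ?thesis
      by (rule has_field_derivative_transform_within_open[of _ _ _ "{0<..}"]) (use 1 in \<open>auto simp: flat_def\<close>)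
  next
    case 2
    have "((\<lambda>t. 0) has_real_derivative 0) (at t)" by simp
    then have "(flat k has_real_derivative 0) (at t)"
      by (rule has_field_derivative_transform_within_open[of _ _ _ "{..<0}"]) (use 2 in \<open>auto simp: flat_def\<close>)
    then show ?thesis using 2 by (simp add: flat_def)
  next
    case 3
    obtain C where C: "\<And>t. \<bar>flat k t\<bar> \<le> C * t\<^sup>2" using flat_le_square by blast
    have "((\<lambda>h. flat k h / h) \<longlongrightarrow> 0) (at 0)"
    proof (rule Lim_null_comparison)
      show "\<forall>\<^sub>F h in at 0. norm (flat k h / h) \<le> C * \<bar>h\<bar>"
      proof (rule eventually_at_filter[THEN iffD2], intro always_eventually allI impI)
        fix h :: real assume "h \<noteq> 0"
        then show "norm (flat k h / h) \<le> C * \<bar>h\<bar>"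
          using C[of h] by (simp add: field_simps power2_eq_square)
      qed
      show "((\<lambda>h. C * \<bar>h\<bar>) \<longlongrightarrow> 0) (at 0)" by (auto intro!: tendsto_eq_intros)
    qed
    then show ?thesis using 3 by (simp add: flat_def DERIV_def)
  qed
qed

lemma Ck_on_flat_norm_square:
  "Ck_on n UNIV (\<lambda>z. complex_of_real (flat k (\<alpha> * (norm (z - a))\<^sup>2 + \<gamma>)))"
proof (induction n arbitrary: k)
  have der: "((\<lambda>z. complex_of_real (flat k (\<alpha> * (norm (z - a))\<^sup>2 + \<gamma>))) has_derivative
      (\<lambda>h. (of_real (flat (k + 2) (\<alpha> * (norm (z - a))\<^sup>2 + \<gamma>)) +
             of_real (- real k) * of_real (flat (k + 1) (\<alpha> * (norm (z - a))\<^sup>2 + \<gamma>))) *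
            of_real (2 * \<alpha> * ((z - a) \<bullet> h)))) (at z)" for z k
  proof -
    let ?t = "\<alpha> * (norm (z - a))\<^sup>2 + \<gamma>"
    have "((\<lambda>z. \<alpha> * ((z - a) \<bullet> (z - a)) + \<gamma>) has_derivative (\<lambda>h. 2 * \<alpha> * ((z - a) \<bullet> h))) (at z)"
      by (auto intro!: derivative_eq_intros simp: inner_commute)
    then have "((\<lambda>z. \<alpha> * (norm (z - a))\<^sup>2 + \<gamma>) has_derivative (\<lambda>h. 2 * \<alpha> * ((z - a) \<bullet> h))) (at z)"
      by (simp add: power2_norm_eq_inner)
    from has_derivative_compose[OF this flat_has_derivative[of k ?t, unfolded has_field_derivative_def]]
    have "((\<lambda>z. flat k (\<alpha> * (norm (z - a))\<^sup>2 + \<gamma>)) has_derivative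
        (\<lambda>h. (flat (k + 2) ?t - real k * flat (k + 1) ?t) * (2 * \<alpha> * ((z - a) \<bullet> h)))) (at z)" .
    from has_derivative_of_real[OF this] show ?thesis by simp
  qed
  {
    case 0
    show ?case
      unfolding Ck_on.simps by (intro continuous_at_imp_continuous_on ballI has_derivative_continuous[OF der])
  next
    case (Suc n)
    have lin: "Ck_on n UNIV (\<lambda>z. complex_of_real (2 * \<alpha> * ((z - a) \<bullet> v)))" for v
    proof -
      have "bounded_linear (\<lambda>z. complex_of_real (2 * \<alpha> * (z \<bullet> v)))"
        by (intro bounded_linear_intros bounded_linear_compose[OF bounded_linear_of_real])
      from Ck_on_affine[OF this, of n UNIV "complex_of_real (2 * \<alpha> * ((- a) \<bullet> v))"]
      show ?thesis by (simp add: inner_diff_left algebra_simps)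
    qed
    have "dir_deriv v (\<lambda>z. complex_of_real (flat k (\<alpha> * (norm (z - a))\<^sup>2 + \<gamma>))) =
      (\<lambda>z. (of_real (flat (k + 2) (\<alpha> * (norm (z - a))\<^sup>2 + \<gamma>)) +
             of_real (- real k) * of_real (flat (k + 1) (\<alpha> * (norm (z - a))\<^sup>2 + \<gamma>))) *
            of_real (2 * \<alpha> * ((z - a) \<bullet> v)))" for v
      by (rule ext) (rule dir_deriv_eq[OF der])
    moreover have "Ck_on n UNIV (\<lambda>z. (of_real (flat (k + 2) (\<alpha> * (norm (z - a))\<^sup>2 + \<gamma>)) +
             of_real (- real k) * of_real (flat (k + 1) (\<alpha> * (norm (z - a))\<^sup>2 + \<gamma>))) *
            complex_of_real (2 * \<alpha> * ((z - a) \<bullet> v)))" for v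
      by (intro Ck_on_mult Ck_on_add Ck_on_const Suc.IH lin)
    moreover have "(\<lambda>z. complex_of_real (flat k (\<alpha> * (norm (z - a))\<^sup>2 + \<gamma>))) differentiable (at z)" for z
      unfolding differentiable_def using der by blast
    ultimately show ?case unfolding Ck_on.simps by metis
  }
qed

text \<open>With \<open>t = |z - a|\<^sup>2 / r\<^sup>2\<close>, \<open>\<alpha> = flat 0 (t - 1)\<close> and \<open>\<beta> = flat 0 (2 - t)\<close>, take
\<open>cnj (z - a) / r\<^sup>2 * \<alpha> / (t \<alpha> + \<beta>)\<close>. The denominator has no zeros because \<open>\<beta> > 0\<close> for \<open>t < 2\<close> and
\<open>t \<alpha> > 0\<close> for \<open>t \<ge> 2\<close>. For \<open>t > 2\<close> the term \<open>\<beta>\<close> vanishes and the quotient is \<open>1/(z - a)\<close>.\<close>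

lemma smooth_reciprocal:
  fixes a :: complex and r :: real
  assumes r: "r > 0"
  obtains f where "\<And>k. Ck_on k UNIV f" "\<And>z. norm (z - a) > 2 * r \<Longrightarrow> f z = 1 / (z - a)"
proof -
  define t where "t = (\<lambda>z. (1/r^2) * (norm (z - a))\<^sup>2)"
  define A B where "A = (\<lambda>z. complex_of_real (flat 0 ((1/r^2) * (norm (z - a))\<^sup>2 + (- 1))))"
    and "B = (\<lambda>z. complex_of_real (flat 0 ((- (1/r^2)) * (norm (z - a))\<^sup>2 + 2)))"
  define T where "T = (\<lambda>z::complex. of_real (1/r^2) * ((z + - a) * (cnj z + - cnj a)))"
  have T: "T z = of_real (t z)" for z
    using complex_norm_square[of "z - a"] by (simp add: T_def t_def)
  define f where "f = (\<lambda>z. of_real (1/r^2) * (cnj z + - cnj a) * (A z * inverse (T z * A z + B z)))"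
  have pos: "t z * flat 0 (t z - 1) + flat 0 (2 - t z) > 0" for z
  proof (cases "t z < 2")
    case True
    then have "flat 0 (2 - t z) > 0" by (simp add: flat_def)
    moreover have "t z \<ge> 0" using r by (simp add: t_def)
    ultimately show ?thesis using flat_nonneg by (simp add: add_nonneg_pos)
  next
    case False
    then have "flat 0 (t z - 1) > 0" "t z > 0" by (auto simp: flat_def)
    then show ?thesis using flat_nonneg by (simp add: add_pos_nonneg)
  qed
  have nz: "T z * A z + B z \<noteq> 0" for z
  proof -
    have "T z * A z + B z = of_real (t z * flat 0 (t z - 1) + flat 0 (2 - t z))"
      unfolding T by (simp add: A_def B_def t_def)
    then show ?thesis using pos[of z] by (simp del: of_real_add of_real_mult)
  qed
  have lin: "Ck_on k UNIV (\<lambda>z. cnj z + - cnj a)" "Ck_on k UNIV (\<lambda>z::complex. z + - a)" for k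
    by (intro Ck_on_affine bounded_linear_cnj bounded_linear_ident)+
  have AB: "Ck_on k UNIV A" "Ck_on k UNIV B" for k
    unfolding A_def B_def by (rule Ck_on_flat_norm_square)+
  have T': "Ck_on k UNIV T" for k
    unfolding T_def by (intro Ck_on_mult Ck_on_const lin)
  have "Ck_on k UNIV f" for k
    unfolding f_def using nz
    by (intro Ck_on_mult Ck_on_add Ck_on_const Ck_on_inverse lin AB T')
  moreover have "f z = 1 / (z - a)" if z: "norm (z - a) > 2 * r" for z
  proof -
    have "(2 * r)^2 < (norm (z - a))^2" using z r by (intro power_strict_mono) auto
    then have t: "t z > 4" using r by (simp add: t_def field_simps)
    then have B0: "B z = 0" by (simp add: B_def flat_def t_def)
    have A0: "A z \<noteq> 0" using t by (simp add: A_def flat_def t_def)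
    have "T z \<noteq> 0" using t T by simp
    then have "z - a \<noteq> 0" "cnj z - cnj a \<noteq> 0" by (auto simp: T_def)
    have cancel: "\<rho> * y * (w * inverse (\<rho> * (x * y) * w)) = 1 / x"
      if "\<rho> \<noteq> 0" "x \<noteq> 0" "y \<noteq> 0" "w \<noteq> 0" for \<rho> x y w :: complex
      using that by (simp add: field_simps)
    show ?thesis
      using cancel[of "of_real (1/r^2)" "z - a" "cnj z - cnj a" "A z"] A0 B0 r
        \<open>z - a \<noteq> 0\<close> \<open>cnj z - cnj a \<noteq> 0\<close>
      by (simp add: f_def T_def)
  qed
  ultimately show thesis using that by blast
qed

section \<open>The Jackson property implies the Lojasiewicz--Siciak inequality\<close>

lemma dbar_eq_0_of_holomorphic:
  assumes "f holomorphic_on S" "open S" "z \<in> S" "\<And>w. w \<in> S \<Longrightarrow> g w = f w"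
  shows "dbar g z = 0"
proof -
  have "(f has_field_derivative deriv f z) (at z)"
    using assms holomorphic_derivI by blast
  then have "(f has_derivative (\<lambda>h. deriv f z * h)) (at z)"
    by (simp add: has_field_derivative_def)
  then have "(g has_derivative (\<lambda>h. deriv f z * h)) (at z)"
    by (rule has_derivative_transform_within_open[OF _ assms(2,3)]) (simp add: assms(4))
  from dir_deriv_eq[OF this] show ?thesis by (simp add: dbar_def algebra_simps)
qed

lemma poly_dist_lessE:
  assumes "poly_dist E f n < ennreal C"
  obtains p where "degree p \<le> n" "\<And>z. z \<in> E \<Longrightarrow> norm (f z - poly p z) \<le> C"
proof -
  from assms obtain p where p: "degree p \<le> n" "sup_norm_on E (\<lambda>z. f z - poly p z) < ennreal C"
    unfolding poly_dist_def INF_less_iff by auto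
  have C: "C > 0" using assms by (metis ennreal_neg linorder_not_le not_less_zero)
  have "norm (f z - poly p z) \<le> C" if "z \<in> E" for z
  proof -
    have "ennreal (norm (f z - poly p z)) \<le> ennreal C"
      using sup_norm_on_upper[OF that, of "\<lambda>z. f z - poly p z"] p(2) by (meson order.strict_trans1 order_less_imp_le)
    then show ?thesis using C by simp
  qed
  then show thesis using that p by blast
qed

text \<open>The Bernstein--Walsh inequality for \<open>e q\<close> gives \<open>e \<le> exp (m u(a))\<close> for every candidate \<open>u\<close>. If
there is no candidate, the infimum defining the Green's function is infinite.\<close>

lemma green_function_lower_bound:
  assumes E: "bounded E" and q: "degree q \<le> m" "m \<ge> 1" "poly q a = 1"
    "\<And>z. z \<in> E \<Longrightarrow> norm (poly q z) \<le> exp (- 1)"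
  shows "green_function E a \<ge> ennreal (1 / real m)"
proof -
  have "a \<notin> poly_hull E"
  proof
    assume "a \<in> poly_hull E"
    then have "norm (poly q a) \<le> exp (- 1)" using norm_le_on_poly_hull[of E q "exp (-1)" a] q by auto
    then show False using q by simp
  qed
  moreover have "1 / real m \<le> u a" if u: "u \<in> green_candidates E" for u
  proof -
    have "norm (poly (smult (of_real (exp 1)) q) a) \<le> exp (real m * u a)"
    proof (rule bernstein_walsh[OF E _ _ u \<open>a \<notin> poly_hull E\<close>])
      show "degree (smult (of_real (exp 1)) q) \<le> m" using q by simp
      show "norm (poly (smult (of_real (exp 1)) q) z) \<le> 1" if "z \<in> E" for z
        using q(4)[OF that] by (simp add: norm_mult exp_minus field_simps)
    qed
    then have "1 \<le> real m * u a" using q(3) by simp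
    then show ?thesis using q(2) by (simp add: field_simps)
  qed
  ultimately show ?thesis
    by (simp add: green_function_def le_INF_iff ennreal_leI)
qed

lemma enlargement_iff: "E \<noteq> {} \<Longrightarrow> z \<in> enlargement E \<delta> \<longleftrightarrow> infdist z E \<le> \<delta>"
  by (simp add: enlargement_def)

text \<open>The Jackson bound is used on the enlargement by \<open>\<delta>/2\<close>, which stays at distance at least \<open>\<delta>/2\<close>
from \<open>a\<close>, so that the function \<open>1/(z - a)\<close> is bounded there by \<open>2/\<delta>\<close>.\<close>

lemma jackson_imp_separating_poly:
  assumes c: "c \<ge> 1" and v: "v \<ge> 1" and l: "l \<ge> 1" and n: "n \<ge> 1"
    and E: "E \<noteq> {}" "closed E" and \<delta>: "\<delta> = infdist a E" "0 < \<delta>" "\<delta> \<le> 1"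
    and JP: "\<And>\<delta> f. 0 < \<delta> \<Longrightarrow> \<delta> \<le> 1 \<Longrightarrow> f \<in> H_infinity (enlargement E \<delta>) \<Longrightarrow>
          jackson_norm E l f \<le> ennreal ((c * real l powr v / \<delta> powr s) powr (real l + c)) *
            sup_norm_on (enlargement E \<delta>) f"
  obtains p where "degree p \<le> n"
    "\<And>z. z \<in> E \<Longrightarrow> norm (1 / (z - a) - poly p z) \<le>
       4 * (c * real l powr v / (\<delta>/2) powr s) powr (real l + c) / (\<delta> * real n ^ l)"
proof -
  \<comment> \<open>The radius \<open>\<delta>/8\<close> makes \<open>f\<close> holomorphic where \<open>|z - a| > \<delta>/4\<close>, a neighbourhood of the enlargement.\<close>
  obtain f where f: "\<And>k. Ck_on k UNIV f" "\<And>z. norm (z - a) > 2 * (\<delta>/8) \<Longrightarrow> f z = 1 / (z - a)"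
    using smooth_reciprocal[of "\<delta>/8" a] \<delta> by auto
  define X where "X = (c * real l powr v / (\<delta>/2) powr s) powr (real l + c)"
  have X: "X > 0" using c l \<delta> by (simp add: X_def)
  have far: "norm (z - a) \<ge> \<delta>/2" if "z \<in> enlargement E (\<delta>/2)" for z
  proof -
    have "infdist a E \<le> infdist z E + dist a z" by (rule infdist_triangle)
    then show ?thesis using that \<delta> E by (simp add: enlargement_iff dist_norm norm_minus_commute)
  qed
  define U where "U = {z. norm (z - a) > 2 * (\<delta>/8)}"
  have U: "open U" unfolding U_def by (intro open_Collect_less continuous_intros)
  have "f \<in> H_infinity (enlargement E (\<delta>/2))"
    unfolding H_infinity_def
  proof (intro CollectI conjI allI exI[of _ U] f(1) U ballI)
    show "enlargement E (\<delta>/2) \<subseteq> U" using far \<delta> by (force simp: U_def)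
    fix z assume z: "z \<in> U"
    show "dbar f z = 0"
    proof (rule dbar_eq_0_of_holomorphic[OF _ U z])
      show "(\<lambda>z. 1 / (z - a)) holomorphic_on U"
        using \<delta> by (intro holomorphic_intros) (auto simp: U_def)
    qed (auto simp: U_def f(2))
  qed
  with \<delta> have "jackson_norm E l f \<le> ennreal X * sup_norm_on (enlargement E (\<delta>/2)) f"
    unfolding X_def by (intro JP) auto
  also have "sup_norm_on (enlargement E (\<delta>/2)) f \<le> ennreal (2/\<delta>)"
    unfolding sup_norm_on_le_iff
  proof
    fix z assume "z \<in> enlargement E (\<delta>/2)"
    from far[OF this] have far': "norm (z - a) \<ge> \<delta>/2" .
    have "norm (f z) = 1 / norm (z - a)"
      using far' \<delta> by (subst f(2)) (auto simp: norm_divide)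
    also have "\<dots> \<le> 1 / (\<delta>/2)"
      using far' \<delta> by (intro divide_left_mono mult_pos_pos) auto
    finally have "norm (f z) \<le> 2 / \<delta>" by simp
    then show "ennreal (norm (f z)) \<le> ennreal (2/\<delta>)" by (rule ennreal_leI)
  qed
  also have "ennreal X * ennreal (2/\<delta>) = ennreal (X * (2/\<delta>))"
    using X \<delta>(2) by (intro ennreal_mult[symmetric]) auto
  finally have J: "jackson_norm E l f \<le> ennreal (X * (2/\<delta>))" by (simp add: mult_left_mono)
  have "of_nat n ^ l * poly_dist E f n \<le> jackson_norm E l f"
    unfolding jackson_norm_def using n by (intro add_increasing SUP_upper2[of n]) auto
  with J have "ennreal (real n ^ l) * poly_dist E f n \<le> ennreal (X * (2/\<delta>))"
    by (metis (no_types, lifting) ennreal_of_nat_eq_real_of_nat ennreal_power of_nat_0_le_iff order_trans)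
  also have "\<dots> < ennreal (real n ^ l) * ennreal (4 * X / (\<delta> * real n ^ l))"
    using X \<delta> n by (simp add: ennreal_mult[symmetric] ennreal_less_iff field_simps)
  finally have "poly_dist E f n < ennreal (4 * X / (\<delta> * real n ^ l))"
    by (meson mult_left_mono leI not_less zero_le)
  then obtain p where p: "degree p \<le> n" "\<And>z. z \<in> E \<Longrightarrow> norm (f z - poly p z) \<le> 4 * X / (\<delta> * real n ^ l)"
    using poly_dist_lessE by blast
  show thesis
  proof (rule that[OF p(1)])
    fix z assume z: "z \<in> E"
    then have "z \<in> enlargement E (\<delta>/2)" using \<delta> E by (simp add: enlargement_iff)
    from far[OF this] \<delta> have "f z = 1 / (z - a)" by (intro f(2)) auto
    with p(2)[OF z] show "norm (1 / (z - a) - poly p z) \<le>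
       4 * (c * real l powr v / (\<delta>/2) powr s) powr (real l + c) / (\<delta> * real n ^ l)"
      by (simp add: X_def)
  qed
qed

text \<open>The number \<open>l\<close> is chosen with \<open>s (l + c) + 1 \<le> s' l\<close>; this is possible because \<open>s < s'\<close>. Then
\<open>n \<approx> K \<delta>^(-s')\<close> makes \<open>n\<^sup>l\<close> outweigh the Jackson bound, which is of order \<open>\<delta>^(- s (l + c) - 1)\<close>.\<close>

theorem jackson_imp_LS:
  assumes s: "1 \<le> s" "s < s'" and E: "compact E" and JP: "Jackson_property s E"
  shows "Lojasiewicz_Siciak s' E"
proof (cases "E = {}")
  case True
  then show ?thesis by (auto simp: Lojasiewicz_Siciak_def enlargement_def intro: exI[of _ 1])
next
  case ne: False
  from JP obtain c v where cv: "c \<ge> 1" "v \<ge> 1" and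
    J: "\<And>l \<delta> f. l \<ge> 1 \<Longrightarrow> 0 < \<delta> \<Longrightarrow> \<delta> \<le> 1 \<Longrightarrow> f \<in> H_infinity (enlargement E \<delta>) \<Longrightarrow>
          jackson_norm E l f \<le> ennreal ((c * real l powr v / \<delta> powr s) powr (real l + c)) *
            sup_norm_on (enlargement E \<delta>) f"
    unfolding Jackson_property_def by metis
  obtain R where R: "R > 0" "\<And>z. z \<in> E \<Longrightarrow> norm z \<le> R"
    using compact_imp_bounded[OF E] bounded_pos by blast
  define l where "l = nat \<lceil>max 1 ((s * c + 1) / (s' - s))\<rceil>"
  have "real l \<ge> max 1 ((s * c + 1) / (s' - s))" unfolding l_def by linarith
  then have l: "l \<ge> 1" and "(s * c + 1) / (s' - s) \<le> l" by auto
  then have ls: "s * (l + c) + 1 \<le> s' * l" using s by (simp add: field_simps)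
  define Y where "Y = (c * real l powr v * 2 powr s) powr (real l + c)"
  define K where "K = max 1 (exp 1 * (2 * R + 1) * 4 * Y)"
  have K: "K \<ge> 1" by (simp add: K_def)
  have main: "green_function E a \<ge> ennreal (1 / (3 * K) * infdist a E powr s')"
    if a: "a \<in> enlargement E 1" "infdist a E > 0" for a
  proof -
    define \<delta> where "\<delta> = infdist a E"
    have \<delta>: "0 < \<delta>" "\<delta> \<le> 1" using a ne by (auto simp: \<delta>_def enlargement_iff)
    define n where "n = nat \<lceil>K * \<delta> powr (- s')\<rceil>"
    have d1: "\<delta> powr (- s') \<ge> 1" using \<delta> s by (simp add: powr_minus field_simps powr_le1)
    then have Kd: "K * \<delta> powr (- s') \<ge> 1" using K mult_mono[of 1 K 1 "\<delta> powr (-s')"] by simp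
    have n: "real n \<ge> K * \<delta> powr (- s')" "real n \<le> K * \<delta> powr (- s') + 1"
      unfolding n_def using Kd by linarith+
    have n1: "n \<ge> 1" using n Kd by linarith
    obtain p where p: "degree p \<le> n" "\<And>z. z \<in> E \<Longrightarrow> norm (1 / (z - a) - poly p z) \<le>
       4 * (c * real l powr v / (\<delta>/2) powr s) powr (real l + c) / (\<delta> * real n ^ l)"
      using jackson_imp_separating_poly[OF cv l n1 ne compact_imp_closed[OF E] \<delta>_def \<delta> J[OF l]]
      by blast
    have bound: "4 * (c * real l powr v / (\<delta>/2) powr s) powr (real l + c) / (\<delta> * real n ^ l)
        \<le> exp (- 1) / (2 * R + 1)"
    proof -
      have "(c * real l powr v / (\<delta>/2) powr s) powr (real l + c) = Y * \<delta> powr (- s * (real l + c))"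
      proof -
        have "c * real l powr v / (\<delta>/2) powr s = (c * real l powr v * 2 powr s) * \<delta> powr (- s)"
          using \<delta> by (simp add: powr_divide powr_minus field_simps)
        then show ?thesis using cv l \<delta> by (simp add: Y_def powr_mult powr_powr)
      qed
      then have "4 * (c * real l powr v / (\<delta>/2) powr s) powr (real l + c) / \<delta>
          = 4 * Y * \<delta> powr (- (s * (real l + c) + 1))"
        using \<delta> by (simp add: powr_diff powr_minus field_simps powr_add)
      also have "\<dots> \<le> 4 * Y * \<delta> powr (- (s' * l))"
        using \<delta> ls by (intro mult_left_mono powr_mono') (auto simp: Y_def)
      also have "\<dots> \<le> exp (- 1) / (2 * R + 1) * (K * \<delta> powr (- (s' * l)))"
      proof -
        have "4 * Y * (exp 1 * (2 * R + 1)) \<le> K" by (simp add: K_def mult_ac)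
        then have "4 * Y \<le> K / (exp 1 * (2 * R + 1))"
          using R by (subst pos_le_divide_eq) auto
        also have "\<dots> = exp (- 1) / (2 * R + 1) * K"
          by (simp add: exp_minus divide_inverse mult_ac)
        finally have "4 * Y \<le> exp (- 1) / (2 * R + 1) * K" .
        then have "4 * Y * \<delta> powr (- (s' * l)) \<le> exp (- 1) / (2 * R + 1) * K * \<delta> powr (- (s' * l))"
          by (intro mult_right_mono) auto
        then show ?thesis by (simp only: mult.assoc)
      qed
      also have "K * \<delta> powr (- (s' * l)) \<le> real n ^ l"
      proof -
        have "K * \<delta> powr (- (s' * l)) \<le> K ^ l * (\<delta> powr (- s')) ^ l"
        proof (rule mult_mono)
          show "K \<le> K ^ l" using K l by (simp add: self_le_power)
          show "\<delta> powr (- (s' * l)) \<le> (\<delta> powr (- s')) ^ l"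
            using \<delta> by (simp add: powr_powr flip: powr_realpow)
        qed (use K in auto)
        also have "\<dots> = (K * \<delta> powr (- s')) ^ l" by (simp add: power_mult_distrib)
        also have "\<dots> \<le> real n ^ l" using n Kd by (intro power_mono) auto
        finally show ?thesis .
      qed
      finally have "4 * (c * real l powr v / (\<delta>/2) powr s) powr (real l + c) / \<delta>
          \<le> exp (- 1) / (2 * R + 1) * real n ^ l" using R by (simp add: mult_left_mono divide_right_mono)
      then show ?thesis using n1 \<delta> by (simp add: field_simps)
    qed
    have nora: "norm a \<le> R + 1"
    proof -
      obtain b where b: "b \<in> E" "infdist a E = dist a b"
        using infdist_attains_inf[OF compact_imp_closed[OF E] ne] by blast
      have "norm a \<le> norm b + dist a b" by (simp add: dist_norm norm_triangle_sub)
      then show ?thesis using R(2)[OF b(1)] b \<delta> by (simp add: \<delta>_def)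
    qed
    define q where "q = 1 - [:- a, 1:] * p"
    have "green_function E a \<ge> ennreal (1 / real (n + 1))"
    proof (rule green_function_lower_bound[OF compact_imp_bounded[OF E]])
      show "degree q \<le> n + 1"
        unfolding q_def using degree_mult_le[of "[:- a, 1:]" p] p(1)
        by (intro degree_diff_le) auto
      show "poly q a = 1" by (simp add: q_def)
      fix z assume z: "z \<in> E"
      have "z \<noteq> a" using z a(2) by auto
      then have "poly q z = (z - a) * (1 / (z - a) - poly p z)"
        by (simp add: q_def field_simps)
      then have "norm (poly q z) = norm (z - a) * norm (1 / (z - a) - poly p z)"
        by (simp only: norm_mult)
      also have "\<dots> \<le> (2 * R + 1) * (exp (- 1) / (2 * R + 1))"
      proof (rule mult_mono)
        show "norm (z - a) \<le> 2 * R + 1"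
          using norm_triangle_ineq4[of z a] R(2)[OF z] nora by linarith
        show "norm (1 / (z - a) - poly p z) \<le> exp (- 1) / (2 * R + 1)"
          using p(2)[OF z] bound by linarith
      qed (use R in auto)
      finally show "norm (poly q z) \<le> exp (- 1)" using R by simp
    qed simp
    moreover have "1 / (3 * K) * infdist a E powr s' \<le> 1 / real (n + 1)"
    proof -
      have "real (n + 1) \<le> 3 * K * \<delta> powr (- s')" using n Kd by simp
      then show ?thesis using K \<delta> by (simp add: \<delta>_def[symmetric] powr_minus field_simps)
    qed
    ultimately show ?thesis using ennreal_leI order_trans by blast
  qed
  show ?thesis
    unfolding Lojasiewicz_Siciak_def
  proof (intro exI[of _ "1 / (3 * K)"] conjI ballI)
    show "1 / (3 * K) > 0" using K by simp
    fix z assume z: "z \<in> enlargement E 1"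
    show "ennreal (1 / (3 * K) * infdist z E powr s') \<le> green_function E z"
    proof (cases "infdist z E > 0")
      case False
      then have "infdist z E = 0" using infdist_nonneg[of z E] by linarith
      then show ?thesis by simp
    qed (use main z in blast)
  qed
qed

section \<open>Lagrange interpolation at near-Fekete sets\<close>

definition lagrange_basis :: "complex set \<Rightarrow> complex \<Rightarrow> complex poly" where
  "lagrange_basis A a = (\<Prod>b\<in>A - {a}. smult (1 / (a - b)) [:- b, 1:])"

lemma poly_lagrange_basis: "poly (lagrange_basis A a) z = (\<Prod>b\<in>A - {a}. (z - b) / (a - b))"
  by (simp add: lagrange_basis_def poly_prod diff_divide_distrib)

lemma poly_lagrange_basis_node:
  assumes "finite A" "a \<in> A" "c \<in> A"
  shows "poly (lagrange_basis A a) c = (if c = a then 1 else 0)"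
  using assms by (auto simp: poly_lagrange_basis intro!: prod.neutral)

lemma degree_lagrange_basis:
  assumes "finite A" "a \<in> A"
  shows "degree (lagrange_basis A a) < card A"
proof -
  have "degree (lagrange_basis A a) \<le> (\<Sum>b\<in>A - {a}. degree (smult (1 / (a - b)) [:- b, 1:]))"
    unfolding lagrange_basis_def using degree_prod_sum_le[of "A - {a}"] assms
    unfolding o_def by blast
  also have "\<dots> \<le> (\<Sum>b\<in>A - {a}. 1)"
    by (intro sum_mono) simp
  also have "\<dots> < card A"
  proof -
    have "card A > 0" using assms by (auto simp: card_gt_0_iff)
    then show ?thesis using assms by simp
  qed
  finally show ?thesis .
qed

lemma lagrange_interpolation:
  assumes A: "finite A" and q: "degree q < card A"
  shows "(\<Sum>a\<in>A. poly q a * poly (lagrange_basis A a) z) = poly q z"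
proof -
  define p where "p = (\<Sum>a\<in>A. smult (poly q a) (lagrange_basis A a))"
  have "p = q"
  proof (rule poly_eqI_degree)
    fix c assume c: "c \<in> A"
    have "poly p c = (\<Sum>a\<in>A. if a = c then poly q a else 0)"
      unfolding p_def poly_sum using c A
      by (intro sum.cong) (auto simp: poly_lagrange_basis_node)
    then show "poly p c = poly q c" using A c by simp
  next
    have "degree p \<le> card A - 1"
      unfolding p_def
    proof (intro degree_sum_le[OF A])
      fix a assume "a \<in> A"
      then show "degree (smult (poly q a) (lagrange_basis A a)) \<le> card A - 1"
        using degree_lagrange_basis[OF A, of a] degree_smult_le[of "poly q a" "lagrange_basis A a"] by linarith
    qed
    then show "degree p < card A" using q by linarith
  qed (rule q)
  then have "poly p z = poly q z" by simp
  then show ?thesis by (simp add: p_def poly_sum)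
qed

text \<open>For fixed \<open>\<zeta>\<close> and \<open>w(z) = \<Prod> (z - a)\<close>, the quotient \<open>(w(\<zeta>) - w(z)) / (\<zeta> - z)\<close> is a polynomial
in \<open>z\<close> of degree less than \<open>card A\<close>, hence equal to its own interpolant, and its value at a node
\<open>a\<close> is \<open>w(\<zeta>) / (\<zeta> - a)\<close>. The left-hand side is the Cauchy transform of the interpolation error
functional at \<open>z\<close>; the right-hand side shows its order of decay in \<open>\<zeta>\<close> at infinity.\<close>

lemma interpolation_kernel:
  assumes A: "finite A" "A \<noteq> {}" and \<zeta>: "\<zeta> \<notin> A" "\<zeta> \<noteq> z"
  shows "1 / (\<zeta> - z) - (\<Sum>a\<in>A. poly (lagrange_basis A a) z / (\<zeta> - a))
         = (\<Prod>a\<in>A. (z - a) / (\<zeta> - a)) / (\<zeta> - z)"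
proof -
  define w where "w = (\<Prod>a\<in>A. [:- a, 1:])"
  have degw: "degree w \<le> card A"
    unfolding w_def using degree_prod_sum_le[OF A(1), of "\<lambda>a. [:- a, 1:]"] by simp
  have w: "poly w x = (\<Prod>a\<in>A. x - a)" for x by (simp add: w_def poly_prod)
  have w0: "poly w \<zeta> \<noteq> 0" using A \<zeta> by (auto simp: w)
  have "[:- \<zeta>, 1:] dvd w - [:poly w \<zeta>:]" by (simp add: poly_eq_0_iff_dvd[symmetric])
  then obtain q where q: "w - [:poly w \<zeta>:] = [:- \<zeta>, 1:] * q" by (elim dvdE)
  have degq: "degree q < card A"
  proof (cases "q = 0")
    case True
    then show ?thesis using A by (simp add: card_gt_0_iff)
  next
    case False
    then have "degree ([:- \<zeta>, 1:] * q) = degree q + 1" by (subst degree_mult_eq) auto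
    moreover have "degree (w - [:poly w \<zeta>:]) \<le> card A" using degw by (intro degree_diff_le) auto
    ultimately show ?thesis using q by simp
  qed
  have qv: "poly w x - poly w \<zeta> = (x - \<zeta>) * poly q x" for x
  proof -
    have "poly (w - [:poly w \<zeta>:]) x = poly ([:- \<zeta>, 1:] * q) x" by (simp only: q)
    then show ?thesis by (simp add: algebra_simps)
  qed
  have qa: "poly q a = poly w \<zeta> / (\<zeta> - a)" if "a \<in> A" for a
  proof -
    have "poly w a = 0" using that A by (auto simp: w)
    moreover have "\<zeta> \<noteq> a" using \<zeta> that by auto
    ultimately show ?thesis using qv[of a] by (simp add: field_simps)
  qed
  have "poly q z = (\<Sum>a\<in>A. poly q a * poly (lagrange_basis A a) z)"
    using lagrange_interpolation[OF A(1) degq] by simp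
  also have "\<dots> = poly w \<zeta> * (\<Sum>a\<in>A. poly (lagrange_basis A a) z / (\<zeta> - a))"
    by (simp add: sum_distrib_left qa)
  finally have S: "(\<Sum>a\<in>A. poly (lagrange_basis A a) z / (\<zeta> - a)) = poly q z / poly w \<zeta>"
    using w0 by (simp add: field_simps)
  have "(\<Prod>a\<in>A. (z - a) / (\<zeta> - a)) = poly w z / poly w \<zeta>"
    by (simp add: w prod_dividef)
  moreover have "poly w z = poly w \<zeta> - (\<zeta> - z) * poly q z"
    using qv[of z] by (simp add: algebra_simps)
  moreover have "1 / d - y / W = (W - d * y) / W / d" if "d \<noteq> 0" "W \<noteq> 0" for d y W :: complex
    using that by (simp add: field_simps)
  ultimately show ?thesis
    using w0 \<zeta>(2) unfolding S by simp
qed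

text \<open>The squared modulus of the Vandermonde determinant. The product over ordered pairs does not
depend on an enumeration of the set.\<close>

definition vandermonde_sq :: "complex set \<Rightarrow> real" where
  "vandermonde_sq A = (\<Prod>a\<in>A. \<Prod>b\<in>A - {a}. norm (a - b))"

lemma vandermonde_sq_pos: "finite A \<Longrightarrow> vandermonde_sq A > 0"
  unfolding vandermonde_sq_def by (intro prod_pos) auto

lemma vandermonde_sq_insert:
  assumes B: "finite B" "a \<notin> B"
  shows "vandermonde_sq (insert a B) = vandermonde_sq B * (\<Prod>b\<in>B. norm (a - b))\<^sup>2"
proof -
  have "vandermonde_sq (insert a B) = (\<Prod>b\<in>B. norm (a - b)) * (\<Prod>c\<in>B. \<Prod>b\<in>insert a B - {c}. norm (c - b))"
    unfolding vandermonde_sq_def using B by simp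
  also have "(\<Prod>c\<in>B. \<Prod>b\<in>insert a B - {c}. norm (c - b)) = (\<Prod>c\<in>B. norm (a - c) * (\<Prod>b\<in>B - {c}. norm (c - b)))"
  proof (rule prod.cong[OF refl])
    fix c assume c: "c \<in> B"
    then have "insert a B - {c} = insert a (B - {c})" using B by auto
    then show "(\<Prod>b\<in>insert a B - {c}. norm (c - b)) = norm (a - c) * (\<Prod>b\<in>B - {c}. norm (c - b))"
      using B by (simp add: norm_minus_commute)
  qed
  also have "\<dots> = (\<Prod>b\<in>B. norm (a - b)) * vandermonde_sq B"
    by (simp add: prod.distrib vandermonde_sq_def)
  finally show ?thesis by (simp add: power2_eq_square)
qed

text \<open>Exchanging the node \<open>a\<close> for \<open>z\<close> multiplies the squared Vandermonde determinant by \<open>|l\<^sub>a(z)|\<^sup>2\<close>,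
where \<open>l\<^sub>a\<close> is the basis polynomial. If \<open>A\<close> is within a factor 4 of the supremum over all \<open>N\<close>-point
subsets of \<open>E\<close>, then \<open>|l\<^sub>a(z)| \<le> 2\<close>. Exact maximizers (Fekete sets) would give 1;
the factor leaves room for every bounded \<open>E\<close>.\<close>

lemma ex_near_fekete_set:
  assumes E: "bounded E" "infinite E"
  obtains A where "finite A" "A \<subseteq> E" "card A = N"
    "\<And>a z. a \<in> A \<Longrightarrow> z \<in> E \<Longrightarrow> norm (poly (lagrange_basis A a) z) \<le> 2"
proof -
  define X where "X = vandermonde_sq ` {A. finite A \<and> A \<subseteq> E \<and> card A = N}"
  obtain R where R: "R > 0" "\<And>z. z \<in> E \<Longrightarrow> norm z \<le> R" using E bounded_pos by blast
  define D where "D = max 1 (2 * R)"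
  have D: "D \<ge> 1" "\<And>a b. a \<in> E \<Longrightarrow> b \<in> E \<Longrightarrow> norm (a - b) \<le> D"
  proof -
    show "norm (a - b) \<le> D" if "a \<in> E" "b \<in> E" for a b
      using norm_triangle_ineq4[of a b] R(2)[OF that(1)] R(2)[OF that(2)] by (simp add: D_def)
  qed (simp add: D_def)
  have bdd: "bdd_above X"
  proof (rule bdd_aboveI)
    fix x assume "x \<in> X"
    then obtain A where A: "finite A" "A \<subseteq> E" "card A = N" "x = vandermonde_sq A" by (auto simp: X_def)
    have "vandermonde_sq A \<le> (\<Prod>a\<in>A. D ^ N)"
      unfolding vandermonde_sq_def
    proof (intro prod_mono conjI prod_nonneg)
      fix a assume a: "a \<in> A"
      have "(\<Prod>b\<in>A - {a}. norm (a - b)) \<le> (\<Prod>b\<in>A - {a}. D)"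
        using A a D by (intro prod_mono) auto
      also have "\<dots> = D ^ card (A - {a})" by simp
      also have "\<dots> \<le> D ^ N" using D A a by (intro power_increasing) auto
      finally show "(\<Prod>b\<in>A - {a}. norm (a - b)) \<le> D ^ N" .
    qed auto
    then show "x \<le> (D ^ N) ^ N" using A by simp
  qed
  obtain A0 where A0: "finite A0" "card A0 = N" "A0 \<subseteq> E"
    using infinite_arbitrarily_large[OF E(2)] by blast
  then have "vandermonde_sq A0 \<in> X" by (auto simp: X_def)
  then have "Sup X > 0" using vandermonde_sq_pos[OF A0(1)] bdd by (meson cSup_upper less_le_trans)
  then have "Sup X / 4 < Sup X" by simp
  then obtain x where x: "x \<in> X" "Sup X / 4 < x"
    using \<open>vandermonde_sq A0 \<in> X\<close> by (metis empty_iff less_cSupE)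
  then obtain A where A: "finite A" "A \<subseteq> E" "card A = N" "Sup X / 4 < vandermonde_sq A" by (auto simp: X_def)
  have "norm (poly (lagrange_basis A a) z) \<le> 2" if a: "a \<in> A" and z: "z \<in> E" for a z
  proof (cases "z \<in> A")
    case True
    then show ?thesis using poly_lagrange_basis_node[OF A(1) a True] by auto
  next
    case False
    define B where "B = A - {a}"
    have B: "finite B" "a \<notin> B" "z \<notin> B" "A = insert a B" using A a False by (auto simp: B_def)
    have "card A = Suc (card B)" unfolding B(4) using B(1,2) by simp
    then have "card (insert z B) = N" using A(3) B(1,3) by simp
    moreover have "insert z B \<subseteq> E" using A(2) z by (auto simp: B_def)
    ultimately have "vandermonde_sq (insert z B) \<in> X" unfolding X_def using B(1) by blast
    then have "vandermonde_sq (insert z B) \<le> Sup X" using bdd by (rule cSup_upper)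
    also have "\<dots> \<le> 4 * vandermonde_sq (insert a B)" using A(4) unfolding B(4) by simp
    finally have "vandermonde_sq B * (\<Prod>b\<in>B. norm (z - b))\<^sup>2 \<le> vandermonde_sq B * (2 * (\<Prod>b\<in>B. norm (a - b)))\<^sup>2"
      using vandermonde_sq_insert[OF B(1,2)] vandermonde_sq_insert[OF B(1,3)] by (simp add: power_mult_distrib mult_ac)
    then have "(\<Prod>b\<in>B. norm (z - b))\<^sup>2 \<le> (2 * (\<Prod>b\<in>B. norm (a - b)))\<^sup>2"
      using vandermonde_sq_pos[OF B(1)] by simp
    then have le: "(\<Prod>b\<in>B. norm (z - b)) \<le> 2 * (\<Prod>b\<in>B. norm (a - b))"
      by (rule power2_le_imp_le) (auto intro: prod_nonneg)
    have "(\<Prod>b\<in>B. norm (a - b)) > 0" using B by (intro prod_pos) auto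
    then show ?thesis
      using le by (simp add: poly_lagrange_basis B_def[symmetric] prod_norm[symmetric] norm_divide prod_dividef field_simps)
  qed
  then show thesis using that A by blast
qed

text \<open>Among the Lagrange basis polynomials of a near-Fekete set, take the one with the largest leading
coefficient. The basis polynomials sum to 1, and \<open>infdist z E\<close> times any of them is at most
\<open>|z| + R\<close> times the chosen one; therefore the latter cannot be much smaller than \<open>infdist z E\<close>
anywhere. The modulus of half of it is \<open>\<kappa> * (\<Prod>b\<in>B. norm (z - b))\<close>, whose logarithm divided by
\<open>m\<close> approximates the Green's function.\<close>

lemma ex_fekete_polynomial:
  fixes E :: "complex set"
  assumes E: "compact E" "infinite E" and R: "\<And>z. z \<in> E \<Longrightarrow> norm z \<le> R"
  obtains B \<kappa> where "finite B" "B \<subseteq> E" "card B = m" "(\<kappa>::real) > 0"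
    "\<And>z. z \<in> E \<Longrightarrow> \<kappa> * (\<Prod>b\<in>B. norm (z - b)) \<le> 1"
    "\<And>z. infdist z E \<le> 2 * real (m + 1) * (norm z + R) * (\<kappa> * (\<Prod>b\<in>B. norm (z - b)))"
proof -
  obtain A where A: "finite A" "A \<subseteq> E" "card A = m + 1"
    "\<And>a z. a \<in> A \<Longrightarrow> z \<in> E \<Longrightarrow> norm (poly (lagrange_basis A a) z) \<le> 2"
    using ex_near_fekete_set[OF compact_imp_bounded[OF E(1)] E(2), of "m + 1"] by blast
  define d where "d = (\<lambda>a. \<Prod>b\<in>A - {a}. norm (a - b))"
  have dpos: "d a > 0" if "a \<in> A" for a unfolding d_def using A by (intro prod_pos) auto
  have "A \<noteq> {}" using A by auto
  then obtain a0 where a0: "a0 \<in> A" "\<And>a. a \<in> A \<Longrightarrow> d a0 \<le> d a"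
    using ex_is_arg_min_if_finite[OF A(1), of d] by (auto simp: is_arg_min_linorder)
  have nl: "norm (poly (lagrange_basis A a) z) = (\<Prod>b\<in>A - {a}. norm (z - b)) / d a" for a z
    by (simp add: poly_lagrange_basis prod_norm[symmetric] norm_divide prod_dividef d_def)
  show thesis
  proof (rule that)
    show "finite (A - {a0})" "A - {a0} \<subseteq> E" "card (A - {a0}) = m" using A a0 by auto
    show "1 / (2 * d a0) > 0" using dpos a0 by simp
    show "1 / (2 * d a0) * (\<Prod>b\<in>A - {a0}. norm (z - b)) \<le> 1" if "z \<in> E" for z
      using A(4)[OF a0(1) that] dpos[OF a0(1)] by (simp add: nl field_simps)
    fix z
    define p where "p = 1 / (2 * d a0) * (\<Prod>b\<in>A - {a0}. norm (z - b))"
    have p0: "p \<ge> 0" unfolding p_def using dpos[OF a0(1)] by (intro mult_nonneg_nonneg prod_nonneg) auto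
    have R0: "norm z + R \<ge> 0" using R[of a0] a0 A norm_ge_zero[of a0] norm_ge_zero[of z] by (smt (verit) in_mono)
    have summand: "infdist z E * norm (poly (lagrange_basis A a) z) \<le> 2 * (norm z + R) * p" if a: "a \<in> A" for a
    proof -
      have "infdist z E * (\<Prod>b\<in>A - {a}. norm (z - b)) \<le> norm (z - a) * (\<Prod>b\<in>A - {a}. norm (z - b))"
        using infdist_le[of a E z] a A by (intro mult_right_mono prod_nonneg) (auto simp: dist_norm)
      also have "\<dots> = (\<Prod>b\<in>A. norm (z - b))" using a A by (simp add: prod.remove)
      also have "\<dots> = norm (z - a0) * (\<Prod>b\<in>A - {a0}. norm (z - b))" using a0 A by (simp add: prod.remove)
      also have "\<dots> \<le> (norm z + R) * (\<Prod>b\<in>A - {a0}. norm (z - b))"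
        using norm_triangle_ineq4[of z a0] R[of a0] a0 A by (intro mult_right_mono prod_nonneg) auto
      also have "\<dots> = (norm z + R) * (2 * p * d a0)" using dpos[OF a0(1)] by (simp add: p_def)
      also have "\<dots> \<le> (norm z + R) * (2 * p * d a)"
        using a0(2)[OF a] R0 p0 by (intro mult_left_mono) auto
      finally show ?thesis using dpos[OF a] by (simp add: nl field_simps)
    qed
    have "1 = poly 1 z" by simp
    also have "\<dots> = (\<Sum>a\<in>A. poly 1 a * poly (lagrange_basis A a) z)"
      using A by (intro lagrange_interpolation[symmetric]) auto
    finally have "(\<Sum>a\<in>A. poly (lagrange_basis A a) z) = 1" by simp
    then have "1 \<le> (\<Sum>a\<in>A. norm (poly (lagrange_basis A a) z))"
      by (metis norm_one norm_sum)
    then have "infdist z E * 1 \<le> infdist z E * (\<Sum>a\<in>A. norm (poly (lagrange_basis A a) z))"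
      by (intro mult_left_mono infdist_nonneg)
    also have "\<dots> \<le> (\<Sum>a\<in>A. 2 * (norm z + R) * p)"
      unfolding sum_distrib_left by (intro sum_mono summand)
    also have "\<dots> = 2 * real (m + 1) * (norm z + R) * p" using A(3) by (simp add: algebra_simps)
    finally show "infdist z E \<le> 2 * real (m + 1) * (norm z + R) * (1 / (2 * d a0) * (\<Prod>b\<in>A - {a0}. norm (z - b)))"
      by (simp add: p_def)
  qed
qed

section \<open>Green's function is attained\<close>

lemma Re_mult_holomorphic_has_derivative:
  assumes S: "open S" and g: "g holomorphic_on S" and z: "z \<in> S"
    and W: "\<And>w. w \<in> S \<Longrightarrow> W w = Re (c * g w)"
  shows "(W has_derivative (\<lambda>h. Re (c * (deriv g z * h)))) (at z)"
proof -
  have "(g has_derivative (\<lambda>h. deriv g z * h)) (at z)"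
    using holomorphic_derivI[OF g S z] by (simp add: has_field_derivative_def)
  then have "((\<lambda>w. Re (c * g w)) has_derivative (\<lambda>h. Re (c * (deriv g z * h)))) (at z)"
    by (auto intro!: derivative_eq_intros)
  then show ?thesis
    by (rule has_derivative_transform_within_open[OF _ S z]) (simp add: W)
qed

lemma harmonic_on_of_holomorphic_gradient:
  assumes S: "open S" and g: "g holomorphic_on S"
    and U: "\<And>z. z \<in> S \<Longrightarrow> (U has_derivative (\<lambda>h. Re (g z * h))) (at z)"
  shows "harmonic_on S U"
proof -
  have d1: "dir_deriv v U z = Re (v * g z)" if "z \<in> S" for v z
    using dir_deriv_eq[OF U[OF that], of v] by (simp add: mult.commute)
  have U2: "(dir_deriv v U has_derivative (\<lambda>h. Re (v * (deriv g z * h)))) (at z)" if "z \<in> S" for v z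
    by (rule Re_mult_holomorphic_has_derivative[OF S g that]) (rule d1)
  have d2: "dir_deriv w (dir_deriv v U) z = Re (v * (deriv g z * w))" if "z \<in> S" for v w z
    by (rule dir_deriv_eq[OF U2[OF that]])
  have "continuous_on S (\<lambda>z. Re (v * (deriv g z * w)))" for v w
    using holomorphic_on_imp_continuous_on[OF holomorphic_deriv[OF g S]]
    by (intro continuous_intros)
  then have c2: "continuous_on S (dir_deriv w (dir_deriv v U))" for v w
    using d2 continuous_on_cong by (metis (no_types, lifting))
  have "Ck_on 2 S U"
    unfolding numeral_2_eq_2 Ck_on.simps using U U2 c2 by (auto simp: differentiable_def)
  moreover have "dir_deriv 1 (dir_deriv 1 U) z + dir_deriv \<i> (dir_deriv \<i> U) z = 0" if "z \<in> S" for z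
    using that by (simp add: d2)
  ultimately show ?thesis by (simp add: harmonic_on_def)
qed

text \<open>Montel's theorem applies to the complex gradients \<open>G n = \<partial>u/\<partial>x - \<i> \<partial>u/\<partial>y\<close>, which are
single-valued, whereas the \<open>u n\<close> are real parts of holomorphic functions only locally. A diagonal
argument makes the values converge on a countable dense set, and on every disc the convergence of
the gradients carries this over from one point to the whole disc.\<close>

lemma harmonic_compactness:
  fixes u :: "nat \<Rightarrow> complex \<Rightarrow> real"
  assumes S: "open S" and G: "\<And>n. G n holomorphic_on S"
    and der: "\<And>n z. z \<in> S \<Longrightarrow> (u n has_derivative (\<lambda>h. Re (G n z * h))) (at z)"
    and bddG: "\<And>K. compact K \<Longrightarrow> K \<subseteq> S \<Longrightarrow> \<exists>B. \<forall>n. \<forall>z\<in>K. norm (G n z) \<le> B"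
    and bddu: "\<And>n z. z \<in> S \<Longrightarrow> \<bar>u n z\<bar> \<le> M z"
  obtains \<rho> U where "strict_mono \<rho>" "harmonic_on S U" "\<And>z. z \<in> S \<Longrightarrow> (\<lambda>n. u (\<rho> n) z) \<longlonglongrightarrow> U z"
proof -
  obtain g r where g: "g holomorphic_on S" "strict_mono r"
    "\<And>K. \<lbrakk>compact K; K \<subseteq> S\<rbrakk> \<Longrightarrow> uniform_limit K (G \<circ> r) g sequentially"
  proof (rule Montel[OF S, of "range G" G])
    fix K :: "complex set" assume "compact K" "K \<subseteq> S"
    then show "\<exists>B. \<forall>h\<in>range G. \<forall>z\<in>K. norm (h z) \<le> B" using bddG[of K] by auto
  qed (use G in auto)
  obtain D :: "complex set" where D: "countable D" "\<And>X. open X \<Longrightarrow> X \<noteq> {} \<Longrightarrow> \<exists>d\<in>D. d \<in> X"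
    using countable_dense_setE by blast
  \<comment> \<open>The values are rescaled at each point so that one bound holds on the whole dense set.\<close>
  define f where "f = (\<lambda>n x. u (r n) x / (\<bar>M x\<bar> + 1))"
  have "norm (f n x) \<le> 1" if "x \<in> D \<inter> S" for n x
  proof -
    have "\<bar>u (r n) x\<bar> \<le> \<bar>M x\<bar> + 1" using bddu[of x "r n"] that by auto
    then show ?thesis by (simp add: f_def)
  qed
  then obtain k where k: "strict_mono k" "\<And>x. x \<in> D \<inter> S \<Longrightarrow> \<exists>l. (\<lambda>n. f (k n) x) \<longlonglongrightarrow> l"
    using function_convergent_subsequence[of "D \<inter> S" f 1] countable_Int1[OF D(1)] by metis
  define \<rho> where "\<rho> = r \<circ> k"
  have \<rho>: "strict_mono \<rho>" using g(2) k(1) by (simp add: \<rho>_def strict_mono_o)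
  have loc: "\<exists>g'. \<forall>x\<in>ball a e. (\<lambda>n. u (\<rho> n) x) \<longlonglongrightarrow> g' x \<and>
      (g' has_derivative (\<lambda>h. Re (g x * h))) (at x within ball a e)"
    if a: "e > 0" "cball a e \<subseteq> S" for a e
  proof -
    obtain x0 where x0: "x0 \<in> D" "x0 \<in> ball a e" using D(2)[of "ball a e"] a by auto
    have x0S: "x0 \<in> S" using x0 a by auto
    then obtain l where "(\<lambda>n. f (k n) x0) \<longlonglongrightarrow> l" using k(2)[of x0] x0 by auto
    then have "(\<lambda>n. f (k n) x0 * (\<bar>M x0\<bar> + 1)) \<longlonglongrightarrow> l * (\<bar>M x0\<bar> + 1)" by (intro tendsto_intros)
    moreover have "f (k n) x0 * (\<bar>M x0\<bar> + 1) = u (\<rho> n) x0" for n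
    proof -
      have "\<bar>M x0\<bar> + 1 \<noteq> 0" using abs_ge_zero[of "M x0"] by linarith
      then show ?thesis by (simp add: f_def \<rho>_def)
    qed
    ultimately have lim: "(\<lambda>n. u (\<rho> n) x0) \<longlonglongrightarrow> l * (\<bar>M x0\<bar> + 1)" by simp
    have ul: "uniform_limit (cball a e) (G \<circ> r) g sequentially" using g(3)[of "cball a e"] a by auto
    have d1: "(u (\<rho> n) has_derivative (\<lambda>h. Re (G (\<rho> n) x * h))) (at x within ball a e)"
      if "x \<in> ball a e" for n x
    proof -
      have "x \<in> S" using that a(2) by auto
      from has_derivative_at_withinI[OF der[OF this]] show ?thesis .
    qed
    have d2: "\<forall>\<^sub>F n in sequentially. \<forall>x\<in>ball a e. \<forall>h. norm (Re (G (\<rho> n) x * h) - Re (g x * h)) \<le> \<epsilon> * norm h"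
      if \<epsilon>: "\<epsilon> > 0" for \<epsilon>
    proof -
      from uniform_limitD[OF ul \<epsilon>]
      have "\<forall>\<^sub>F n in sequentially. \<forall>x\<in>cball a e. dist ((G \<circ> r) n x) (g x) < \<epsilon>" .
      then have "\<forall>\<^sub>F n in sequentially. \<forall>x\<in>cball a e. dist ((G \<circ> r) (k n) x) (g x) < \<epsilon>"
        using eventually_subseq[OF k(1)] by blast
      then show ?thesis
      proof (rule eventually_mono, intro ballI allI)
        fix n x h assume *: "\<forall>x\<in>cball a e. dist ((G \<circ> r) (k n) x) (g x) < \<epsilon>" and x: "x \<in> ball a e"
        have "norm (Re (G (\<rho> n) x * h) - Re (g x * h)) = \<bar>Re ((G (\<rho> n) x - g x) * h)\<bar>"
          by (simp add: algebra_simps)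
        also have "\<dots> \<le> norm (G (\<rho> n) x - g x) * norm h"
          using abs_Re_le_cmod[of "(G (\<rho> n) x - g x) * h"] by (simp add: norm_mult)
        also have "\<dots> \<le> \<epsilon> * norm h"
          using * x by (intro mult_right_mono) (auto simp: dist_norm \<rho>_def intro: less_imp_le)
        finally show "norm (Re (G (\<rho> n) x * h) - Re (g x * h)) \<le> \<epsilon> * norm h" .
      qed
    qed
    show ?thesis
      by (rule has_derivative_sequence[where f' = "\<lambda>n x h. Re (G (\<rho> n) x * h)", OF convex_ball d1 d2 x0(2) lim])
  qed
  define U where "U = (\<lambda>z. lim (\<lambda>n. u (\<rho> n) z))"
  have ex: "(\<lambda>n. u (\<rho> n) a) \<longlonglongrightarrow> U a \<and> (U has_derivative (\<lambda>h. Re (g a * h))) (at a)" if "a \<in> S" for a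
  proof -
    obtain e where e: "e > 0" "cball a e \<subseteq> S" using S \<open>a \<in> S\<close> open_contains_cball by blast
    obtain g' where g': "\<And>x. x \<in> ball a e \<Longrightarrow> (\<lambda>n. u (\<rho> n) x) \<longlonglongrightarrow> g' x"
      "\<And>x. x \<in> ball a e \<Longrightarrow> (g' has_derivative (\<lambda>h. Re (g x * h))) (at x within ball a e)"
      using loc[OF e] by blast
    have eq: "g' x = U x" if "x \<in> ball a e" for x
      using limI[OF g'(1)[OF that]] by (simp add: U_def)
    have a: "a \<in> ball a e" using e by simp
    have "(g' has_derivative (\<lambda>h. Re (g a * h))) (at a)"
      using g'(2)[OF a] at_within_open[OF a open_ball] by simp
    then have "(U has_derivative (\<lambda>h. Re (g a * h))) (at a)"
      by (rule has_derivative_transform_within_open[OF _ open_ball a eq])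
    then show ?thesis using g'(1)[OF a] eq[OF a] by simp
  qed
  have "harmonic_on S U"
    by (rule harmonic_on_of_holomorphic_gradient[OF S g(1)]) (use ex in blast)
  then show thesis using that[OF \<rho>] ex by blast
qed

text \<open>A finite set is the zero set of a polynomial, and multiplying this polynomial by large constants
contradicts the Bernstein--Walsh inequality.\<close>

lemma infinite_if_green_candidate:
  assumes u: "u \<in> green_candidates E" and E: "bounded E" "E = poly_hull E"
  shows "infinite E"
proof
  assume fin: "finite E"
  then obtain z where z: "z \<notin> E" using infinite_UNIV_char_0 by (metis ex_new_if_finite)
  define q where "q = (\<Prod>e\<in>E. [:- e, 1:])"
  have q0: "poly q z \<noteq> 0" using z fin by (auto simp: q_def poly_prod)
  define c where "c = of_real (exp (real (degree q) * u z) + 1) / poly q z"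
  have "norm (poly (smult c q) z) \<le> exp (real (degree q) * u z)"
  proof (rule bernstein_walsh[OF E(1) _ _ u])
    show "degree (smult c q) \<le> degree q" by (rule degree_smult_le)
    show "norm (poly (smult c q) w) \<le> 1" if "w \<in> E" for w
    proof -
      have "poly q w = 0" using that fin by (auto simp: q_def poly_prod)
      then show ?thesis by simp
    qed
    show "z \<notin> poly_hull E" using z E by simp
  qed
  moreover have "poly (smult c q) z = of_real (exp (real (degree q) * u z) + 1)" using q0 by (simp add: c_def)
  ultimately have "\<bar>exp (real (degree q) * u z) + 1\<bar> \<le> exp (real (degree q) * u z)"
    by (simp only: norm_of_real)
  then show False by simp
qed

lemma sum_ln_norm_has_derivative:
  assumes "finite B" "z \<notin> B"
  shows "((\<lambda>z. (c + (\<Sum>b\<in>B. ln (norm (z - b)))) / m) has_derivative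
     (\<lambda>h. Re ((\<Sum>b\<in>B. 1 / (z - b)) / of_real m * h))) (at z)"
proof -
  have 1: "((\<lambda>z. ln (norm (z - b))) has_derivative (\<lambda>h. Re (1 / (z - b) * h))) (at z)" if "b \<in> B" for b
  proof -
    have "((\<lambda>z. z - b) has_derivative (\<lambda>h. h)) (at z)" by (auto intro!: derivative_eq_intros)
    moreover have "z - b \<noteq> 0" using assms that by auto
    ultimately show ?thesis using has_derivative_ln_norm by fastforce
  qed
  have "((\<lambda>z. c + (\<Sum>b\<in>B. ln (norm (z - b)))) has_derivative (\<lambda>h. 0 + (\<Sum>b\<in>B. Re (1 / (z - b) * h)))) (at z)"
    by (intro has_derivative_add has_derivative_const has_derivative_sum 1)
  from bounded_linear.has_derivative[OF bounded_linear_divide this, of m]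
  have "((\<lambda>z. (c + (\<Sum>b\<in>B. ln (norm (z - b)))) / m) has_derivative
     (\<lambda>h. (0 + (\<Sum>b\<in>B. Re (1 / (z - b) * h))) / m)) (at z)" .
  moreover have "(0 + (\<Sum>b\<in>B. Re (1 / (z - b) * h))) / m = Re ((\<Sum>b\<in>B. 1 / (z - b)) / of_real m * h)" for h
  proof -
    have "(\<Sum>b\<in>B. 1 / (z - b)) / of_real m * h = (\<Sum>b\<in>B. 1 / (z - b) * h) / of_real m"
      by (simp add: sum_distrib_right)
    then show ?thesis by (simp only: Re_divide_of_real Re_sum add_0_left)
  qed
  ultimately show ?thesis by (simp only:)
qed

text \<open>Let \<open>u n\<close> be \<open>1/(n + 1)\<close> times the logarithm of the polynomial of degree \<open>n + 1\<close> from
\<open>ex_fekete_polynomial\<close>. It lies below all candidates by Bernstein--Walsh, in particular below the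
given \<open>v\<close>, and, at every point, above a sequence that tends to 0. All its zeros lie in \<open>E\<close>, so its gradient is
bounded by \<open>1 / infdist z E\<close>. A limit along a subsequence is therefore a nonnegative harmonic function
below all candidates, and it has the required logarithmic growth.\<close>

lemma green_function_attained:
  assumes E: "compact E" "E = poly_hull E" and v: "v \<in> green_candidates E"
  obtains u where "u \<in> green_candidates E" "\<And>z. z \<notin> E \<Longrightarrow> green_function E z = ennreal (u z)"
proof -
  have bE: "bounded E" using E compact_imp_bounded by blast
  have infE: "infinite E" using infinite_if_green_candidate[OF v bE E(2)] .
  then have neE: "E \<noteq> {}" by auto
  obtain R where R: "R > 0" "\<And>z. z \<in> E \<Longrightarrow> norm z \<le> R" using bE bounded_pos by blast
  define S where "S = - E"
  have S: "open S" using compact_imp_closed[OF E(1)] by (simp add: S_def open_Compl)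
  have ipos: "infdist z E > 0" if "z \<in> S" for z
    using that neE compact_imp_closed[OF E(1)] by (simp add: S_def infdist_pos_not_in_closed)
  have "\<exists>B \<kappa>. finite B \<and> B \<subseteq> E \<and> card B = Suc n \<and> \<kappa> > 0 \<and>
      (\<forall>z\<in>E. \<kappa> * (\<Prod>b\<in>B. norm (z - b)) \<le> 1) \<and>
      (\<forall>z. infdist z E \<le> 2 * real (Suc n + 1) * (norm z + R) * (\<kappa> * (\<Prod>b\<in>B. norm (z - b))))" for n
    using ex_fekete_polynomial[OF E(1) infE R(2), of "Suc n"] by (smt (verit))
  then obtain B \<kappa> where B: "\<And>n. finite (B n)" "\<And>n. B n \<subseteq> E" "\<And>n. card (B n) = Suc n"
    and \<kappa>: "\<And>n. \<kappa> n > (0::real)"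
    and le1: "\<And>n z. z \<in> E \<Longrightarrow> \<kappa> n * (\<Prod>b\<in>B n. norm (z - b)) \<le> 1"
    and low: "\<And>n z. infdist z E \<le> 2 * real (Suc n + 1) * (norm z + R) * (\<kappa> n * (\<Prod>b\<in>B n. norm (z - b)))"
    by metis
  define u where "u = (\<lambda>n z. (ln (\<kappa> n) + (\<Sum>b\<in>B n. ln (norm (z - b)))) / real (Suc n))"
  define G where "G = (\<lambda>n z. (\<Sum>b\<in>B n. 1 / (z - b)) / of_real (real (Suc n)))"
  have notB: "z \<notin> B n" if "z \<in> S" for z n using that B(2) by (auto simp: S_def)
  have prodpos: "(\<Prod>b\<in>B n. norm (z - b)) > 0" if "z \<in> S" for n z
    using notB[OF that] by (intro prod_pos) auto
  have ln_eq: "real (Suc n) * u n z = ln (\<kappa> n * (\<Prod>b\<in>B n. norm (z - b)))" if z: "z \<in> S" for n z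
  proof -
    have "ln (\<kappa> n * (\<Prod>b\<in>B n. norm (z - b))) = ln (\<kappa> n) + ln (\<Prod>b\<in>B n. norm (z - b))"
      using \<kappa> prodpos[OF z] by (intro ln_mult_pos) auto
    also have "ln (\<Prod>b\<in>B n. norm (z - b)) = (\<Sum>b\<in>B n. ln (norm (z - b)))"
      using notB[OF z] by (intro ln_prod B) auto
    finally show ?thesis by (simp add: u_def)
  qed
  have upper: "u n z \<le> w z" if w: "w \<in> green_candidates E" and z: "z \<in> S" for w n z
  proof -
    define q where "q = smult (of_real (\<kappa> n)) (\<Prod>b\<in>B n. [:- b, 1:])"
    have nq: "norm (poly q x) = \<kappa> n * (\<Prod>b\<in>B n. norm (x - b))" for x
      using \<kappa>[of n] by (simp add: q_def poly_prod norm_mult prod_norm)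
    have "norm (poly q z) \<le> exp (real (Suc n) * w z)"
    proof (rule bernstein_walsh[OF bE _ _ w])
      have "degree (\<Prod>b\<in>B n. [:- b, 1:]) \<le> (\<Sum>b\<in>B n. degree [:- b, 1::complex:])"
        using degree_prod_sum_le[OF B(1)[of n], of "\<lambda>b. [:- b, 1:]"] by (simp add: o_def)
      then show "degree q \<le> Suc n"
        using B(3)[of n] degree_smult_le[of "of_real (\<kappa> n)" "\<Prod>b\<in>B n. [:- b, 1:]"]
        by (simp add: q_def del: degree_smult_eq)
      show "z \<notin> poly_hull E" using z E(2) by (simp add: S_def)
    qed (use le1 nq in auto)
    then have "ln (\<kappa> n * (\<Prod>b\<in>B n. norm (z - b))) \<le> real (Suc n) * w z"
      unfolding nq using \<kappa>[of n] prodpos[OF z, of n] by (metis ln_exp ln_le_cancel_iff exp_gt_zero mult_pos_pos)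
    then have "real (Suc n) * u n z \<le> real (Suc n) * w z" using ln_eq[OF z] by simp
    then show ?thesis by (simp only: mult_le_cancel_left_pos of_nat_0_less_iff zero_less_Suc)
  qed
  define \<beta> where "\<beta> = (\<lambda>z. \<bar>ln (infdist z E / (2 * (norm z + R)))\<bar>)"
  \<comment> \<open>The second error term is written as \<open>2 ln N / N\<close> with \<open>N = n + 2 \<le> 2 (n + 1)\<close>, a multiple of a standard null sequence.\<close>
  have lower: "u n z \<ge> - \<beta> z / real (Suc n) - 2 * (ln (real (n + 2)) / real (n + 2))" if z: "z \<in> S" for n z
  proof -
    have p0: "\<kappa> n * (\<Prod>b\<in>B n. norm (z - b)) > 0" using \<kappa> prodpos[OF z] by simp
    have R0: "norm z + R > 0" using R(1) by (simp add: add_nonneg_pos)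
    have "infdist z E / (2 * (norm z + R)) \<le> real (n + 2) * (\<kappa> n * (\<Prod>b\<in>B n. norm (z - b)))"
      using low[of z n] R0 by (simp add: field_simps)
    then have "ln (infdist z E / (2 * (norm z + R))) \<le> ln (real (n + 2) * (\<kappa> n * (\<Prod>b\<in>B n. norm (z - b))))"
      using ipos[OF z] R0 p0 by (subst ln_le_cancel_iff) auto
    also have "\<dots> = ln (real (n + 2)) + real (Suc n) * u n z"
      using p0 ln_eq[OF z, of n] by (subst ln_mult_pos) auto
    finally have "real (Suc n) * u n z \<ge> - \<beta> z - ln (real (n + 2))" by (simp add: \<beta>_def)
    then have "u n z \<ge> (- \<beta> z - ln (real (n + 2))) / real (Suc n)"
      by (simp add: divide_le_eq mult.commute)
    moreover have "ln (real (n + 2)) / real (Suc n) \<le> 2 * (ln (real (n + 2)) / real (n + 2))"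
    proof -
      have "ln (real (n + 2)) * real (n + 2) \<le> ln (real (n + 2)) * (2 * real (Suc n))"
        by (intro mult_left_mono) auto
      then show ?thesis by (simp add: field_simps)
    qed
    ultimately show ?thesis by (simp add: diff_divide_distrib)
  qed
  have lower': "u n z \<ge> - \<beta> z - 2" if z: "z \<in> S" for n z
  proof -
    have "\<beta> z / real (Suc n) \<le> \<beta> z" by (simp add: \<beta>_def divide_le_eq mult_le_cancel_left1)
    then have "- \<beta> z \<le> - \<beta> z / real (Suc n)" by simp
    moreover have "ln (real (n + 2)) / real (n + 2) \<le> 1"
      using ln_le_minus_one[of "real (n+2)"] by (simp add: divide_le_eq)
    ultimately show ?thesis using lower[OF z, of n] by linarith
  qed
  obtain \<rho> U where U: "strict_mono \<rho>" "harmonic_on S U" "\<And>z. z \<in> S \<Longrightarrow> (\<lambda>n. u (\<rho> n) z) \<longlonglongrightarrow> U z"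
  proof (rule harmonic_compactness[OF S, of G u "\<lambda>z. \<bar>v z\<bar> + \<beta> z + 2"])
    show "G n holomorphic_on S" for n
      unfolding G_def using notB by (intro holomorphic_intros) auto
    show "(u n has_derivative (\<lambda>h. Re (G n z * h))) (at z)" if "z \<in> S" for n z
      unfolding u_def G_def by (rule sum_ln_norm_has_derivative[OF B(1) notB[OF that]])
    show "\<bar>u n z\<bar> \<le> \<bar>v z\<bar> + \<beta> z + 2" if "z \<in> S" for n z
    proof -
      have "\<beta> z \<ge> 0" by (simp add: \<beta>_def)
      then show ?thesis using upper[OF v that, of n] lower'[OF that, of n] by linarith
    qed
    fix K assume K: "compact K" "K \<subseteq> S"
    have "continuous_on K (\<lambda>z. 1 / infdist z E)"
      using ipos K by (intro continuous_intros) force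
    then obtain C where C: "\<And>z. z \<in> K \<Longrightarrow> 1 / infdist z E \<le> C"
      using compact_imp_bounded[OF compact_continuous_image[OF _ K(1)]] bounded_real
      by (metis abs_le_D1 image_eqI)
    have "norm (G n z) \<le> C" if z: "z \<in> K" for n z
    proof -
      have "norm (\<Sum>b\<in>B n. 1 / (z - b)) \<le> (\<Sum>b\<in>B n. 1 / infdist z E)"
      proof (rule sum_norm_le)
        fix b assume b: "b \<in> B n"
        then have "infdist z E \<le> norm (z - b)" using B(2) infdist_le[of b E z] by (auto simp: dist_norm)
        then show "norm (1 / (z - b)) \<le> 1 / infdist z E"
          using ipos[of z] subsetD[OF K(2) z] by (simp add: norm_divide frac_le)
      qed
      then have "norm (G n z) \<le> 1 / infdist z E"
        using B(3)[of n] by (simp add: G_def norm_divide divide_le_eq mult.commute del: of_nat_Suc)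
      then show ?thesis using C[OF z] by linarith
    qed
    then show "\<exists>B. \<forall>n. \<forall>z\<in>K. norm (G n z) \<le> B" by blast
  qed blast
  have U_le: "U z \<le> w z" if "w \<in> green_candidates E" "z \<in> S" for w z
    using U(3)[OF that(2)] upper[OF that] by (intro LIMSEQ_le_const2) auto
  have U_nonneg: "0 \<le> U z" if z: "z \<in> S" for z
  proof -
    have "(\<lambda>n. - \<beta> z / real (Suc n) - 2 * (ln (real (n + 2)) / real (n + 2))) \<longlonglongrightarrow> 0 - 2 * 0"
      using LIMSEQ_ignore_initial_segment[OF lim_ln_over_n, of 2]
      by (intro tendsto_intros LIMSEQ_Suc[OF lim_const_over_n])
    from LIMSEQ_subseq_LIMSEQ[OF this U(1)]
    have L: "(\<lambda>n. - \<beta> z / real (Suc (\<rho> n)) - 2 * (ln (real (\<rho> n + 2)) / real (\<rho> n + 2))) \<longlonglongrightarrow> 0"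
      by (simp add: o_def)
    show ?thesis
      by (rule LIMSEQ_le[OF L U(3)[OF z]]) (use lower[OF z] in blast)
  qed
  obtain Rv Cv where v': "Rv \<ge> 1" "Cv \<ge> 0" "\<And>z. norm z \<ge> Rv \<Longrightarrow> \<bar>v z - ln (norm z)\<bar> \<le> Cv"
    using green_candidate_log_bounds[OF v] by metis
  \<comment> \<open>The lower bound for \<open>u n\<close> at one point outside \<open>E\<close> bounds the leading coefficients \<open>\<kappa> n\<close> below, and thus \<open>u n\<close> near infinity.\<close>
  define p where "p = complex_of_real (R + 1)"
  have pS: "p \<in> S" using R unfolding p_def S_def by (smt (verit) ComplI norm_of_real)
  define C0 where "C0 = \<beta> p + 2 + ln (2 * R + 1) + ln 2"
  have u_low: "u n z \<ge> ln (norm z) - C0" if z: "norm z \<ge> 2 * R + 1" for n z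
  proof -
    have "ln (norm (p - b)) \<le> ln (2 * R + 1)" if "b \<in> B n" for b
    proof -
      have "norm (p - b) \<le> 2 * R + 1"
        using norm_triangle_ineq4[of p b] R(2)[of b] B(2)[of n] that R(1) by (auto simp: p_def simp del: of_real_add)
      moreover have "norm (p - b) > 0" using notB[OF pS, of n] that by auto
      ultimately show ?thesis using R(1) by (subst ln_le_cancel_iff) auto
    qed
    then have "(\<Sum>b\<in>B n. ln (norm (p - b))) \<le> real (Suc n) * ln (2 * R + 1)"
      using sum_bounded_above[of "B n" "\<lambda>b. ln (norm (p - b))" "ln (2 * R + 1)"] B(3)[of n] by simp
    moreover have "real (Suc n) * u n p = ln (\<kappa> n) + (\<Sum>b\<in>B n. ln (norm (p - b)))" by (simp add: u_def)
    moreover have "real (Suc n) * u n p \<ge> real (Suc n) * (- \<beta> p - 2)"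
      using lower'[OF pS, of n] by (intro mult_left_mono) auto
    ultimately have 1: "ln (\<kappa> n) \<ge> real (Suc n) * (- \<beta> p - 2 - ln (2 * R + 1))"
      by (simp add: algebra_simps)
    have "ln (norm z) - ln 2 \<le> ln (norm (z - b))" if "b \<in> B n" for b
    proof -
      have "norm z / 2 \<le> norm (z - b)"
        using norm_triangle_ineq2[of z b] R(2)[of b] B(2)[of n] that z by auto
      then have "ln (norm z / 2) \<le> ln (norm (z - b))"
        using z R by (subst ln_le_cancel_iff) auto
      moreover have "z \<noteq> 0" using z R(1) by auto
      ultimately show ?thesis by (simp add: ln_div)
    qed
    then have "(\<Sum>b\<in>B n. ln (norm (z - b))) \<ge> real (Suc n) * (ln (norm z) - ln 2)"
      using sum_bounded_below[of "B n" "ln (norm z) - ln 2" "\<lambda>b. ln (norm (z - b))"] B(3)[of n] by simp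
    with 1 have "ln (\<kappa> n) + (\<Sum>b\<in>B n. ln (norm (z - b))) \<ge> real (Suc n) * (ln (norm z) - C0)"
      by (simp add: C0_def algebra_simps)
    then show ?thesis by (simp add: u_def le_divide_eq mult.commute del: of_nat_Suc)
  qed
  have "(\<lambda>z. U z - ln (norm z)) \<in> O[at_infinity](\<lambda>_. 1)"
  proof (rule bigoI[of _ "max C0 Cv"])
    have "norm (U z - ln (norm z)) \<le> max C0 Cv * norm (1::real)" if z: "norm z \<ge> max (2 * R + 1) Rv" for z
    proof -
      have zS: "z \<in> S" using z R unfolding S_def by (smt (verit) ComplI max.cobounded1 order_trans)
      have "U z \<ge> ln (norm z) - C0"
        using z by (intro LIMSEQ_le_const[OF U(3)[OF zS]]) (auto intro: u_low)
      moreover have "U z \<le> ln (norm z) + Cv" using U_le[OF v zS] v'(3)[of z] z by auto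
      ultimately show ?thesis by (auto simp: abs_le_iff)
    qed
    then show "eventually (\<lambda>z. norm (U z - ln (norm z)) \<le> max C0 Cv * norm (1::real)) at_infinity"
      unfolding eventually_at_infinity by blast
  qed
  then have Uc: "U \<in> green_candidates E"
    using U(2) U_nonneg E(2) by (simp add: green_candidates_def S_def)
  moreover have "green_function E z = ennreal (U z)" if "z \<notin> E" for z
  proof -
    have "(INF u\<in>green_candidates E. ennreal (u z)) = ennreal (U z)"
      using Uc U_le[of _ z] that by (intro INF_eqI[of _ "ennreal (U z)" "\<lambda>u. ennreal (u z)"]) (auto simp: S_def intro: ennreal_leI)
    then show ?thesis using that E(2) by (simp add: green_function_def)
  qed
  ultimately show thesis using that by blast
qed

section \<open>Cauchy's formula over the boundary of a union of squares\<close>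

text \<open>Cancellation of interior edges: in the sum over \<open>T\<close> of the differences of opposite edges, only the
edges bordering exactly one cell of \<open>T\<close> survive.\<close>

lemma norm_sum_shift_le:
  fixes H :: "'a \<Rightarrow> 'b::real_normed_vector"
  assumes T: "finite T" "inj \<sigma>" and b: "b \<ge> 0"
    and le: "\<And>t. t \<in> T - \<sigma> ` T \<or> t \<in> \<sigma> ` T - T \<Longrightarrow> norm (H t) \<le> b"
  shows "norm (\<Sum>t\<in>T. H t - H (\<sigma> t)) \<le> 2 * real (card T) * b"
proof -
  have "(\<Sum>t\<in>T. H t - H (\<sigma> t)) = (\<Sum>t\<in>T. H t) - (\<Sum>t\<in>\<sigma> ` T. H t)"
    using T(2) by (simp add: sum_subtractf sum.reindex inj_on_subset o_def)
  also have "\<dots> = (\<Sum>t\<in>T - \<sigma> ` T. H t) - (\<Sum>t\<in>\<sigma> ` T - T. H t)"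
    using T(1) sum.Int_Diff[of T H "\<sigma> ` T"] sum.Int_Diff[of "\<sigma> ` T" H T] by (simp add: Int_commute)
  finally have "norm (\<Sum>t\<in>T. H t - H (\<sigma> t)) \<le> norm (\<Sum>t\<in>T - \<sigma> ` T. H t) + norm (\<Sum>t\<in>\<sigma> ` T - T. H t)"
    by (simp add: norm_triangle_ineq4)
  also have "norm (\<Sum>t\<in>T - \<sigma> ` T. H t) \<le> real (card T) * b"
  proof -
    have "norm (\<Sum>t\<in>T - \<sigma> ` T. H t) \<le> real (card (T - \<sigma> ` T)) * b"
      using le by (intro sum_norm_bound) auto
    also have "\<dots> \<le> real (card T) * b"
      using T b by (intro mult_right_mono) (auto intro: card_mono)
    finally show ?thesis .
  qed
  also have "norm (\<Sum>t\<in>\<sigma> ` T - T. H t) \<le> real (card T) * b"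
  proof -
    have "norm (\<Sum>t\<in>\<sigma> ` T - T. H t) \<le> real (card (\<sigma> ` T - T)) * b"
      using le by (intro sum_norm_bound) auto
    also have "card (\<sigma> ` T - T) \<le> card (\<sigma> ` T)"
      using T by (intro card_mono) auto
    also have "card (\<sigma> ` T) \<le> card T" using T by (rule_tac card_image_le)
    finally show ?thesis using b by (simp add: mult_right_mono)
  qed
  finally show ?thesis by (simp add: algebra_simps)
qed

lemma ex_generic_offset:
  fixes X :: "real set" and h :: real
  assumes "finite X"
  obtains x where "0 \<le> x" "x \<le> 1" "\<And>y i. y \<in> X \<Longrightarrow> y \<noteq> x + h * of_int i"
proof -
  have "countable ((\<lambda>(y, i). y - h * real_of_int i) ` (X \<times> UNIV))"
    using assms by (intro countable_image countable_SIGMA countable_finite countableI_type)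
  moreover have "uncountable {0..1::real}" by (simp add: uncountable_closed_interval)
  ultimately have "uncountable ({0..1} - (\<lambda>(y, i). y - h * real_of_int i) ` (X \<times> UNIV))"
    by (rule_tac uncountable_minus_countable)
  then obtain x where x: "x \<in> {0..1}" "x \<notin> (\<lambda>(y, i). y - h * real_of_int i) ` (X \<times> UNIV)"
    by (metis DiffE countable_empty equals0I)
  show thesis
  proof (rule that)
    fix y i assume "y \<in> X"
    then show "y \<noteq> x + h * of_int i"
      using x(2) by (force simp: image_iff)
  qed (use x in auto)
qed

definition grid_pt :: "real \<Rightarrow> real \<Rightarrow> int \<Rightarrow> int \<Rightarrow> complex" where
  "grid_pt x h i j = Complex (x + h * of_int i) (x + h * of_int j)"

definition grid_cell :: "real \<Rightarrow> real \<Rightarrow> int \<Rightarrow> int \<Rightarrow> complex set" where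
  "grid_cell x h i j = cbox (grid_pt x h i j) (grid_pt x h (i + 1) (j + 1))"

lemma grid_cell_iff:
  "z \<in> grid_cell x h i j \<longleftrightarrow>
     x + h * of_int i \<le> Re z \<and> Re z \<le> x + h * of_int i + h \<and>
     x + h * of_int j \<le> Im z \<and> Im z \<le> x + h * of_int j + h"
  by (auto simp: grid_cell_def grid_pt_def in_cbox_complex_iff algebra_simps)

lemma grid_cell_dist:
  assumes "z \<in> grid_cell x h i j" "w \<in> grid_cell x h i j"
  shows "dist z w \<le> 2 * h"
proof -
  have "dist z w \<le> \<bar>Re (z - w)\<bar> + \<bar>Im (z - w)\<bar>" unfolding dist_norm by (rule cmod_le)
  then show ?thesis using assms by (auto simp: grid_cell_iff)
qed

lemma closed_segment_subset_grid_cell: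
  assumes "h \<ge> 0"
  shows "closed_segment (grid_pt x h i j) (grid_pt x h (i + 1) j) \<subseteq> grid_cell x h i j"
    "closed_segment (grid_pt x h i j) (grid_pt x h (i + 1) j) \<subseteq> grid_cell x h i (j - 1)"
    "closed_segment (grid_pt x h i j) (grid_pt x h i (j + 1)) \<subseteq> grid_cell x h i j"
    "closed_segment (grid_pt x h i j) (grid_pt x h i (j + 1)) \<subseteq> grid_cell x h (i - 1) j"
proof -
  have sub: "closed_segment p q \<subseteq> grid_cell x h k l"
    if "p \<in> grid_cell x h k l" "q \<in> grid_cell x h k l" for p q k l
    using that by (intro closed_segment_subset) (auto simp: grid_cell_def convex_box)
  show "closed_segment (grid_pt x h i j) (grid_pt x h (i + 1) j) \<subseteq> grid_cell x h i j"
    by (rule sub) (use assms in \<open>simp_all add: grid_cell_iff grid_pt_def algebra_simps\<close>)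
  show "closed_segment (grid_pt x h i j) (grid_pt x h (i + 1) j) \<subseteq> grid_cell x h i (j - 1)"
    by (rule sub) (use assms in \<open>simp_all add: grid_cell_iff grid_pt_def algebra_simps\<close>)
  show "closed_segment (grid_pt x h i j) (grid_pt x h i (j + 1)) \<subseteq> grid_cell x h i j"
    by (rule sub) (use assms in \<open>simp_all add: grid_cell_iff grid_pt_def algebra_simps\<close>)
  show "closed_segment (grid_pt x h i j) (grid_pt x h i (j + 1)) \<subseteq> grid_cell x h (i - 1) j"
    by (rule sub) (use assms in \<open>simp_all add: grid_cell_iff grid_pt_def algebra_simps\<close>)
qed

lemma contour_integral_grid_cell:
  assumes h: "h > 0" and U: "convex C" "open C" "f holomorphic_on C" "grid_cell x h i j \<subseteq> C"
    and w: "\<And>l. Re w \<noteq> x + h * of_int l" "\<And>l. Im w \<noteq> x + h * of_int l"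
  shows "((\<lambda>\<zeta>. f \<zeta> / (\<zeta> - w)) has_contour_integral
      (2 * pi * \<i> * (if i = \<lfloor>(Re w - x) / h\<rfloor> \<and> j = \<lfloor>(Im w - x) / h\<rfloor> then 1 else 0) * f w))
      (rectpath (grid_pt x h i j) (grid_pt x h (i + 1) (j + 1)))"
proof -
  let ?p = "grid_pt x h i j" and ?q = "grid_pt x h (i + 1) (j + 1)"
  have le: "Re ?p \<le> Re ?q" "Im ?p \<le> Im ?q" and lt: "Re ?p < Re ?q" "Im ?p < Im ?q"
    using h by (auto simp: grid_pt_def algebra_simps)
  have img: "path_image (rectpath ?p ?q) = grid_cell x h i j - box ?p ?q"
    using path_image_rectpath_cbox_minus_box[OF le] by (simp add: grid_cell_def)
  have floor: "i = \<lfloor>(y - x) / h\<rfloor> \<longleftrightarrow> x + h * of_int i \<le> y \<and> y < x + h * of_int i + h" for y i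
  proof -
    have "i = \<lfloor>(y - x) / h\<rfloor> \<longleftrightarrow> of_int i \<le> (y - x) / h \<and> (y - x) / h < of_int i + 1"
      by (metis floor_eq_iff)
    then show ?thesis using h by (simp add: field_simps)
  qed
  have inbox: "i = \<lfloor>(Re w - x) / h\<rfloor> \<and> j = \<lfloor>(Im w - x) / h\<rfloor> \<longleftrightarrow> w \<in> box ?p ?q"
    unfolding floor using w(1)[of i] w(2)[of j]
    by (auto simp: grid_pt_def in_box_complex_iff algebra_simps)
  have incbox: "w \<in> grid_cell x h i j \<longleftrightarrow> w \<in> box ?p ?q"
    using w(1)[of i] w(2)[of j] w(1)[of "i+1"] w(2)[of "j+1"]
    by (auto simp: grid_cell_iff grid_pt_def in_box_complex_iff algebra_simps)
  have wn: "winding_number (rectpath ?p ?q) w = (if w \<in> box ?p ?q then 1 else 0)"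
  proof (cases "w \<in> box ?p ?q")
    case True
    then show ?thesis by (simp add: winding_number_rectpath)
  next
    case False
    then have "w \<notin> cbox ?p ?q" using incbox by (simp add: grid_cell_def)
    then show ?thesis using False winding_number_rectpath_outside[OF le] by simp
  qed
  show ?thesis
  proof (cases "w \<in> C")
    case True
    have "((\<lambda>\<zeta>. f \<zeta> / (\<zeta> - w)) has_contour_integral (2 * pi * \<i> * winding_number (rectpath ?p ?q) w * f w)) (rectpath ?p ?q)"
    proof (rule Cauchy_integral_formula_convex_simple[OF U(1,3)])
      show "w \<in> interior C" using True U(2) by (simp add: interior_open)
      show "path_image (rectpath ?p ?q) \<subseteq> C - {w}" using img U(4) incbox by auto
    qed auto
    then show ?thesis unfolding wn inbox by simp
  next
    case False
    then have "w \<notin> box ?p ?q" using incbox U(4) by auto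
    moreover have "((\<lambda>\<zeta>. f \<zeta> / (\<zeta> - w)) has_contour_integral 0) (rectpath ?p ?q)"
    proof (rule Cauchy_theorem_convex_simple[of _ C])
      show "(\<lambda>\<zeta>. f \<zeta> / (\<zeta> - w)) holomorphic_on C"
        using False U(3) by (intro holomorphic_intros) auto
    qed (use img U in auto)
    ultimately show ?thesis unfolding inbox by simp
  qed
qed

lemma contour_integral_rectpath_edges:
  fixes F :: "complex \<Rightarrow> complex"
  assumes cont: "continuous_on (path_image (rectpath (grid_pt x h i j) (grid_pt x h (i + 1) (j + 1)))) F"
    and h: "h > 0"
  shows "contour_integral (rectpath (grid_pt x h i j) (grid_pt x h (i + 1) (j + 1))) F =
     contour_integral (linepath (grid_pt x h i j) (grid_pt x h (i + 1) j)) F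
   - contour_integral (linepath (grid_pt x h i (j + 1)) (grid_pt x h (i + 1) (j + 1))) F
   - (contour_integral (linepath (grid_pt x h i j) (grid_pt x h i (j + 1))) F
   - contour_integral (linepath (grid_pt x h (i + 1) j) (grid_pt x h (i + 1) (j + 1))) F)"
proof -
  define a b c d where "a = grid_pt x h i j" and "b = grid_pt x h (i + 1) j"
    and "c = grid_pt x h (i + 1) (j + 1)" and "d = grid_pt x h i (j + 1)"
  have r: "rectpath a c = linepath a b +++ linepath b c +++ linepath c d +++ linepath d a"
    by (simp add: rectpath_def Let_def a_def b_def c_def d_def grid_pt_def)
  have img: "path_image (rectpath a c) = closed_segment a b \<union> closed_segment b c \<union> closed_segment c d \<union> closed_segment d a"
    by (simp add: r path_image_join Un_assoc)
  have ci: "F contour_integrable_on linepath a b" "F contour_integrable_on linepath b c"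
    "F contour_integrable_on linepath c d" "F contour_integrable_on linepath d a"
    "F contour_integrable_on linepath d c" "F contour_integrable_on linepath a d"
    using cont unfolding a_def[symmetric] c_def[symmetric] img
    by (auto intro!: contour_integrable_continuous_linepath elim!: continuous_on_subset simp: closed_segment_commute)
  have "contour_integral (rectpath a c) F = contour_integral (linepath a b) F + (contour_integral (linepath b c) F +
      (contour_integral (linepath c d) F + contour_integral (linepath d a) F))"
    unfolding r using ci by (simp add: contour_integrable_joinI valid_path_join)
  also have "contour_integral (linepath c d) F = - contour_integral (linepath d c) F"
    using ci cont img by (intro contour_integral_reverse_linepath) (auto elim!: continuous_on_subset simp: a_def c_def closed_segment_commute)
  also have "contour_integral (linepath d a) F = - contour_integral (linepath a d) F"
    using ci cont img by (intro contour_integral_reverse_linepath) (auto elim!: continuous_on_subset simp: a_def c_def closed_segment_commute)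
  finally show ?thesis by (simp add: a_def b_def c_def d_def)
qed

lemma card_grid_cells_le:
  assumes h: "h > 0" "h \<le> 1" and x: "0 \<le> x" "x \<le> 1" and R: "R \<ge> 0"
    and T: "\<And>i j. (i, j) \<in> T \<Longrightarrow> \<exists>z\<in>grid_cell x h i j. norm z \<le> R + 1"
  shows "finite T" "real (card T) \<le> ((2 * R + 9) / h)\<^sup>2"
proof -
  define n where "n = \<lfloor>(R + 3) / h\<rfloor>"
  have bnd: "-n \<le> i \<and> i \<le> n" if "x + h * of_int i \<le> y" "y \<le> x + h * of_int i + h" "\<bar>y\<bar> \<le> R + 1" for i y
  proof -
    have "\<bar>h * of_int i\<bar> \<le> R + 3" using that h x R by (auto simp: abs_le_iff)
    then have "\<bar>of_int i\<bar> \<le> (R + 3) / h" using h by (simp add: abs_mult field_simps)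
    then have "of_int i \<le> (R + 3) / h" "of_int (- i) \<le> (R + 3) / h" by auto
    then show ?thesis unfolding n_def by (metis le_floor_iff minus_le_iff)
  qed
  have sub: "T \<subseteq> {-n..n} \<times> {-n..n}"
  proof (intro subrelI)
    fix i j assume "(i, j) \<in> T"
    then obtain z where z: "z \<in> grid_cell x h i j" "norm z \<le> R + 1" using T by blast
    have "\<bar>Re z\<bar> \<le> R + 1" "\<bar>Im z\<bar> \<le> R + 1"
      using z(2) abs_Re_le_cmod[of z] abs_Im_le_cmod[of z] by linarith+
    then show "(i, j) \<in> {-n..n} \<times> {-n..n}"
      using z(1) bnd[of i "Re z"] bnd[of j "Im z"] by (auto simp: grid_cell_iff)
  qed
  show "finite T" using sub by (rule finite_subset) auto
  have n: "0 \<le> n" "of_int n \<le> (R + 3) / h" using h R by (auto simp: n_def)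
  have "card T \<le> card ({-n..n} \<times> {-n..n})" by (rule card_mono[OF _ sub]) auto
  also have "\<dots> = (nat (2 * n + 1))\<^sup>2" by (simp add: card_cartesian_product power2_eq_square algebra_simps)
  finally have "real (card T) \<le> (real (nat (2 * n + 1)))\<^sup>2" by (metis of_nat_le_iff of_nat_power)
  also have "real (nat (2 * n + 1)) = 2 * of_int n + 1" using n by simp
  also have "(2 * of_int n + 1)\<^sup>2 \<le> ((2 * R + 9) / h)\<^sup>2"
  proof (rule power_mono)
    have "2 * of_int n + 1 \<le> 2 * ((R + 3) / h) + 3 / h" using n(2) h by (simp add: field_simps)
    then show "2 * of_int n + 1 \<le> (2 * R + 9) / h" using h by (simp add: field_simps)
  qed (use n in auto)
  finally show "real (card T) \<le> ((2 * R + 9) / h)\<^sup>2" .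
qed

text \<open>The sum is the integral of \<open>f\<close> against the measure with masses \<open>c k\<close> at \<open>w k\<close>. By Cauchy's formula it
equals the sum of the integrals of \<open>f\<close> times the Cauchy transform of this measure, divided by
\<open>2 \<pi> \<i>\<close>, over the boundaries of all squares that meet the enlargement of \<open>E\<close> by \<open>\<delta>/2\<close>. An edge
that remains after cancellation lies between a square that meets this enlargement and one that does
not, so it runs where \<open>\<delta>/2 \<le> infdist \<zeta> E \<le> \<delta>\<close>. The offset of the grid is chosen so that no \<open>w k\<close> lies on
a grid line.\<close>

lemma cauchy_transform_estimate:
  fixes f :: "complex \<Rightarrow> complex" and w c :: "'i \<Rightarrow> complex"
  assumes E: "E \<noteq> {}" "\<And>z. z \<in> E \<Longrightarrow> norm z \<le> R" "R \<ge> 0" and \<delta>: "0 < \<delta>" "\<delta> \<le> 1"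
    and U: "open U" "enlargement E \<delta> \<subseteq> U" "f holomorphic_on U"
    and I: "finite I" "\<And>k. k \<in> I \<Longrightarrow> w k \<in> E"
    and A: "A \<ge> 0" "\<And>z. infdist z E \<le> \<delta> \<Longrightarrow> norm (f z) \<le> A"
    and B: "B \<ge> 0" "\<And>\<zeta>. \<delta>/2 \<le> infdist \<zeta> E \<Longrightarrow> infdist \<zeta> E \<le> \<delta> \<Longrightarrow> norm (\<Sum>k\<in>I. c k / (\<zeta> - w k)) \<le> B"
  shows "norm (\<Sum>k\<in>I. c k * f (w k)) \<le> 32 * (2 * R + 9)\<^sup>2 / \<delta> * A * B"
proof -
  have inU: "z \<in> U" if "infdist z E \<le> \<delta>" for z
    using that U(2) E(1) unfolding enlargement_def by blast
  define h where "h = \<delta> / 8"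
  have h: "h > 0" "h \<le> 1" using \<delta> by (auto simp: h_def)
  obtain x where x: "0 \<le> x" "x \<le> 1" and
    gen: "\<And>y l. y \<in> Re ` w ` I \<union> Im ` w ` I \<Longrightarrow> y \<noteq> x + h * of_int l"
    using ex_generic_offset[of "Re ` w ` I \<union> Im ` w ` I" h] I(1) by blast
  have gen': "Re (w k) \<noteq> x + h * of_int l" "Im (w k) \<noteq> x + h * of_int l" if "k \<in> I" for k l
    using gen that by auto
  define T where "T = {(i, j). \<exists>z\<in>grid_cell x h i j. infdist z E \<le> \<delta>/2}"
  have near: "\<exists>b\<in>E. dist z b < infdist z E + e" if "e > 0" for z e
  proof -
    have "Inf (dist z ` E) < infdist z E + e" using that E(1) by (simp add: infdist_notempty)
    from cInf_lessD[OF _ this] show ?thesis using E(1) by auto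
  qed
  have T: "finite T" "real (card T) \<le> ((2 * R + 9) / h)\<^sup>2"
  proof -
    have *: "\<exists>z\<in>grid_cell x h i j. norm z \<le> R + 1" if ij: "(i, j) \<in> T" for i j
    proof -
      obtain z where z: "z \<in> grid_cell x h i j" "infdist z E \<le> \<delta>/2" using ij unfolding T_def by blast
      obtain b where "b \<in> E" "dist z b < infdist z E + 1/2" using near[of "1/2" z] by auto
      then have "norm z \<le> R + 1"
        using norm_triangle_sub[of z b] E(2)[of b] z(2) \<delta> by (simp add: dist_norm)
      then show ?thesis using z by blast
    qed
    show "finite T" "real (card T) \<le> ((2 * R + 9) / h)\<^sup>2"
      using card_grid_cells_le[OF h x E(3), of T] * by blast+
  qed
  have close: "infdist z E \<le> \<delta>" if ij: "(i, j) \<in> T" and z: "z \<in> grid_cell x h i j" for z i j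
  proof -
    obtain y where y: "y \<in> grid_cell x h i j" "infdist y E \<le> \<delta>/2" using ij by (auto simp: T_def)
    have "infdist z E \<le> infdist y E + dist z y" by (rule infdist_triangle)
    then show ?thesis using y(2) grid_cell_dist[OF z y(1)] h_def \<delta>(1) by linarith
  qed
  have far: "infdist z E \<ge> \<delta>/2" if "(i, j) \<notin> T" and "z \<in> grid_cell x h i j" for z i j
    using that by (force simp: T_def)
  define F where "F = (\<lambda>\<zeta>. f \<zeta> * (\<Sum>k\<in>I. c k / (\<zeta> - w k)))"
  have F_eq: "F \<zeta> = (\<Sum>k\<in>I. c k * (f \<zeta> / (\<zeta> - w k)))" for \<zeta>
    by (simp add: F_def sum_distrib_left mult_ac)
  define Q where "Q = (\<lambda>t. rectpath (grid_pt x h (fst t) (snd t)) (grid_pt x h (fst t + 1) (snd t + 1)))"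
  define H V where "H = (\<lambda>t. contour_integral (linepath (grid_pt x h (fst t) (snd t)) (grid_pt x h (fst t + 1) (snd t))) F)"
    and "V = (\<lambda>t. contour_integral (linepath (grid_pt x h (fst t) (snd t)) (grid_pt x h (fst t) (snd t + 1))) F)"
  \<comment> \<open>Each pole lies in exactly one square, and this square is one of those near \<open>E\<close>.\<close>
  define pos where "pos = (\<lambda>k. (\<lfloor>(Re (w k) - x) / h\<rfloor>, \<lfloor>(Im (w k) - x) / h\<rfloor>))"
  have pos: "pos k \<in> T" if k: "k \<in> I" for k
  proof -
    have *: "x + h * of_int \<lfloor>(y - x) / h\<rfloor> \<le> y" "y \<le> x + h * of_int \<lfloor>(y - x) / h\<rfloor> + h" for y
    proof -
      have "of_int \<lfloor>(y - x) / h\<rfloor> * h \<le> y - x"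
        using pos_le_divide_eq[OF h(1)] of_int_floor_le by blast
      moreover have "y - x \<le> (of_int \<lfloor>(y - x) / h\<rfloor> + 1) * h"
        using pos_divide_le_eq[OF h(1)] real_of_int_floor_add_one_ge by blast
      ultimately show "x + h * of_int \<lfloor>(y - x) / h\<rfloor> \<le> y" "y \<le> x + h * of_int \<lfloor>(y - x) / h\<rfloor> + h"
        by (simp_all add: ring_distribs mult.commute)
    qed
    have "w k \<in> grid_cell x h (fst (pos k)) (snd (pos k))"
      using * by (simp add: grid_cell_iff pos_def)
    moreover have "infdist (w k) E \<le> \<delta>/2" using I(2)[OF k] \<delta> by simp
    ultimately show ?thesis by (auto simp: T_def case_prod_beta)
  qed
  have cell: "(F has_contour_integral (\<Sum>k\<in>I. c k * (2 * pi * \<i> * (if t = pos k then 1 else 0) * f (w k)))) (Q t)"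
    if t: "t \<in> T" for t
  proof -
    obtain i j where ij: "t = (i, j)" by (cases t)
    obtain y where y: "y \<in> grid_cell x h i j" "infdist y E \<le> \<delta>/2" using t by (auto simp: T_def ij)
    have sub: "ball y (\<delta>/2) \<subseteq> U"
    proof
      fix z assume z: "z \<in> ball y (\<delta>/2)"
      have "infdist z E \<le> infdist y E + dist z y" by (rule infdist_triangle)
      then have "infdist z E \<le> \<delta>" using z y(2) by (simp add: dist_commute)
      then show "z \<in> U" by (rule inU)
    qed
    have cellsub: "grid_cell x h i j \<subseteq> ball y (\<delta>/2)"
      using grid_cell_dist[OF y(1)] \<delta> by (force simp: h_def)
    have "((\<lambda>\<zeta>. f \<zeta> / (\<zeta> - w k)) has_contour_integral
      (2 * pi * \<i> * (if i = \<lfloor>(Re (w k) - x) / h\<rfloor> \<and> j = \<lfloor>(Im (w k) - x) / h\<rfloor> then 1 else 0) * f (w k)))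
      (rectpath (grid_pt x h i j) (grid_pt x h (i + 1) (j + 1)))" if k: "k \<in> I" for k
      using contour_integral_grid_cell[OF h(1) convex_ball open_ball holomorphic_on_subset[OF U(3) sub] cellsub gen'[OF k]] .
    then have "((\<lambda>\<zeta>. f \<zeta> / (\<zeta> - w k)) has_contour_integral
      (2 * pi * \<i> * (if t = pos k then 1 else 0) * f (w k))) (Q t)" if k: "k \<in> I" for k
      using k by (simp add: ij pos_def Q_def)
    then show ?thesis unfolding F_eq
      by (intro has_contour_integral_sum I has_contour_integral_lmul)
  qed
  have contF: "continuous_on X F" if "X \<subseteq> U" "\<And>k. k \<in> I \<Longrightarrow> w k \<notin> X" for X
    unfolding F_def using that
    by (intro continuous_intros continuous_on_subset[OF holomorphic_on_imp_continuous_on[OF U(3)]]) auto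
  have ReIm: "Im z = x + h * of_int j" if "z \<in> closed_segment (grid_pt x h i j) (grid_pt x h (i + 1) j)" for z i j
    using that by (simp add: grid_pt_def closed_segment_same_Im)
  have ImRe: "Re z = x + h * of_int i" if "z \<in> closed_segment (grid_pt x h i j) (grid_pt x h i (j + 1))" for z i j
    using that by (simp add: grid_pt_def closed_segment_same_Re)
  have edges: "contour_integral (Q t) F = (H t - H (fst t, snd t + 1)) - (V t - V (fst t + 1, snd t))" if t: "t \<in> T" for t
  proof -
    obtain i j where ij: "t = (i, j)" by (cases t)
    let ?p = "grid_pt x h i j" and ?q = "grid_pt x h (i + 1) (j + 1)"
    have le: "Re ?p \<le> Re ?q" "Im ?p \<le> Im ?q" using h by (auto simp: grid_pt_def algebra_simps)
    have "continuous_on (path_image (rectpath ?p ?q)) F"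
    proof (rule contF)
      have "path_image (rectpath ?p ?q) \<subseteq> grid_cell x h i j"
        using path_image_rectpath_subset_cbox[OF le] by (simp add: grid_cell_def)
      then show "path_image (rectpath ?p ?q) \<subseteq> U"
        using close[of i j] t inU unfolding ij by blast
      show "w k \<notin> path_image (rectpath ?p ?q)" if k: "k \<in> I" for k
        using gen'[OF k, of i] gen'[OF k, of j] gen'[OF k, of "i + 1"] gen'[OF k, of "j + 1"]
        unfolding path_image_rectpath[OF le] by (auto simp: grid_pt_def)
    qed
    from contour_integral_rectpath_edges[OF this h(1)] show ?thesis
      by (simp add: Q_def H_def V_def ij)
  qed
  have edge_bound: "norm (contour_integral (linepath p q) F) \<le> A * B * h"
    if "(i, j) \<in> T" "(i', j') \<notin> T" "closed_segment p q \<subseteq> grid_cell x h i j"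
      "closed_segment p q \<subseteq> grid_cell x h i' j'" "norm (q - p) = h"
      "\<And>k. k \<in> I \<Longrightarrow> w k \<notin> closed_segment p q" for i j i' j' p q
  proof -
    have d: "infdist z E \<le> \<delta>" "\<delta>/2 \<le> infdist z E" if "z \<in> closed_segment p q" for z
      using close[of i j z] far[of i' j' z] that \<open>(i, j) \<in> T\<close> \<open>(i', j') \<notin> T\<close>
        \<open>closed_segment p q \<subseteq> grid_cell x h i j\<close> \<open>closed_segment p q \<subseteq> grid_cell x h i' j'\<close> by blast+
    have "closed_segment p q \<subseteq> U" using d(1) inU by blast
    then have "F contour_integrable_on (linepath p q)"
      using that(6) by (intro contour_integrable_continuous_linepath contF) auto
    then have "norm (contour_integral (linepath p q) F) \<le> A * B * norm (q - p)"
    proof (rule contour_integral_bound_linepath)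
      show "0 \<le> A * B" using A(1) B(1) by simp
      show "norm (F z) \<le> A * B" if "z \<in> closed_segment p q" for z
        unfolding F_def norm_mult using A(1) A(2)[OF d(1)[OF that]] B(2)[OF d(2)[OF that] d(1)[OF that]]
        by (intro mult_mono) auto
    qed
    then show ?thesis using that(5) by simp
  qed
  have norms: "norm (grid_pt x h (i + 1) j - grid_pt x h i j) = h" "norm (grid_pt x h i (j + 1) - grid_pt x h i j) = h" for i j
    using h by (simp_all add: grid_pt_def cmod_def algebra_simps)
  have sumH: "norm (\<Sum>t\<in>T. H t - H (fst t, snd t + 1)) \<le> 2 * real (card T) * (A * B * h)"
  proof (rule norm_sum_shift_le[OF T(1), where \<sigma> = "\<lambda>t. (fst t, snd t + 1)"])
    show "inj (\<lambda>t::int \<times> int. (fst t, snd t + 1))" by (auto simp: inj_def)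
    show "0 \<le> A * B * h" using A(1) B(1) h by simp
    fix t assume t: "t \<in> T - (\<lambda>t. (fst t, snd t + 1)) ` T \<or> t \<in> (\<lambda>t. (fst t, snd t + 1)) ` T - T"
    obtain i j where ij: "t = (i, j)" by (cases t)
    have im: "(i, j) \<in> (\<lambda>t. (fst t, snd t + 1)) ` T \<longleftrightarrow> (i, j - 1) \<in> T"
      by (force simp: image_iff)
    have seg: "closed_segment (grid_pt x h i j) (grid_pt x h (i + 1) j) \<subseteq> grid_cell x h i j"
      "closed_segment (grid_pt x h i j) (grid_pt x h (i + 1) j) \<subseteq> grid_cell x h i (j - 1)"
      using closed_segment_subset_grid_cell h by auto
    have nw: "w k \<notin> closed_segment (grid_pt x h i j) (grid_pt x h (i + 1) j)" if "k \<in> I" for k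
      using ReIm gen'(2)[OF that] by blast
    have "(i, j) \<in> T \<and> (i, j - 1) \<notin> T \<or> (i, j - 1) \<in> T \<and> (i, j) \<notin> T" using t im unfolding ij by blast
    then show "norm (H t) \<le> A * B * h"
      unfolding H_def ij fst_conv snd_conv using edge_bound seg norms(1) nw by metis
  qed
  have sumV: "norm (\<Sum>t\<in>T. V t - V (fst t + 1, snd t)) \<le> 2 * real (card T) * (A * B * h)"
  proof (rule norm_sum_shift_le[OF T(1), where \<sigma> = "\<lambda>t. (fst t + 1, snd t)"])
    show "inj (\<lambda>t::int \<times> int. (fst t + 1, snd t))" by (auto simp: inj_def)
    show "0 \<le> A * B * h" using A(1) B(1) h by simp
    fix t assume t: "t \<in> T - (\<lambda>t. (fst t + 1, snd t)) ` T \<or> t \<in> (\<lambda>t. (fst t + 1, snd t)) ` T - T"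
    obtain i j where ij: "t = (i, j)" by (cases t)
    have im: "(i, j) \<in> (\<lambda>t. (fst t + 1, snd t)) ` T \<longleftrightarrow> (i - 1, j) \<in> T"
      by (force simp: image_iff)
    have seg: "closed_segment (grid_pt x h i j) (grid_pt x h i (j + 1)) \<subseteq> grid_cell x h i j"
      "closed_segment (grid_pt x h i j) (grid_pt x h i (j + 1)) \<subseteq> grid_cell x h (i - 1) j"
      using closed_segment_subset_grid_cell h by auto
    have nw: "w k \<notin> closed_segment (grid_pt x h i j) (grid_pt x h i (j + 1))" if "k \<in> I" for k
      using ImRe gen'(1)[OF that] by blast
    have "(i, j) \<in> T \<and> (i - 1, j) \<notin> T \<or> (i - 1, j) \<in> T \<and> (i, j) \<notin> T" using t im unfolding ij by blast
    then show "norm (V t) \<le> A * B * h"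
      unfolding V_def ij fst_conv snd_conv using edge_bound seg norms(2) nw by metis
  qed
  have "(\<Sum>t\<in>T. contour_integral (Q t) F) = (\<Sum>t\<in>T. \<Sum>k\<in>I. c k * (2 * pi * \<i> * (if t = pos k then 1 else 0) * f (w k)))"
    using contour_integral_unique[OF cell] by (intro sum.cong) auto
  also have "\<dots> = (\<Sum>k\<in>I. \<Sum>t\<in>T. if t = pos k then c k * (2 * pi * \<i> * f (w k)) else 0)"
    by (subst sum.swap) (auto intro!: sum.cong)
  also have "\<dots> = (\<Sum>k\<in>I. c k * (2 * pi * \<i> * f (w k)))"
    using T(1) pos by (intro sum.cong) auto
  also have "\<dots> = 2 * pi * \<i> * (\<Sum>k\<in>I. c k * f (w k))"
    by (simp add: sum_distrib_left mult_ac)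
  finally have total: "2 * pi * \<i> * (\<Sum>k\<in>I. c k * f (w k)) =
      (\<Sum>t\<in>T. H t - H (fst t, snd t + 1)) - (\<Sum>t\<in>T. V t - V (fst t + 1, snd t))"
    by (simp add: edges sum_subtractf)
  define N where "N = norm (\<Sum>k\<in>I. c k * f (w k))"
  have "N \<le> 2 * pi * N" using pi_gt3 by (simp add: N_def mult_le_cancel_right1)
  also have "2 * pi * N = norm (2 * pi * \<i> * (\<Sum>k\<in>I. c k * f (w k)))" by (simp add: N_def norm_mult)
  also have "\<dots> \<le> norm (\<Sum>t\<in>T. H t - H (fst t, snd t + 1)) + norm (\<Sum>t\<in>T. V t - V (fst t + 1, snd t))"
    unfolding total by (rule norm_triangle_ineq4)
  also have "\<dots> \<le> 4 * real (card T) * (A * B * h)" using sumH sumV by linarith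
  also have "\<dots> \<le> 4 * ((2 * R + 9) / h)\<^sup>2 * (A * B * h)"
    using T(2) A(1) B(1) h by (intro mult_right_mono mult_left_mono) auto
  also have "\<dots> = 32 * (2 * R + 9)\<^sup>2 / \<delta> * A * B"
    using \<delta> by (simp add: h_def field_simps power2_eq_square)
  finally show ?thesis by (simp add: N_def)
qed

section \<open>Decay of the interpolation kernel\<close>

text \<open>Let \<open>K\<close> be the kernel on the left. At distance \<open>\<eta>\<close> from \<open>E\<close> the \<open>N + 1\<close> summands give
\<open>|K| \<le> (2 N + 1) / \<eta>\<close>. By \<open>interpolation_kernel\<close>, \<open>K\<close> is of order \<open>|\<zeta>|^(- N - 1)\<close> at
infinity, so \<open>|K| exp (N u)\<close> tends to 0 there, and the maximum principle carries the bound at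
distance \<open>\<eta>\<close> to all larger distances.\<close>

lemma interpolation_kernel_bound:
  assumes E: "compact E" "E = poly_hull E" "E \<noteq> {}" and u: "u \<in> green_candidates E"
    and A: "finite A" "A \<subseteq> E" "card A = N" "N > 0" and z: "z \<in> E" "z \<notin> A"
    and L: "\<And>a. a \<in> A \<Longrightarrow> norm (poly (lagrange_basis A a) z) \<le> 2"
    and \<eta>: "\<eta> > 0" "\<And>\<zeta>. infdist \<zeta> E = \<eta> \<Longrightarrow> u \<zeta> \<le> m" and \<zeta>: "infdist \<zeta> E > \<eta>"
  shows "norm (1 / (\<zeta> - z) - (\<Sum>a\<in>A. poly (lagrange_basis A a) z / (\<zeta> - a)))
      \<le> (2 * real N + 1) / \<eta> * exp (real N * m) * exp (- real N * u \<zeta>)"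
proof -
  define K where "K = (\<lambda>\<zeta>. 1 / (\<zeta> - z) - (\<Sum>a\<in>A. poly (lagrange_basis A a) z / (\<zeta> - a)))"
  define B where "B = (2 * real N + 1) / \<eta> * exp (real N * m)"
  have B: "B > 0" using \<eta>(1) by (simp add: B_def)
  define S where "S = {\<zeta>. infdist \<zeta> E > \<eta>}"
  define S' where "S' = {\<zeta>. infdist \<zeta> E \<ge> \<eta>}"
  have S: "open S" unfolding S_def by (intro open_Collect_less continuous_intros)
  have S': "closed S'" unfolding S'_def by (intro closed_Collect_le continuous_intros)
  have SS': "S \<subseteq> S'" by (auto simp: S_def S'_def)
  have S'E: "S' \<subseteq> - E" using \<eta>(1) by (auto simp: S'_def)
  have hu: "harmonic_on (- E) u" using u E(2) by (simp add: green_candidates_def)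
  have huS: "harmonic_on S u"
  proof -
    have "S \<subseteq> - E" using SS' S'E by blast
    moreover have "Ck_on k T v" if "T \<subseteq> X" "Ck_on k X v" for T X k and v :: "complex \<Rightarrow> real"
      using that by (induction k arbitrary: v) (auto intro: continuous_on_subset)
    ultimately show ?thesis using hu unfolding harmonic_on_def by blast
  qed
  obtain R0 where R0: "R0 > 0" "\<And>z. z \<in> E \<Longrightarrow> norm z \<le> R0" using compact_imp_bounded[OF E(1)] bounded_pos by blast
  obtain R1 C where R1: "R1 \<ge> 1" "C \<ge> 0" "\<And>z. norm z \<ge> R1 \<Longrightarrow> \<bar>u z - ln (norm z)\<bar> \<le> C"
    using green_candidate_log_bounds[OF u] by metis
  define val where "val = (\<lambda>\<zeta>. norm (K \<zeta>) * exp (real N * u \<zeta>))"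
  have Khol: "K holomorphic_on - E"
    unfolding K_def using z A(2) by (intro holomorphic_intros) auto
  have contval: "continuous_on S' val"
    unfolding val_def
    using continuous_on_subset[OF holomorphic_on_imp_continuous_on[OF Khol] S'E]
      continuous_on_subset[OF harmonic_on_continuous[OF hu] S'E]
    by (intro continuous_intros)
  have edge: "val \<zeta> \<le> B" if \<zeta>: "infdist \<zeta> E = \<eta>" for \<zeta>
  proof -
    have d: "norm (\<zeta> - b) \<ge> \<eta>" if "b \<in> E" for b
      using infdist_le[OF that, of \<zeta>] \<zeta> by (simp add: dist_norm)
    have "norm (K \<zeta>) \<le> norm (1 / (\<zeta> - z)) + norm (\<Sum>a\<in>A. poly (lagrange_basis A a) z / (\<zeta> - a))"
      unfolding K_def by (rule norm_triangle_ineq4)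
    also have "norm (1 / (\<zeta> - z)) \<le> 1 / \<eta>" using d[OF z(1)] \<eta>(1) by (simp add: norm_divide frac_le)
    also have "norm (\<Sum>a\<in>A. poly (lagrange_basis A a) z / (\<zeta> - a)) \<le> (\<Sum>a\<in>A. 2 / \<eta>)"
    proof (rule sum_norm_le)
      fix a assume a: "a \<in> A"
      then show "norm (poly (lagrange_basis A a) z / (\<zeta> - a)) \<le> 2 / \<eta>"
        using d[of a] A(2) \<eta>(1) L[OF a] by (auto simp: norm_divide intro!: frac_le)
    qed
    finally have "norm (K \<zeta>) \<le> (2 * real N + 1) / \<eta>"
      using A(3) by (simp add: add_divide_distrib mult.commute add.commute)
    moreover have "exp (real N * u \<zeta>) \<le> exp (real N * m)" using \<eta>(2)[OF \<zeta>] by (simp add: mult_left_mono)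
    ultimately show ?thesis unfolding val_def B_def using \<eta>(1) by (intro mult_mono) auto
  qed
  have decay: "val \<zeta> \<le> (2 * R0) ^ N * 2 ^ (N + 1) * exp (real N * C) / norm \<zeta>"
    if big: "norm \<zeta> \<ge> max (2 * R0) R1" for \<zeta>
  proof -
    have n0: "norm \<zeta> > 0" using big R0(1) by (metis max.bounded_iff mult_pos_pos order_less_le_trans zero_less_numeral)
    have half: "norm (\<zeta> - b) \<ge> norm \<zeta> / 2" if "b \<in> E" for b
      using norm_triangle_ineq2[of \<zeta> b] R0(2)[OF that] big by auto
    have nE: "\<zeta> \<notin> E"
    proof
      assume "\<zeta> \<in> E" then show False using half[of \<zeta>] n0 by simp
    qed
    have "K \<zeta> = (\<Prod>a\<in>A. (z - a) / (\<zeta> - a)) / (\<zeta> - z)"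
      unfolding K_def using A nE z by (intro interpolation_kernel) auto
    then have "norm (K \<zeta>) = (\<Prod>a\<in>A. norm (z - a) / norm (\<zeta> - a)) / norm (\<zeta> - z)"
      by (simp add: norm_divide flip: prod_norm)
    also have "\<dots> \<le> (\<Prod>a\<in>A. 2 * R0 / (norm \<zeta> / 2)) / (norm \<zeta> / 2)"
    proof (rule frac_le)
      show "(\<Prod>a\<in>A. norm (z - a) / norm (\<zeta> - a)) \<le> (\<Prod>a\<in>A. 2 * R0 / (norm \<zeta> / 2))"
      proof (intro prod_mono conjI)
        fix a assume a: "a \<in> A"
        have "norm (z - a) \<le> 2 * R0" using norm_triangle_ineq4[of z a] R0(2)[OF z(1)] R0(2)[of a] a A(2) by auto
        then show "norm (z - a) / norm (\<zeta> - a) \<le> 2 * R0 / (norm \<zeta> / 2)"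
          using half[of a] a A(2) n0 R0(1) by (intro frac_le) auto
      qed auto
    qed (use half[OF z(1)] n0 R0(1) in \<open>auto intro: prod_nonneg\<close>)
    also have "\<dots> = (2 * R0) ^ N * 2 ^ (N + 1) / norm \<zeta> ^ (N + 1)"
    proof -
      have "(4::real) ^ N = 2 ^ N * 2 ^ N" by (simp flip: power_mult_distrib)
      then show ?thesis using A(3) n0 by (simp add: power_divide power_mult_distrib field_simps)
    qed
    finally have K: "norm (K \<zeta>) \<le> (2 * R0) ^ N * 2 ^ (N + 1) / norm \<zeta> ^ (N + 1)" .
    have "u \<zeta> \<le> ln (norm \<zeta>) + C" using R1(3)[of \<zeta>] big by auto
    then have "real N * u \<zeta> \<le> real N * (ln (norm \<zeta>) + C)" by (intro mult_left_mono) auto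
    then have "exp (real N * u \<zeta>) \<le> exp (real N * ln (norm \<zeta>) + real N * C)" by (simp add: distrib_left)
    also have "\<dots> = norm \<zeta> ^ N * exp (real N * C)"
      using n0 by (simp add: exp_add exp_of_nat_mult)
    finally have "val \<zeta> \<le> ((2 * R0) ^ N * 2 ^ (N + 1) / norm \<zeta> ^ (N + 1)) * (norm \<zeta> ^ N * exp (real N * C))"
      unfolding val_def using K R0(1) by (intro mult_mono) auto
    also have "\<dots> = (2 * R0) ^ N * 2 ^ (N + 1) * exp (real N * C) / norm \<zeta>"
      using n0 by (simp add: field_simps)
    finally show ?thesis .
  qed
  have "norm (K \<zeta>) * exp (real N * u \<zeta>) \<le> B"
  proof (rule harmonic_maximum_principle[OF S huS])
    show "K holomorphic_on S" using Khol SS' S'E holomorphic_on_subset by blast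
    show "\<zeta> \<in> S" using \<zeta> by (simp add: S_def)
    fix e :: real assume e: "e > 0"
    define X where "X = {\<zeta>\<in>S. norm (K \<zeta>) * exp (real N * u \<zeta>) \<ge> B + e}"
    have X: "X = S' \<inter> val -` {B + e..}"
    proof (intro equalityI subsetI)
      fix y assume y: "y \<in> S' \<inter> val -` {B + e..}"
      then have "infdist y E \<noteq> \<eta>" using edge[of y] e by auto
      then show "y \<in> X" using y by (auto simp: X_def S_def S'_def val_def)
    qed (use SS' in \<open>auto simp: X_def val_def\<close>)
    have "closed X" unfolding X by (rule continuous_closed_preimage[OF contval S']) simp
    moreover have "bounded X"
    proof -
      define P where "P = (2 * R0) ^ N * 2 ^ (N + 1) * exp (real N * C)"
      have "norm y \<le> max (max (2 * R0) R1) (P / B)" if y: "y \<in> X" for y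
      proof (rule ccontr)
        assume "\<not> norm y \<le> max (max (2 * R0) R1) (P / B)"
        then have big: "norm y \<ge> max (2 * R0) R1" "norm y > P / B" by auto
        have "norm y > 0" using big(1) R1(1) by auto
        have "val y \<le> P / norm y" using decay[OF big(1)] by (simp add: P_def)
        also have "\<dots> < B" using big(2) B \<open>norm y > 0\<close> by (simp add: field_simps)
        finally show False using y e by (simp add: X)
      qed
      then show ?thesis using boundedI by blast
    qed
    ultimately show "compact {z \<in> S. B + e \<le> norm (K z) * exp (real N * u z)}"
      by (simp add: X_def compact_eq_bounded_closed)
  qed (use B in simp)
  then have "norm (K \<zeta>) \<le> B / exp (real N * u \<zeta>)" by (simp add: field_simps)
  then show ?thesis by (simp add: K_def B_def exp_minus divide_inverse)
qed

section \<open>The Lojasiewicz--Siciak inequality and Hoelder continuity imply the Jackson property\<close>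

lemma holomorphic_on_of_dbar_eq_0:
  assumes U: "open U" and d: "\<And>z. z \<in> U \<Longrightarrow> f differentiable (at z)" and z: "\<And>z. z \<in> U \<Longrightarrow> dbar f z = 0"
  shows "f holomorphic_on U"
  unfolding holomorphic_on_open[OF U]
proof
  fix z assume "z \<in> U"
  define D where "D = frechet_derivative f (at z)"
  have D: "(f has_derivative D) (at z)" using d[OF \<open>z \<in> U\<close>] by (simp add: D_def frechet_derivative_works)
  have "D 1 + \<i> * D \<i> = 0"
    using z[OF \<open>z \<in> U\<close>] by (simp add: dbar_def dir_deriv_eq[OF D])
  then have "\<i> * (D 1 + \<i> * D \<i>) = 0" by simp
  then have Di: "D \<i> = \<i> * D 1" by (simp add: distrib_left flip: mult.assoc)
  have "D h = D 1 * h" for h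
  proof -
    have lin: "linear D" using D by (rule has_derivative_linear)
    have "h = Re h *\<^sub>R 1 + Im h *\<^sub>R \<i>" by (simp add: complex_eq_iff)
    then have "D h = Re h *\<^sub>R D 1 + Im h *\<^sub>R D \<i>"
      using linear_add[OF lin] linear_cmul[OF lin] by metis
    also have "\<dots> = D 1 * (of_real (Re h) + \<i> * of_real (Im h))"
      by (simp add: Di scaleR_conv_of_real algebra_simps)
    finally show ?thesis by (simp add: complex_eq[symmetric])
  qed
  then have "D = (\<lambda>h. D 1 * h)" by (rule ext)
  then show "\<exists>f'. (f has_field_derivative f') (at z)"
    using D unfolding has_field_derivative_def by metis
qed

lemma H_infinityD:
  assumes "f \<in> H_infinity K"
  obtains U where "open U" "K \<subseteq> U" "f holomorphic_on U"
proof -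
  obtain U where U: "open U" "K \<subseteq> U" "\<And>z. z \<in> U \<Longrightarrow> dbar f z = 0" and C: "\<And>k. Ck_on k UNIV f"
    using assms by (auto simp: H_infinity_def)
  have "f differentiable (at z)" for z using C[of 1] by simp
  then have "f holomorphic_on U" using U by (intro holomorphic_on_of_dbar_eq_0) auto
  then show thesis using that U by blast
qed

lemma poly_dist_le:
  assumes "degree p \<le> n" "\<And>z. z \<in> E \<Longrightarrow> norm (f z - poly p z) \<le> C"
  shows "poly_dist E f n \<le> ennreal C"
proof -
  have "poly_dist E f n \<le> sup_norm_on E (\<lambda>z. f z - poly p z)"
    unfolding poly_dist_def using assms(1) by (intro INF_lower) auto
  also have "\<dots> \<le> ennreal C"
    using assms(2) by (auto simp: sup_norm_on_le_iff intro: ennreal_leI)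
  finally show ?thesis .
qed

text \<open>With \<open>N = n + 1\<close>, the upper bound on \<open>u\<close> enters only at distance \<open>\<eta> = (\<delta>/4) N^(-k)\<close> from \<open>E\<close>,
where it gives \<open>N u \<le> M2\<close>: the growth of \<open>u\<close> costs a constant factor, and \<open>1/\<eta>\<close> a polynomial one.
The lower bound on \<open>u\<close> is used at distances between \<open>\<delta>/2\<close> and \<open>\<delta>\<close> and produces the exponential
decay.\<close>

lemma interpolation_error:
  assumes E: "compact E" "E = poly_hull E" "E \<noteq> {}" and u: "u \<in> green_candidates E"
    and k: "k \<ge> 1" and M1: "M1 > 0" and M2: "M2 > 0"
    and LS: "\<And>z. 0 < infdist z E \<Longrightarrow> infdist z E \<le> 1 \<Longrightarrow> M1 * infdist z E powr s \<le> u z"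
    and HCP: "\<And>z. 0 < infdist z E \<Longrightarrow> infdist z E \<le> 1 \<Longrightarrow> u z \<le> M2 * infdist z E powr (1 / k)"
    and R: "R \<ge> 0" "\<And>z. z \<in> E \<Longrightarrow> norm z \<le> R" and s: "s \<ge> 0"
    and \<delta>: "0 < \<delta>" "\<delta> \<le> 1"
    and U: "open U" "enlargement E \<delta> \<subseteq> U" "f holomorphic_on U"
    and F: "F \<ge> 0" "\<And>z. infdist z E \<le> \<delta> \<Longrightarrow> norm (f z) \<le> F"
  shows "poly_dist E f n \<le> ennreal (384 * (2 * R + 9)\<^sup>2 * exp M2 * F * \<delta> powr (- 2) *
      (real (n + 1) powr (k + 1) * exp (- (M1 / 2 powr s * real (n + 1) * \<delta> powr s))))"
proof -
  define N where "N = n + 1"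
  have N: "N > 0" "real N \<ge> 1" by (auto simp: N_def)
  have bE: "bounded E" using E compact_imp_bounded by blast
  have infE: "infinite E" using infinite_if_green_candidate[OF u bE E(2)] .
  obtain A where A: "finite A" "A \<subseteq> E" "card A = N"
    and L: "\<And>a z. a \<in> A \<Longrightarrow> z \<in> E \<Longrightarrow> norm (poly (lagrange_basis A a) z) \<le> 2"
    using ex_near_fekete_set[OF bE infE, of N] by blast
  define p where "p = (\<Sum>a\<in>A. smult (f a) (lagrange_basis A a))"
  define \<eta> where "\<eta> = \<delta> / 4 * real N powr (- k)"
  have Nk: "0 < real N powr (- k)" "real N powr (- k) \<le> 1"
    using N k by (auto simp: powr_minus_divide ge_one_powr_ge_zero)
  have "\<delta> / 4 * real N powr (- k) \<le> \<delta> / 4 * 1" using Nk \<delta> by (intro mult_left_mono) auto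
  then have \<eta>: "0 < \<eta>" "\<eta> \<le> \<delta> / 4" using Nk \<delta> by (auto simp: \<eta>_def)
  define c0 where "c0 = M1 / 2 powr s"
  define B where "B = (2 * real N + 1) / \<eta> * exp M2 * exp (- (c0 * real N * \<delta> powr s))"
  have Bpos: "B \<ge> 0" using \<eta> by (simp add: B_def)
  have Bbound: "norm (1 / (\<zeta> - z) - (\<Sum>a\<in>A. poly (lagrange_basis A a) z / (\<zeta> - a))) \<le> B"
    if z: "z \<in> E" "z \<notin> A" and \<zeta>: "\<delta> / 2 \<le> infdist \<zeta> E" "infdist \<zeta> E \<le> \<delta>" for z \<zeta>
  proof -
    have "norm (1 / (\<zeta> - z) - (\<Sum>a\<in>A. poly (lagrange_basis A a) z / (\<zeta> - a)))
        \<le> (2 * real N + 1) / \<eta> * exp (real N * (M2 * \<eta> powr (1 / k))) * exp (- real N * u \<zeta>)"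
    proof (rule interpolation_kernel_bound[OF E u A N(1) z _ \<eta>(1)])
      show "norm (poly (lagrange_basis A a) z) \<le> 2" if "a \<in> A" for a using L[OF that z(1)] .
      show "u \<xi> \<le> M2 * \<eta> powr (1 / k)" if "infdist \<xi> E = \<eta>" for \<xi>
        using HCP[of \<xi>] that \<eta> \<delta> by simp
      show "\<eta> < infdist \<zeta> E" using \<zeta>(1) \<eta> \<delta> by linarith
    qed
    also have "\<dots> \<le> (2 * real N + 1) / \<eta> * exp M2 * exp (- (c0 * real N * \<delta> powr s))"
    proof (intro mult_mono)
      have "\<eta> powr (1 / k) = (\<delta> / 4) powr (1 / k) * real N powr (- 1)"
        unfolding \<eta>_def using \<delta> N k by (subst powr_mult) (auto simp: powr_powr)
      also have "\<dots> \<le> 1 * real N powr (- 1)"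
        using \<delta> k by (intro mult_right_mono powr_le1) auto
      finally have "real N * \<eta> powr (1 / k) \<le> real N * real N powr (- 1)"
        using N by (intro mult_left_mono) auto
      also have "\<dots> = 1" using N by (simp add: powr_minus)
      finally have "M2 * (real N * \<eta> powr (1 / k)) \<le> M2 * 1" using M2 by (intro mult_left_mono) auto
      then show "exp (real N * (M2 * \<eta> powr (1 / k))) \<le> exp M2" by (simp add: mult_ac)
      have "c0 * \<delta> powr s = M1 * (\<delta> / 2) powr s" using \<delta> by (simp add: c0_def powr_divide)
      also have "\<dots> \<le> M1 * infdist \<zeta> E powr s"
        using M1 s \<zeta> \<delta> by (intro mult_left_mono powr_mono2) auto
      also have "\<dots> \<le> u \<zeta>" using \<zeta> \<delta> by (intro LS) auto
      finally have "real N * (c0 * \<delta> powr s) \<le> real N * u \<zeta>" by (intro mult_left_mono) auto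
      then show "exp (- real N * u \<zeta>) \<le> exp (- (c0 * real N * \<delta> powr s))" by (simp add: mult_ac)
    qed (use \<eta> in auto)
    finally show ?thesis by (simp add: B_def)
  qed
  have err: "norm (f z - poly p z) \<le> 32 * (2 * R + 9)\<^sup>2 / \<delta> * F * B" if z: "z \<in> E" for z
  proof (cases "z \<in> A")
    case True
    have "poly p z = (\<Sum>a\<in>A. if a = z then f a else 0)"
      unfolding p_def poly_sum using True A(1)
      by (intro sum.cong) (auto simp: poly_lagrange_basis_node)
    then have "poly p z = f z" using True A(1) by simp
    then show ?thesis using F(1) Bpos \<delta> by simp
  next
    case False
    \<comment> \<open>The masses of the functional that maps \<open>f\<close> to its interpolation error at \<open>z\<close>.\<close>
    define c where "c = (\<lambda>a. if a = z then 1 else - poly (lagrange_basis A a) z)"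
    have "norm (\<Sum>a\<in>insert z A. c a * f a) \<le> 32 * (2 * R + 9)\<^sup>2 / \<delta> * F * B"
    proof (rule cauchy_transform_estimate[where w = "\<lambda>a. a", OF E(3) R(2,1) \<delta> U _ _ F Bpos])
      show "finite (insert z A)" using A by simp
      show "a \<in> E" if "a \<in> insert z A" for a using that A z by auto
      fix \<zeta> assume \<zeta>: "\<delta> / 2 \<le> infdist \<zeta> E" "infdist \<zeta> E \<le> \<delta>"
      have "(\<Sum>a\<in>insert z A. c a / (\<zeta> - a)) = 1 / (\<zeta> - z) + (\<Sum>a\<in>A. c a / (\<zeta> - a))"
        using A False by (simp add: c_def)
      also have "(\<Sum>a\<in>A. c a / (\<zeta> - a)) = - (\<Sum>a\<in>A. poly (lagrange_basis A a) z / (\<zeta> - a))"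
        unfolding sum_negf[symmetric] using False by (intro sum.cong) (auto simp: c_def)
      finally show "norm (\<Sum>a\<in>insert z A. c a / (\<zeta> - a)) \<le> B"
        using Bbound[OF z False \<zeta>] by simp
    qed
    moreover have "(\<Sum>a\<in>insert z A. c a * f a) = f z - poly p z"
    proof -
      have "(\<Sum>a\<in>insert z A. c a * f a) = f z + (\<Sum>a\<in>A. c a * f a)"
        using A False by (simp add: c_def)
      also have "(\<Sum>a\<in>A. c a * f a) = - (\<Sum>a\<in>A. f a * poly (lagrange_basis A a) z)"
        unfolding sum_negf[symmetric] using False by (intro sum.cong) (auto simp: c_def)
      finally show ?thesis by (simp add: p_def poly_sum)
    qed
    ultimately show ?thesis by simp
  qed
  have "degree p \<le> n"
    unfolding p_def
  proof (intro degree_sum_le[OF A(1)])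
    fix a assume "a \<in> A"
    then show "degree (smult (f a) (lagrange_basis A a)) \<le> n"
      using degree_lagrange_basis[OF A(1), of a] A(3) degree_smult_le[of "f a" "lagrange_basis A a"]
      by (simp add: N_def)
  qed
  then have "poly_dist E f n \<le> ennreal (32 * (2 * R + 9)\<^sup>2 / \<delta> * F * B)"
    using err by (rule poly_dist_le)
  also have "\<dots> \<le> ennreal (384 * (2 * R + 9)\<^sup>2 * exp M2 * F * \<delta> powr (- 2) *
      (real N powr (k + 1) * exp (- (c0 * real N * \<delta> powr s))))"
  proof (rule ennreal_leI)
    have "(2 * real N + 1) / \<eta> \<le> 3 * real N / \<eta>" using N \<eta> by (intro divide_right_mono) auto
    also have "\<dots> = 12 / \<delta> * real N powr (k + 1)"
      using \<delta> N by (simp add: \<eta>_def powr_add powr_minus field_simps)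
    finally have "B \<le> 12 / \<delta> * real N powr (k + 1) * exp M2 * exp (- (c0 * real N * \<delta> powr s))"
      unfolding B_def by (intro mult_right_mono) auto
    then have "32 * (2 * R + 9)\<^sup>2 / \<delta> * F * B \<le> 32 * (2 * R + 9)\<^sup>2 / \<delta> * F *
        (12 / \<delta> * real N powr (k + 1) * exp M2 * exp (- (c0 * real N * \<delta> powr s)))"
      using F \<delta> by (intro mult_left_mono) auto
    also have "\<dots> = 384 * (2 * R + 9)\<^sup>2 * exp M2 * F * \<delta> powr (- 2) *
      (real N powr (k + 1) * exp (- (c0 * real N * \<delta> powr s)))"
      using \<delta> by (simp add: powr_minus powr_numeral power2_eq_square field_simps)
    finally show "32 * (2 * R + 9)\<^sup>2 / \<delta> * F * B \<le> 384 * (2 * R + 9)\<^sup>2 * exp M2 * F * \<delta> powr (- 2) *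
      (real N powr (k + 1) * exp (- (c0 * real N * \<delta> powr s)))" .
  qed
  finally show ?thesis by (simp add: N_def c0_def)
qed

lemma powr_mult_exp_le:
  fixes x q :: real
  assumes "x > 0" "q > 0"
  shows "x powr q * exp (- x) \<le> q powr q"
proof -
  have "ln (x / q) \<le> x / q - 1" using assms by (intro ln_le_minus_one) auto
  then have "q * (ln x - ln q) \<le> q * (x / q - 1)"
    using assms by (intro mult_left_mono) (auto simp: ln_div)
  then have "q * ln x - x \<le> q * ln q" using assms by (simp add: algebra_simps)
  then have "exp (q * ln x - x) \<le> exp (q * ln q)" by simp
  then show ?thesis using assms by (simp add: powr_def exp_diff exp_minus divide_inverse)
qed

lemma power_mult_exp_decay_le:
  fixes N k a :: real
  assumes "N \<ge> 1" "a > 0" "k \<ge> 0" "l \<ge> 1"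
  shows "N ^ l * (N powr k * exp (- (a * N))) \<le> ((real l + k) / a) powr (real l + k)"
proof -
  have "N ^ l * N powr k = N powr (real l + k)"
    using assms by (simp add: powr_add powr_realpow)
  then have "N ^ l * (N powr k * exp (- (a * N))) = (1 / a) powr (real l + k) * ((a * N) powr (real l + k) * exp (- (a * N)))"
    using assms by (simp add: powr_mult powr_divide flip: mult.assoc)
  also have "\<dots> \<le> (1 / a) powr (real l + k) * (real l + k) powr (real l + k)"
    using assms by (intro mult_left_mono powr_mult_exp_le) auto
  also have "\<dots> = ((real l + k) / a) powr (real l + k)"
    using assms by (simp add: powr_divide)
  finally show ?thesis .
qed

text \<open>The Hoelder bound makes the Green's function finite at some point outside \<open>E\<close>, so that a candidate
exists. Both inequalities can then be read for the single harmonic function that attains the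
Green's function.\<close>

lemma polynomially_convex_LS_HCP_constants:
  assumes E: "compact E" "E = poly_hull E" "E \<noteq> {}" and LS: "Lojasiewicz_Siciak s E"
    and HCP: "Hoelder_continuity_property E"
  obtains u M1 M2 k where "u \<in> green_candidates E" "M1 > 0" "M2 > 0" "k \<ge> 1"
    "\<And>z. 0 < infdist z E \<Longrightarrow> infdist z E \<le> 1 \<Longrightarrow> M1 * infdist z E powr s \<le> u z"
    "\<And>z. 0 < infdist z E \<Longrightarrow> infdist z E \<le> 1 \<Longrightarrow> u z \<le> M2 * infdist z E powr (1 / k)"
proof -
  obtain M1 where M1: "M1 > 0" "\<And>z. z \<in> enlargement E 1 \<Longrightarrow> green_function E z \<ge> ennreal (M1 * infdist z E powr s)"
    using LS unfolding Lojasiewicz_Siciak_def by blast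
  obtain k M2 where k: "k \<ge> 1" and M2: "M2 \<ge> 1"
    "\<And>z. z \<in> enlargement E 1 \<Longrightarrow> green_function E z \<le> ennreal (M2 * infdist z E powr (1 / k))"
    using HCP unfolding Hoelder_continuity_property_def HCP_exponent_def by blast
  obtain z where z: "z \<in> enlargement E 1" "z \<notin> E"
  proof -
    have "\<not> open E"
      using E clopen[of E] compact_imp_closed[OF E(1)] not_compact_UNIV by metis
    then obtain b where b: "b \<in> E" "\<not> ball b 1 \<subseteq> E" by (meson open_contains_ball zero_less_one)
    from b(2) obtain z where z: "z \<in> ball b 1" "z \<notin> E" by blast
    then have "infdist z E \<le> 1" using infdist_le[OF b(1), of z] by (simp add: dist_commute)
    then show thesis using that z E(3) by (auto simp: enlargement_def)
  qed
  have "green_function E z \<noteq> \<infinity>" using M2(2)[OF z(1)] by (auto simp: top_unique)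
  then have "green_candidates E \<noteq> {}" using z(2) E(2) by (auto simp: green_function_def)
  then obtain u where u: "u \<in> green_candidates E" "\<And>z. z \<notin> E \<Longrightarrow> green_function E z = ennreal (u z)"
    using green_function_attained[OF E(1,2)] by blast
  have u0: "u z \<ge> 0" if "z \<notin> E" for z using u(1) that E(2) by (auto simp: green_candidates_def)
  have notE: "z \<notin> E" if "0 < infdist z E" for z using that by auto
  show thesis
  proof (rule that[OF u(1) M1(1) _ k])
    fix z assume z: "0 < infdist z E" "infdist z E \<le> 1"
    have zE: "z \<in> enlargement E 1" using z(2) E(3) by (simp add: enlargement_def)
    show "M1 * infdist z E powr s \<le> u z"
      using M1(2)[OF zE] u(2)[OF notE[OF z(1)]] u0[OF notE[OF z(1)]] by simp
    show "u z \<le> M2 * infdist z E powr (1 / k)"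
      using M2(2)[OF zE] u(2)[OF notE[OF z(1)]] M2(1) by (simp add: ennreal_le_iff)
  qed (use M2 in simp)
qed

lemma rapid_approx_if_power_bounds:
  assumes f: "continuous_on E f"
    and b: "\<And>l. l \<ge> 1 \<Longrightarrow> \<exists>C\<ge>0. \<forall>n\<ge>1. of_nat n ^ l * poly_dist E f n \<le> ennreal C"
  shows "f \<in> rapid_approx E"
proof -
  have "(\<lambda>n. of_nat n ^ l * poly_dist E f n) \<longlonglongrightarrow> 0" for l
  proof -
    obtain C where C: "C \<ge> 0" "\<And>n. n \<ge> 1 \<Longrightarrow> of_nat n ^ Suc l * poly_dist E f n \<le> ennreal C"
      using b[of "Suc l"] by auto
    have bound: "of_nat n ^ l * poly_dist E f n \<le> ennreal (C / real n)" if n: "n \<ge> 1" for n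
    proof -
      have "of_nat n ^ l * poly_dist E f n = ennreal (1 / real n) * (of_nat n ^ Suc l * poly_dist E f n)"
      proof -
        have "ennreal (1 / real n) * of_nat n = 1"
          using n by (simp add: ennreal_of_nat_eq_real_of_nat ennreal_mult[symmetric])
        then show ?thesis by (simp flip: mult.assoc)
      qed
      also have "\<dots> \<le> ennreal (1 / real n) * ennreal C" by (intro mult_left_mono C n) simp
      also have "\<dots> = ennreal (C / real n)" using C(1) by (simp add: ennreal_mult[symmetric])
      finally show ?thesis .
    qed
    show ?thesis
    proof (rule tendsto_sandwich[OF _ _ tendsto_const])
      show "\<forall>\<^sub>F n in sequentially. 0 \<le> of_nat n ^ l * poly_dist E f n" by simp
      show "\<forall>\<^sub>F n in sequentially. of_nat n ^ l * poly_dist E f n \<le> ennreal (C / real n)"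
        using eventually_ge_at_top[of "1::nat"] by eventually_elim (rule bound)
      have "(\<lambda>n. ennreal (C / real n)) \<longlonglongrightarrow> ennreal 0"
        by (intro tendsto_ennrealI lim_const_over_n)
      then show "(\<lambda>n. ennreal (C / real n)) \<longlonglongrightarrow> 0" by simp
    qed
  qed
  then show ?thesis using f by (simp add: rapid_approx_def)
qed

text \<open>The bounds on the interpolation error, multiplied by \<open>n\<^sup>l\<close>, are at most a constant times
\<open>\<delta>^(-2) ((l + k + 1) / (c0 \<delta>\<^sup>s))^(l + k + 1)\<close>. The additive constant \<open>c\<close> in the
exponent \<open>l + c\<close> absorbs \<open>k + 1\<close>, the factor \<open>\<delta>^(-2)\<close> (because \<open>s \<ge> 1\<close>) and the constant factor, so
that \<open>v = 1\<close> suffices.\<close>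

theorem LS_HCP_imp_jackson:
  assumes s: "1 \<le> s" and E: "compact E" "polynomially_convex E"
    and LS: "Lojasiewicz_Siciak s E" and HCP: "Hoelder_continuity_property E"
  shows "Jackson_property s E"
proof (cases "E = {}")
  case True
  have "sup_norm_on {} f = 0" for f by (simp add: sup_norm_on_def bot_ennreal)
  moreover have "poly_dist {} f n = 0" for f n
    using poly_dist_le[of 0 n "{}" f 0] by simp
  ultimately show ?thesis
    unfolding True Jackson_property_def
    by (auto simp: rapid_approx_def jackson_norm_def intro!: exI[of _ 1])
next
  case ne: False
  have hull: "E = poly_hull E" using E(2) by (simp add: polynomially_convex_def)
  obtain u M1 M2 k where u: "u \<in> green_candidates E" and M: "M1 > 0" "M2 > 0" and k: "k \<ge> 1"
    and low: "\<And>z. 0 < infdist z E \<Longrightarrow> infdist z E \<le> 1 \<Longrightarrow> M1 * infdist z E powr s \<le> u z"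
    and up: "\<And>z. 0 < infdist z E \<Longrightarrow> infdist z E \<le> 1 \<Longrightarrow> u z \<le> M2 * infdist z E powr (1 / k)"
    using polynomially_convex_LS_HCP_constants[OF E(1) hull ne LS HCP] by metis
  obtain R where R: "R > 0" "\<And>z. z \<in> E \<Longrightarrow> norm z \<le> R"
    using compact_imp_bounded[OF E(1)] bounded_pos by blast
  define c0 where "c0 = M1 / 2 powr s"
  have c0: "c0 > 0" using M by (simp add: c0_def)
  define C0 where "C0 = 384 * (2 * R + 9)\<^sup>2 * exp M2"
  have C0: "C0 \<ge> 0" by (simp add: C0_def)
  define Y where "Y = (\<lambda>l \<delta>. (real l + (k + 1)) / (c0 * \<delta> powr s))"
  define b where "b = (\<lambda>l \<delta>. C0 * \<delta> powr (- 2) * Y l \<delta> powr (real l + (k + 1)))"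
  have b: "of_nat n ^ l * poly_dist E f n \<le> ennreal (b l \<delta> * F)"
    if l: "l \<ge> 1" and \<delta>: "0 < \<delta>" "\<delta> \<le> 1" and f: "f \<in> H_infinity (enlargement E \<delta>)"
      and F: "F \<ge> 0" "\<And>z. infdist z E \<le> \<delta> \<Longrightarrow> norm (f z) \<le> F" for n l \<delta> f F
  proof -
    obtain U where U: "open U" "enlargement E \<delta> \<subseteq> U" "f holomorphic_on U" using H_infinityD[OF f] by blast
    define e where "e = real (n + 1) powr (k + 1) * exp (- (c0 * \<delta> powr s * real (n + 1)))"
    have "poly_dist E f n \<le> ennreal (384 * (2 * R + 9)\<^sup>2 * exp M2 * F * \<delta> powr (- 2) *
      (real (n + 1) powr (k + 1) * exp (- (M1 / 2 powr s * real (n + 1) * \<delta> powr s))))"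
      using s R(1) by (intro interpolation_error[OF E(1) hull ne u k M low up _ R(2) _ \<delta> U F]) auto
    also have "\<dots> = ennreal (C0 * F * \<delta> powr (- 2) * e)"
      by (simp add: C0_def e_def c0_def mult_ac)
    finally have "of_nat n ^ l * poly_dist E f n \<le> ennreal (real n ^ l) * ennreal (C0 * F * \<delta> powr (- 2) * e)"
      by (simp add: ennreal_of_nat_eq_real_of_nat ennreal_power mult_left_mono)
    also have "\<dots> = ennreal (real n ^ l * (C0 * F * \<delta> powr (- 2) * e))"
      using C0 F(1) by (intro ennreal_mult[symmetric]) (auto simp: e_def)
    also have "\<dots> \<le> ennreal (b l \<delta> * F)"
    proof (rule ennreal_leI)
      have "real n ^ l * e \<le> real (n + 1) ^ l * e" by (intro mult_right_mono power_mono) (auto simp: e_def)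
      also have "\<dots> \<le> Y l \<delta> powr (real l + (k + 1))"
        unfolding e_def Y_def using c0 \<delta> k l by (intro power_mult_exp_decay_le) auto
      finally have "C0 * F * \<delta> powr (- 2) * (real n ^ l * e) \<le> C0 * F * \<delta> powr (- 2) * Y l \<delta> powr (real l + (k + 1))"
        using C0 F(1) by (intro mult_left_mono) auto
      then show "real n ^ l * (C0 * F * \<delta> powr (- 2) * e) \<le> b l \<delta> * F"
        by (simp add: b_def mult_ac)
    qed
    finally show ?thesis .
  qed
  have "H_infinity E \<subseteq> rapid_approx E"
  proof
    fix f assume f: "f \<in> H_infinity E"
    obtain U where U: "open U" "E \<subseteq> U" "\<And>z. z \<in> U \<Longrightarrow> dbar f z = 0" and C: "\<And>k. Ck_on k UNIV f"
      using f by (auto simp: H_infinity_def)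
    obtain e where e: "e > 0" "{x. infdist x E \<le> e} \<subseteq> U"
      using compact_in_open_separated[OF ne E(1) U(1,2)] by metis
    define \<delta> where "\<delta> = min e 1"
    have \<delta>: "0 < \<delta>" "\<delta> \<le> 1" using e by (auto simp: \<delta>_def)
    have sub: "enlargement E \<delta> \<subseteq> U" using e(2) by (auto simp: enlargement_def \<delta>_def)
    then have f\<delta>: "f \<in> H_infinity (enlargement E \<delta>)" using U C by (auto simp: H_infinity_def)
    have cont: "continuous_on UNIV f" using C[of 0] by simp
    have "compact {z. infdist z E \<le> \<delta>}" using \<delta> by (intro compact_infdist_le[OF ne E(1)]) auto
    then have "bounded (f ` {z. infdist z E \<le> \<delta>})"
      by (intro compact_imp_bounded compact_continuous_image continuous_on_subset[OF cont]) auto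
    then obtain F where F: "F > 0" "\<And>z. infdist z E \<le> \<delta> \<Longrightarrow> norm (f z) \<le> F"
      by (auto simp: bounded_pos)
    show "f \<in> rapid_approx E"
    proof (rule rapid_approx_if_power_bounds)
      show "continuous_on E f" using cont continuous_on_subset by blast
      fix l :: nat assume "l \<ge> 1"
      then show "\<exists>C\<ge>0. \<forall>n\<ge>1. of_nat n ^ l * poly_dist E f n \<le> ennreal C"
        using b[OF _ \<delta> f\<delta> _ F(2)] F(1) C0 by (intro exI[of _ "b l \<delta> * F"]) (auto simp: b_def)
    qed
  qed
  moreover have "\<exists>c\<ge>1. \<exists>v\<ge>1. \<forall>l::nat. l \<ge> 1 \<longrightarrow> (\<forall>\<delta>. 0 < \<delta> \<and> \<delta> \<le> 1 \<longrightarrow>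
       (\<forall>f\<in>H_infinity (enlargement E \<delta>).
          jackson_norm E l f \<le> ennreal ((c * real l powr v / \<delta> powr s) powr (real l + c)) *
            sup_norm_on (enlargement E \<delta>) f))"
  proof -
    define c where "c = max (max (k + 4) (1 + C0)) ((k + 2) / c0)"
    have c: "c \<ge> k + 4" "c \<ge> 1 + C0" "c \<ge> (k + 2) / c0" by (auto simp: c_def)
    have "jackson_norm E l f \<le> ennreal ((c * real l powr 1 / \<delta> powr s) powr (real l + c)) *
            sup_norm_on (enlargement E \<delta>) f"
      if l: "l \<ge> 1" and \<delta>: "0 < \<delta>" "\<delta> \<le> 1" and f: "f \<in> H_infinity (enlargement E \<delta>)" for l \<delta> f
    proof -
      define X where "X = c * real l / \<delta> powr s"
      have ds: "0 < \<delta> powr s" "\<delta> powr s \<le> 1" using \<delta> s by (auto intro: powr_le1)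
      have cl: "c * real l \<ge> c" using c k l by (simp add: mult_le_cancel_left1)
      have Xc: "X \<ge> c" "X \<ge> 1 / \<delta> powr s"
      proof -
        have "c \<le> c * real l / 1" using cl by simp
        also have "\<dots> \<le> X" unfolding X_def using ds c k by (intro divide_left_mono) auto
        finally show "X \<ge> c" .
        have "1 \<le> c * real l" using cl c(1) k by linarith
        then show "X \<ge> 1 / \<delta> powr s" unfolding X_def using ds by (intro divide_right_mono) auto
      qed
      have X1: "X \<ge> 1" using Xc c k by linarith
      have YX: "Y l \<delta> \<le> X"
      proof -
        have "real l + (k + 1) \<le> (k + 2) * real l"
          using mult_left_mono[of 1 "real l" "k + 1"] k l by (simp add: algebra_simps)
        then have "(real l + (k + 1)) / c0 \<le> (k + 2) / c0 * real l"
          using c0 by (simp add: divide_right_mono)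
        also have "\<dots> \<le> c * real l" using c by (intro mult_right_mono) auto
        finally have "(real l + (k + 1)) / c0 / \<delta> powr s \<le> c * real l / \<delta> powr s"
          using ds by (intro divide_right_mono) auto
        then show ?thesis by (simp add: Y_def X_def)
      qed
      have Y0: "Y l \<delta> \<ge> 0" using c0 k by (simp add: Y_def)
      have bX: "1 + b l \<delta> \<le> X powr (real l + c)"
      proof -
        have "\<delta> powr (- 2) \<le> \<delta> powr (- (2 * s))" using \<delta> s by (intro powr_mono') auto
        also have "\<dots> = (1 / \<delta> powr s) powr 2" using \<delta> by (simp add: powr_divide powr_powr powr_minus_divide mult.commute)
        also have "\<dots> \<le> X powr 2" using Xc ds by (intro powr_mono2) auto
        finally have 1: "\<delta> powr (- 2) \<le> X powr 2" .
        have "\<delta> powr (- 2) * Y l \<delta> powr (real l + (k + 1)) \<le> X powr 2 * X powr (real l + (k + 1))"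
          using 1 YX Y0 k by (intro mult_mono powr_mono2) auto
        also have "\<dots> = X powr (2 + (real l + (k + 1)))" by (rule powr_add[symmetric])
        also have "2 + (real l + (k + 1)) = real l + k + 3" by simp
        finally have "\<delta> powr (- 2) * Y l \<delta> powr (real l + (k + 1)) \<le> X powr (real l + k + 3)" .
        then have "b l \<delta> \<le> C0 * X powr (real l + k + 3)"
          using C0 by (simp add: b_def mult.assoc mult_left_mono)
        moreover have "1 \<le> X powr (real l + k + 3)" using X1 k by (intro ge_one_powr_ge_zero) auto
        ultimately have "1 + b l \<delta> \<le> (1 + C0) * X powr (real l + k + 3)" by (simp add: distrib_right)
        also have "\<dots> \<le> X powr 1 * X powr (real l + k + 3)"
          using Xc c X1 by (intro mult_right_mono) auto
        also have "\<dots> = X powr (1 + (real l + k + 3))" by (rule powr_add[symmetric])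
        also have "\<dots> \<le> X powr (real l + c)" using X1 c by (intro powr_mono) auto
        finally show ?thesis .
      qed
      have Xpos: "X powr (real l + c) > 0" using X1 by simp
      show ?thesis
      proof (cases "sup_norm_on (enlargement E \<delta>) f")
        case top
        then show ?thesis using Xpos by (simp add: X_def ennreal_mult_top)
      next
        case (real F)
        have F: "norm (f z) \<le> F" if "infdist z E \<le> \<delta>" for z
        proof -
          have "z \<in> enlargement E \<delta>" using that ne by (simp add: enlargement_def)
          from sup_norm_on_upper[OF this, of f] show ?thesis using real by simp
        qed
        have "sup_norm_on E f \<le> ennreal F"
          unfolding sup_norm_on_le_iff using F \<delta> by (auto intro!: ennreal_leI)
        moreover have "(SUP n\<in>{1..}. of_nat n ^ l * poly_dist E f n) \<le> ennreal (b l \<delta> * F)"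
          using b[OF l \<delta> f real(1) F] by (intro SUP_least)
        ultimately have "jackson_norm E l f \<le> ennreal F + ennreal (b l \<delta> * F)"
          unfolding jackson_norm_def by (rule add_mono)
        also have "\<dots> = ennreal ((1 + b l \<delta>) * F)"
          using real C0 by (subst ennreal_plus[symmetric]) (auto simp: b_def distrib_right)
        also have "\<dots> \<le> ennreal (X powr (real l + c) * F)"
          using bX real by (intro ennreal_leI mult_right_mono) auto
        also have "\<dots> = ennreal (X powr (real l + c)) * sup_norm_on (enlargement E \<delta>) f"
          using real by (simp add: ennreal_mult)
        finally show ?thesis using l by (simp add: X_def)
      qed
    qed
    moreover have "c \<ge> 1" using c k by linarith
    ultimately show ?thesis by (intro exI[of _ c] conjI exI[of _ 1]) auto
  qed
  ultimately show ?thesis unfolding Jackson_property_def by blast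
qed

theorem theorem1p4:
  fixes s s' :: real
  assumes "1 \<le> s" and "s < s'"
  shows "(\<forall>E. compact E \<and> polynomially_convex E \<and> Lojasiewicz_Siciak s E \<and>
              Hoelder_continuity_property E \<longrightarrow> Jackson_property s E) \<and>
         (\<forall>E. compact E \<and> Jackson_property s E \<longrightarrow> Lojasiewicz_Siciak s' E)"
  using LS_HCP_imp_jackson[OF assms(1)] jackson_imp_LS[OF assms] by blast

end
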